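(* Every planar graph $G$ is equitable list point $k$-arborable for every integer $k\geq \max\{\lceil (\Delta(G)+1)/2\rceil,5\}$, where $\Delta(G)$ is the maximum degree of $G$.
   Context: All graphs are finite, simple and undirected. A $k$-list assignment of a graph $G$ assigns to each vertex $v$ a set (list) $L(v)$ of $k$ colors. A graph $G$ is equitable list point $k$-arborable if for every $k$-list assignment $L$ one can choose $c(v)\in L(v)$ for each vertex $v$ such that each color class induces an acyclic subgraph (a forest) of $G$ and each color appears on at most $\lceil |V(G)|/k\rceil$ vertices of $G$. *)

theory Defs
  imports "HOL-Analysis.Analysis" "Graph_Theory.Graph_Theory"
begin

text \<open>
  A finite simple undirected graph is an instance of the locale predicate \<^const>\<open>graph\<close>: a finite
  symmetric digraph without loops and parallel arcs, so that every undirected edge \<open>uv\<close>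
  is represented by the two opposite arcs from \<open>u\<close> to \<open>v\<close> and from \<open>v\<close> to \<open>u\<close>.
\<close>

definition undirected_edges :: "('a, 'b) pre_digraph \<Rightarrow> 'a set set" where
  "undirected_edges G = {{u, v} | u v. u \<rightarrow>\<^bsub>G\<^esub> v}"

text \<open>
  In a symmetric digraph \<^const>\<open>out_degree\<close> is the number of undirected edges at a vertex.
  The inserted \<open>0\<close> only matters for the graph without vertices.
\<close>

definition max_degree :: "('a, 'b) pre_digraph \<Rightarrow> nat" where
  "max_degree G = Max (insert 0 (out_degree G ` verts G))"

text \<open>
  The library predicate \<^const>\<open>forest\<close> is not the undirected notion: it counts traversing one edge
  back and forth as a (directed) cycle of length 2. The cycles of a simple undirected graph are
  the directed cycles of length at least 3 of its symmetric digraph.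
\<close>

definition undirected_acyclic :: "('a, 'b) pre_digraph \<Rightarrow> bool" where
  "undirected_acyclic G \<longleftrightarrow> \<not> (\<exists>p. pre_digraph.cycle G p \<and> 3 \<le> length p)"

text \<open>
  Crossing-free drawings in the plane, with \<^typ>\<open>complex\<close> as the Euclidean plane: distinct
  vertices are distinct points, each edge is a simple arc joining its two ends, and the interior
  of an edge contains no vertex and no point of any other edge.
\<close>

definition plane_drawing ::
    "('a, 'b) pre_digraph \<Rightarrow> ('a \<Rightarrow> complex) \<Rightarrow> ('a set \<Rightarrow> real \<Rightarrow> complex) \<Rightarrow> bool" where
  "plane_drawing G \<phi> \<gamma> \<longleftrightarrow>
     inj_on \<phi> (verts G) \<and>
     (\<forall>e \<in> undirected_edges G.
        arc (\<gamma> e) \<and> {pathstart (\<gamma> e), pathfinish (\<gamma> e)} = \<phi> ` e \<and>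
        (path_image (\<gamma> e) - \<phi> ` e) \<inter> \<phi> ` verts G = {} \<and>
        (\<forall>e' \<in> undirected_edges G. e' \<noteq> e \<longrightarrow>
           (path_image (\<gamma> e) - \<phi> ` e) \<inter> path_image (\<gamma> e') = {}))"

definition planar_graph :: "('a, 'b) pre_digraph \<Rightarrow> bool" where
  "planar_graph G \<longleftrightarrow> (\<exists>\<phi> \<gamma>. plane_drawing G \<phi> \<gamma>)"

definition list_assignment :: "('a, 'b) pre_digraph \<Rightarrow> nat \<Rightarrow> ('a \<Rightarrow> 'c set) \<Rightarrow> bool" where
  "list_assignment G k L \<longleftrightarrow> (\<forall>v \<in> verts G. finite (L v) \<and> card (L v) = k)"

text \<open>The type argument is the (arbitrary) type the colours are taken from.\<close>

definition equitable_list_point_arborable ::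
    "'c itself \<Rightarrow> ('a, 'b) pre_digraph \<Rightarrow> nat \<Rightarrow> bool" where
  "equitable_list_point_arborable (_ :: 'c itself) G k \<longleftrightarrow>
     (\<forall>L :: 'a \<Rightarrow> 'c set. list_assignment G k L \<longrightarrow>
        (\<exists>c. (\<forall>v \<in> verts G. c v \<in> L v) \<and>
             (\<forall>x. undirected_acyclic (G \<restriction> {v \<in> verts G. c v = x}) \<and>
                  int (card {v \<in> verts G. c v = x}) \<le> \<lceil>real (card (verts G)) / real k\<rceil>)))"

end

theory Submission
  imports Defs
begin

text \<open>
  Colour greedily from a set \<open>S\<close> of \<open>k\<close> vertices: given a colouring of \<open>G - S\<close>, the vertices
  \<open>x\<^sub>k, \<dots>, x\<^sub>1\<close> of \<open>S\<close> can be given distinct colours, each occurring at most once on the neighbours of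
  its vertex outside \<open>S\<close>, provided that \<open>x\<^sub>i\<close> has at most \<open>2i - 1\<close> neighbours outside \<open>S\<close>. Then no
  colour class acquires a cycle and every class grows by at most one.

  The set \<open>S\<close> is found by discharging. Euler's formula enters in the following form: a plane graph
  has a set \<open>T\<close> of triangles (its triangular faces) such that every edge lies in at most two of them
  and \<open>|T| \<ge> 2|E| - 4|V| + 6\<close>. This is proved without faces, by induction on the number of edges,
  from the Jordan curve theorem: a cycle splits the graph into an inner and an outer part, the outer
  one is turned inside out by an inversion, and a path through a disc splits it by the theta curve
  theorem. Giving each vertex the charge \<open>deg - 4\<close>, the total charge is less than \<open>|T|\<close>; but if no
  suitable \<open>S\<close> exists, the vertices can pay 1 to every triangle of \<open>T\<close>. Indices \<open>i \<ge> 3\<close> not needed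
  for the local configuration are filled by 5-degeneracy.
\<close>

section \<open>Walks and cycles as vertex lists\<close>

text \<open>The charge deg - 4 comes from Euler's formula in the form sum (deg v - 4) + sum (len f -
  4) = -8 for a connected plane graph: only triangular faces are in debt, each by 1. A set
  \<open>T\<close> of triangles can therefore stand in for the faces, and discharging asks of it
  only that it is large and that no edge lies in more than two members. The thresholds come from the
  indices. Index i tolerates 2i - 1 neighbours outside \<open>S\<close>, so the degree bound 2k - 1
  lets any vertex take index k, and the obstacle is at the bottom: index 1 needs a vertex with at
  most one outer neighbour, index 2 one with at most three. A vertex of degree 4 or 5 gets there
  only if most of its neighbours are also in \<open>S\<close>. Those neighbours may have large
  degree and must occupy the indices k, k - 1, k - 2. Three places at the top and two at the bottom
  are disjoint exactly when k is at least 5. Distinct colours on a set of k vertices are what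
  controls the class sizes: the cap rises by exactly one when k vertices are added, whatever the
  lists are.\<close>

fun walk_edges :: "'a list \<Rightarrow> 'a set set" where
  "walk_edges (x # y # zs) = insert {x, y} (walk_edges (y # zs))"
| "walk_edges _ = {}"

definition cycle_edges :: "'a list \<Rightarrow> 'a set set" where
  "cycle_edges cs = walk_edges (cs @ [hd cs])"

lemma walk_edges_append:
  "walk_edges (xs @ a # ys) = walk_edges (xs @ [a]) \<union> walk_edges (a # ys)"
  by (induction xs rule: walk_edges.induct) auto

lemma walk_edges_rev: "walk_edges (rev xs) = walk_edges xs"
proof (induction xs rule: walk_edges.induct)
  case (1 x y zs)
  have "walk_edges (rev zs @ [y, x]) = walk_edges (rev zs @ [y]) \<union> walk_edges [y, x]"
    by (rule walk_edges_append)
  with 1 show ?case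
    by (simp add: insert_commute)
qed auto

lemma walk_edges_subset: "e \<in> walk_edges xs \<Longrightarrow> e \<subseteq> set xs"
  by (induction xs rule: walk_edges.induct) auto

lemma finite_walk_edges [simp]: "finite (walk_edges xs)"
  by (induction xs rule: walk_edges.induct) auto

lemma card_walk_edges: "distinct xs \<Longrightarrow> card (walk_edges xs) = length xs - 1"
proof (induction xs rule: walk_edges.induct)
  case (1 x y zs)
  then have "{x, y} \<notin> walk_edges (y # zs)"
    using walk_edges_subset by fastforce
  with 1 show ?case by simp
qed auto

lemma Union_walk_edges: "2 \<le> length xs \<Longrightarrow> \<Union> (walk_edges xs) = set xs"
proof (induction xs rule: walk_edges.induct)
  case (1 x y zs)
  then show ?case by (cases zs) auto
qed auto

lemma walk_edges_ends_notin:
  assumes "distinct (x # ys @ [z])" "ys \<noteq> []"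
  shows "{x, z} \<notin> walk_edges (x # ys @ [z])"
proof -
  obtain y ys' where "ys = y # ys'" using assms by (cases ys) auto
  with assms show ?thesis
    using walk_edges_subset[of "{x, z}" "y # ys' @ [z]"] by (auto simp: doubleton_eq_iff)
qed

lemma walk_edges_no_triangle:
  assumes "distinct xs" "card t = 3" "\<forall>x\<in>t. \<forall>y\<in>t. x \<noteq> y \<longrightarrow> {x, y} \<in> walk_edges xs"
  shows False
  using assms
proof (induction xs rule: walk_edges.induct)
  case (1 x y zs)
  have notin: "{x, b} \<notin> walk_edges (y # zs)" for b
    using 1(2) walk_edges_subset by fastforce
  show ?case
  proof (cases "x \<in> t")
    case True
    have "t \<subseteq> {x, y}"
    proof
      fix b assume b: "b \<in> t"
      show "b \<in> {x, y}"
      proof (rule ccontr)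
        assume "b \<notin> {x, y}"
        then have "{x, b} \<in> walk_edges (x # y # zs)"
          using 1(4) True b by (metis insertI1)
        then have "{x, b} = {x, y}" using notin by simp
        with \<open>b \<notin> {x, y}\<close> show False by (auto simp: doubleton_eq_iff)
      qed
    qed
    then have "card t \<le> card {x, y}" by (intro card_mono) auto
    also have "\<dots> \<le> 2" by (simp add: card_insert_if)
    finally show False using 1(3) by simp
  next
    case False
    then have "\<forall>a\<in>t. \<forall>b\<in>t. a \<noteq> b \<longrightarrow> {a, b} \<in> walk_edges (y # zs)"
      using 1(4) by (auto simp: doubleton_eq_iff)
    with 1 show False by auto
  qed
next
  case ("2_1")
  then have "t \<noteq> {}" by auto
  then obtain x where x: "x \<in> t" by auto
  then have "t = {x}" using "2_1" by auto
  with "2_1" show ?case by simp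
next
  case ("2_2" v)
  then have "t \<noteq> {}" by auto
  then obtain x where x: "x \<in> t" by auto
  then have "t = {x}" using "2_2" by auto
  with "2_2" show ?case by simp
qed

lemma cycle_edges_split:
  "cycle_edges (a # xs @ b # ys) = walk_edges (a # xs @ [b]) \<union> walk_edges (b # ys @ [a])"
  using walk_edges_append[of "a # xs" b "ys @ [a]"] by (simp add: cycle_edges_def)

lemma cycle_edges_snoc:
  assumes "xs \<noteq> []"
  shows "cycle_edges (xs @ [b]) = insert {b, hd xs} (walk_edges (xs @ [b]))"
  using assms walk_edges_append[of xs b "[hd xs]"] by (auto simp: cycle_edges_def)

lemma cycle_edges_rotate:
  assumes "a \<in> set cs"
  obtains cs' where "cycle_edges (a # cs') = cycle_edges cs" "set (a # cs') = set cs"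
    "length (a # cs') = length cs" "distinct (a # cs') \<longleftrightarrow> distinct cs"
proof -
  obtain l r where cs: "cs = l @ a # r" using assms by (meson split_list)
  show ?thesis
  proof (cases l)
    case Nil
    with cs that[of r] show ?thesis by simp
  next
    case (Cons b l')
    have "cycle_edges (a # r @ l) = cycle_edges cs"
      using cs Cons cycle_edges_split[of a r b l'] cycle_edges_split[of b l' a r] by auto
    then show ?thesis using that[of "r @ l"] cs by auto
  qed
qed

lemma cycle_edges_subset: "e \<in> cycle_edges cs \<Longrightarrow> e \<subseteq> set cs"
  using walk_edges_subset[of e "cs @ [hd cs]"] by (cases cs) (auto simp: cycle_edges_def)

lemma finite_cycle_edges [simp]: "finite (cycle_edges cs)"
  by (simp add: cycle_edges_def)

lemma card_cycle_edges:
  assumes "distinct cs" "3 \<le> length cs"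
  shows "card (cycle_edges cs) = length cs"
proof -
  obtain x ys z where cs: "cs = x # ys @ [z]"
    using assms(2) by (cases cs; cases "tl cs" rule: rev_cases) auto
  with assms have "ys \<noteq> []" by auto
  have "cycle_edges cs = insert {z, x} (walk_edges cs)"
    using cycle_edges_snoc[of "x # ys" z] cs by simp
  moreover have "{z, x} \<notin> walk_edges cs"
    using walk_edges_ends_notin[of x ys z] cs assms \<open>ys \<noteq> []\<close> by (simp add: insert_commute)
  ultimately show ?thesis
    using card_walk_edges[OF assms(1)] assms(2) by simp
qed

text \<open>Without its closing edge the cycle is a path, which carries no triangle. Hence a family
  that covers the closing edge at most once has at most one triangle made of cycle edges.\<close>

lemma cycle_edges_triangle:
  assumes "distinct cs" "3 \<le> length cs" "card t = 3"
    "\<forall>x\<in>t. \<forall>y\<in>t. x \<noteq> y \<longrightarrow> {x, y} \<in> cycle_edges cs"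
  shows "{last cs, hd cs} \<subseteq> t"
proof (rule ccontr)
  assume n: "\<not> {last cs, hd cs} \<subseteq> t"
  obtain ys z where cs: "cs = ys @ [z]" "ys \<noteq> []"
    using assms(2) by (cases cs rule: rev_cases) (simp, fastforce)
  have "\<forall>x\<in>t. \<forall>y\<in>t. x \<noteq> y \<longrightarrow> {x, y} \<in> walk_edges cs"
    using assms(4) n cs by (auto simp: cycle_edges_snoc doubleton_eq_iff)
  with assms walk_edges_no_triangle show False by blast
qed

lemma last_hd_in_cycle_edges: "cs \<noteq> [] \<Longrightarrow> {last cs, hd cs} \<in> cycle_edges cs"
  using walk_edges_append[of "butlast cs" "last cs" "[hd cs]"]
  by (simp add: cycle_edges_def) (metis Un_iff append_butlast_last_id append.assoc append_Cons append_Nil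
      insertI1 walk_edges.simps(1))

lemma rtrancl_imp_distinct_walk:
  assumes "(x, y) \<in> R\<^sup>*"
  shows "\<exists>xs. xs \<noteq> [] \<and> distinct xs \<and> hd xs = x \<and> last xs = y \<and>
     (\<forall>e \<in> walk_edges xs. \<exists>a b. e = {a, b} \<and> (a, b) \<in> R) \<and> (\<forall>z \<in> set xs. (x, z) \<in> R\<^sup>*)"
  using assms
proof (induction rule: rtrancl_induct)
  case base
  then show ?case by (intro exI[of _ "[x]"]) auto
next
  case (step y z)
  then obtain xs where xs: "xs \<noteq> []" "distinct xs" "hd xs = x" "last xs = y"
    "\<forall>e \<in> walk_edges xs. \<exists>a b. e = {a, b} \<and> (a, b) \<in> R" "\<forall>z \<in> set xs. (x, z) \<in> R\<^sup>*" by blast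
  show ?case
  proof (cases "z \<in> set xs")
    case True
    then obtain l r where lr: "xs = l @ z # r" by (meson split_list)
    have "walk_edges (l @ [z]) \<subseteq> walk_edges xs" using walk_edges_append[of l z r] lr by auto
    with xs lr show ?thesis
      by (intro exI[of _ "l @ [z]"]) (auto simp: hd_append)
  next
    case False
    obtain l where l: "xs = l @ [y]" using xs by (metis append_butlast_last_id)
    have "walk_edges (xs @ [z]) = insert {y, z} (walk_edges xs)"
      using walk_edges_append[of l y "[z]"] l by auto
    moreover have "(x, z) \<in> R\<^sup>*" using step by auto
    ultimately show ?thesis
      using xs step False by (intro exI[of _ "xs @ [z]"]) auto
  qed
qed

text \<open>All neighbours of the first vertex of a longest path lie on the path, and a second edge
  at that vertex closes a cycle.\<close>

lemma cycle_exists: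
  assumes "finite V" "V \<noteq> {}" and E: "\<And>e. e \<in> E \<Longrightarrow> e \<subseteq> V \<and> card e = 2"
    and deg: "\<And>v. v \<in> V \<Longrightarrow> 2 \<le> card {e \<in> E. v \<in> e}"
  obtains cs where "distinct cs" "3 \<le> length cs" "set cs \<subseteq> V" "cycle_edges cs \<subseteq> E"
proof -
  define P where "P xs \<longleftrightarrow> xs \<noteq> [] \<and> distinct xs \<and> set xs \<subseteq> V \<and> walk_edges xs \<subseteq> E" for xs
  obtain v where "v \<in> V" using assms by auto
  then have P1: "P [v]" by (simp add: P_def)
  have bound: "\<forall>ys. P ys \<longrightarrow> length ys < Suc (card V)"
    by (metis P_def assms(1) card_mono distinct_card less_Suc_eq_le)
  obtain xs where xs: "P xs" "\<And>ys. P ys \<Longrightarrow> length ys \<le> length xs"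
    using ex_has_greatest_nat[of P "[v]" length, OF P1 bound] by blast
  obtain x xr where x: "xs = x # xr" using xs(1) by (cases xs) (auto simp: P_def)
  have nb: "y \<in> set xr" if e: "{x, y} \<in> E" for y
  proof (rule ccontr)
    assume y: "y \<notin> set xr"
    have "card {x, y} = 2" "y \<in> V" using E[OF e] by auto
    then have "x \<noteq> y" by auto
    then have "P (y # xs)"
      using xs(1) x y e \<open>y \<in> V\<close> by (auto simp: P_def insert_commute)
    from xs(2)[OF this] show False by simp
  qed
  have "x \<in> V" using xs x by (simp add: P_def)
  from deg[OF this] have two: "2 \<le> card {e \<in> E. x \<in> e}" .
  \<comment> \<open>The edge along the path, or an arbitrary pair if \<open>xr\<close> is empty. An
    edge other than \<open>c\<close> ends beyond the second vertex of the path, so the cycle closed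
    by it has length at least 3.\<close>
  define c where "c = {x, hd xr}"
  have "\<not> {e \<in> E. x \<in> e} \<subseteq> {c}"
    using two card_mono[of "{c}" "{e \<in> E. x \<in> e}"] by auto
  then obtain e where e: "e \<in> E" "x \<in> e" "e \<noteq> c" by auto
  then obtain y where y: "e = {x, y}" "x \<noteq> y"
    using E[OF e(1)] by (auto simp: card_2_iff)
  then have "y \<in> set xr" using nb e by auto
  then obtain l r where lr: "xr = l @ y # r" by (meson split_list)
  have "l \<noteq> []" using e y lr c_def by (cases l) auto
  have "walk_edges (x # l @ [y]) \<subseteq> E"
    using xs(1) x lr walk_edges_append[of "x # l" y r] by (auto simp: P_def)
  moreover have "cycle_edges (x # l @ [y]) = insert {y, x} (walk_edges (x # l @ [y]))"
    using cycle_edges_snoc[of "x # l" y] by simp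
  moreover have "{y, x} \<in> E" using e y by (auto simp: insert_commute)
  ultimately have "cycle_edges (x # l @ [y]) \<subseteq> E" by auto
  moreover have "3 \<le> length (x # l @ [y])" using \<open>l \<noteq> []\<close> by (cases l) auto
  ultimately show ?thesis
    using that[of "x # l @ [y]"] xs(1) x lr by (auto simp: P_def)
qed

section \<open>Plane drawings\<close>

definition is_cycle :: "'a set set \<Rightarrow> 'a list \<Rightarrow> bool" where
  "is_cycle E cs \<longleftrightarrow> distinct cs \<and> 3 \<le> length cs \<and> cycle_edges cs \<subseteq> E"

text \<open>\<open>plane_drawing\<close> restated for a vertex set and an edge set, so that
  subgraphs and injective continuous images are again instances.\<close>

locale plane_graph =
  fixes V :: "'a set" and E :: "'a set set"
    and \<phi> :: "'a \<Rightarrow> complex" and \<gamma> :: "'a set \<Rightarrow> real \<Rightarrow> complex"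
  assumes finite_V: "finite V"
    and edge: "e \<in> E \<Longrightarrow> e \<subseteq> V \<and> card e = 2"
    and inj: "inj_on \<phi> V"
    and arc_edge: "e \<in> E \<Longrightarrow> arc (\<gamma> e)"
    and ends_edge: "e \<in> E \<Longrightarrow> {pathstart (\<gamma> e), pathfinish (\<gamma> e)} = \<phi> ` e"
    and vertex_notin_edge: "e \<in> E \<Longrightarrow> (path_image (\<gamma> e) - \<phi> ` e) \<inter> \<phi> ` V = {}"
    and edges_disjoint: "e \<in> E \<Longrightarrow> e' \<in> E \<Longrightarrow> e' \<noteq> e \<Longrightarrow>
      (path_image (\<gamma> e) - \<phi> ` e) \<inter> path_image (\<gamma> e') = {}"
begin

abbreviation "im e \<equiv> path_image (\<gamma> e)"
abbreviation "interior_edge e \<equiv> path_image (\<gamma> e) - \<phi> ` e"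
abbreviation "pts F \<equiv> \<Union> (im ` F)"

lemma finite_E: "finite E"
  by (rule finite_subset[of _ "Pow V"]) (use edge finite_V in auto)

lemma plane_subgraph:
  assumes "V' \<subseteq> V" "E' \<subseteq> E" "\<And>e. e \<in> E' \<Longrightarrow> e \<subseteq> V'"
  shows "plane_graph V' E' \<phi> \<gamma>"
proof
  fix e assume "e \<in> E'"
  then have e: "e \<in> E" using assms by auto
  show "e \<subseteq> V' \<and> card e = 2" using edge[OF e] assms \<open>e \<in> E'\<close> by auto
  show "interior_edge e \<inter> \<phi> ` V' = {}" using vertex_notin_edge[OF e] assms by auto
  show "arc (\<gamma> e)" "{pathstart (\<gamma> e), pathfinish (\<gamma> e)} = \<phi> ` e"
    by (fact arc_edge[OF e] ends_edge[OF e])+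
  fix e' assume "e' \<in> E'" "e' \<noteq> e"
  then show "interior_edge e \<inter> im e' = {}" using edges_disjoint[OF e] assms by auto
qed (use assms finite_subset[OF _ finite_V] inj_on_subset[OF inj] in auto)

lemma plane_graph_image:
  assumes "continuous_on X h" "inj_on h X" "\<phi> ` V \<subseteq> X" "pts E \<subseteq> X"
  shows "plane_graph V E (h \<circ> \<phi>) (\<lambda>e. h \<circ> \<gamma> e)"
proof
  show "inj_on (h \<circ> \<phi>) V"
    using inj assms by (auto intro: comp_inj_on inj_on_subset)
  fix e assume e: "e \<in> E"
  have sub: "im e \<subseteq> X" using assms e by auto
  have phe: "\<phi> ` e \<subseteq> X" using edge[OF e] assms by blast
  show "arc (h \<circ> \<gamma> e)"
    using arc_edge[OF e] sub assms
    by (auto simp: arc_def path_image_def intro!: path_continuous_image comp_inj_on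
        intro: continuous_on_subset inj_on_subset)
  show "{pathstart (h \<circ> \<gamma> e), pathfinish (h \<circ> \<gamma> e)} = (h \<circ> \<phi>) ` e"
    using arg_cong[OF ends_edge[OF e], of "image h"]
    by (simp add: pathstart_compose pathfinish_compose image_comp)
  have I: "path_image (h \<circ> \<gamma> e) = h ` im e" for e
    by (simp add: path_image_compose)
  have D: "h ` im e - (h \<circ> \<phi>) ` e = h ` (interior_edge e)"
    using inj_on_image_set_diff[OF assms(2), of "im e" "\<phi> ` e"] sub phe
    by (auto simp: image_comp)
  show "(path_image (h \<circ> \<gamma> e) - (h \<circ> \<phi>) ` e) \<inter> (h \<circ> \<phi>) ` V = {}"
    using vertex_notin_edge[OF e] inj_on_image_Int[OF assms(2), of "interior_edge e" "\<phi> ` V"] sub assms(3)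
    unfolding I D by (auto simp: image_comp)
  fix e' assume e': "e' \<in> E" "e' \<noteq> e"
  show "(path_image (h \<circ> \<gamma> e) - (h \<circ> \<phi>) ` e) \<inter> path_image (h \<circ> \<gamma> e') = {}"
    using edges_disjoint[OF e e'] inj_on_image_Int[OF assms(2), of "interior_edge e" "im e'"] sub assms(4) e'
    unfolding I D by (auto simp: image_comp)
qed (use edge finite_V in auto)

lemma ends_in_im: "e \<in> E \<Longrightarrow> \<phi> ` e \<subseteq> im e"
  using ends_edge[of e] by (metis empty_subsetI insert_subset pathfinish_in_path_image pathstart_in_path_image)

lemma vertex_in_im: "e \<in> E \<Longrightarrow> v \<in> V \<Longrightarrow> \<phi> v \<in> im e \<Longrightarrow> v \<in> e"
proof -
  assume e: "e \<in> E" and v: "v \<in> V" "\<phi> v \<in> im e"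
  then have "\<phi> v \<in> \<phi> ` e" using vertex_notin_edge[OF e] by auto
  with v edge[OF e] inj show "v \<in> e" by (meson inj_on_image_mem_iff)
qed

lemma vertex_in_pts:
  assumes "F \<subseteq> E" "v \<in> V" "\<phi> v \<in> pts F" shows "v \<in> \<Union> F"
  using assms vertex_in_im by blast

lemma im_Int: "e \<in> E \<Longrightarrow> e' \<in> E \<Longrightarrow> e \<noteq> e' \<Longrightarrow> im e \<inter> im e' \<subseteq> \<phi> ` (e \<inter> e')"
proof
  fix z assume e: "e \<in> E" "e' \<in> E" "e \<noteq> e'" and z: "z \<in> im e \<inter> im e'"
  then have "z \<in> \<phi> ` e" "z \<in> \<phi> ` e'"
    using edges_disjoint[of e e'] edges_disjoint[of e' e] by auto
  then show "z \<in> \<phi> ` (e \<inter> e')"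
    using edge[OF e(1)] edge[OF e(2)] inj_on_image_Int[OF inj, of e e'] by auto
qed

lemma pts_Int:
  assumes "F \<subseteq> E" "F' \<subseteq> E" "F \<inter> F' = {}"
  shows "pts F \<inter> pts F' \<subseteq> \<phi> ` (\<Union> F \<inter> \<Union> F')"
proof
  fix z assume "z \<in> pts F \<inter> pts F'"
  then obtain e e' where e: "e \<in> F" "e' \<in> F'" "z \<in> im e" "z \<in> im e'" by auto
  with assms have "z \<in> \<phi> ` (e \<inter> e')" using im_Int[of e e'] by blast
  with e show "z \<in> \<phi> ` (\<Union> F \<inter> \<Union> F')" by auto
qed

lemma interior_connected: "e \<in> E \<Longrightarrow> Topological_Spaces.connected (interior_edge e)"
  using connected_simple_path_endless[OF arc_imp_simple_path[OF arc_edge]] ends_edge by metis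

lemma interior_nonempty: "e \<in> E \<Longrightarrow> interior_edge e \<noteq> {}"
  using nonempty_simple_path_endless[OF arc_imp_simple_path[OF arc_edge]] ends_edge by metis

lemma interior_disjoint_pts: "e \<in> E \<Longrightarrow> F \<subseteq> E \<Longrightarrow> e \<notin> F \<Longrightarrow> interior_edge e \<inter> pts F = {}"
  using edges_disjoint by fastforce

text \<open>Consequently an edge whose interior lies in a region has its ends in the closure of that
  region, so the edges of a closed region form a subgraph on its vertices.\<close>

lemma edge_in_closure: "e \<in> E \<Longrightarrow> im e \<subseteq> closure (interior_edge e)"
proof -
  assume e: "e \<in> E"
  have ends: "\<phi> ` e = {pathstart (\<gamma> e), pathfinish (\<gamma> e)}" using ends_edge[OF e] by auto
  have sp: "simple_path (\<gamma> e)" using arc_edge[OF e] arc_imp_simple_path by auto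
  have eq: "interior_edge e = \<gamma> e ` {0<..<1}"
    using simple_path_endless[OF sp] ends by simp
  have "continuous_on {0..1} (\<gamma> e)" using sp by (simp add: simple_path_def path_def)
  then have "\<gamma> e ` closure {0<..<1} \<subseteq> closure (\<gamma> e ` {0<..<1})"
    by (intro image_closure_subset) (auto intro: closure_subset[THEN subsetD])
  then show ?thesis unfolding eq by (simp add: path_image_def)
qed

lemma path_arc:
  assumes "distinct xs" "2 \<le> length xs" "walk_edges xs \<subseteq> E"
  shows "\<exists>g. arc g \<and> pathstart g = \<phi> (hd xs) \<and> pathfinish g = \<phi> (last xs) \<and>
    path_image g = pts (walk_edges xs)"
  using assms
proof (induction xs rule: walk_edges.induct)
  case (1 x y zs)
  then have e: "{x, y} \<in> E" and xy: "x \<noteq> y" by auto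
  have "{pathstart (\<gamma> {x, y}), pathfinish (\<gamma> {x, y})} = {\<phi> x, \<phi> y}"
    using ends_edge[OF e] by simp
  then have "\<exists>g. arc g \<and> pathstart g = \<phi> x \<and> pathfinish g = \<phi> y \<and> path_image g = im {x, y}"
    using arc_edge[OF e] arc_reversepath[OF arc_edge[OF e]]
    by (metis doubleton_eq_iff path_image_reversepath pathfinish_reversepath pathstart_reversepath)
  then obtain g where g: "arc g" "pathstart g = \<phi> x" "pathfinish g = \<phi> y" "path_image g = im {x, y}"
    by blast
  show ?case
  proof (cases zs)
    case Nil
    with g show ?thesis by auto
  next
    case (Cons z zs')
    with 1 obtain h where h: "arc h" "pathstart h = \<phi> y" "pathfinish h = \<phi> (last (y # zs))"
      "path_image h = pts (walk_edges (y # zs))" by auto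
    have sub: "walk_edges (y # zs) \<subseteq> E" using 1 by auto
    have "{x, y} \<notin> walk_edges (y # zs)"
      using 1(2) walk_edges_subset by fastforce
    then have "im {x, y} \<inter> pts (walk_edges (y # zs)) \<subseteq> \<phi> ` ({x, y} \<inter> \<Union> (walk_edges (y # zs)))"
      using pts_Int[of "{{x, y}}" "walk_edges (y # zs)"] e sub by simp
    also have "{x, y} \<inter> \<Union> (walk_edges (y # zs)) \<subseteq> {y}"
      using 1(2) walk_edges_subset by fastforce
    finally have "path_image g \<inter> path_image h \<subseteq> {pathstart h}"
      using g h by auto
    then have "arc (g +++ h)" using g h by (simp add: arc_join)
    then show ?thesis
      using g h by (intro exI[of _ "g +++ h"]) (auto simp: path_image_join)
  qed
qed auto

lemma cycle_in_V: "is_cycle E cs \<Longrightarrow> set cs \<subseteq> V"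
proof -
  assume c: "is_cycle E cs"
  then obtain x ys where cs: "cs = x # ys" by (cases cs) (auto simp: is_cycle_def)
  have "\<Union> (cycle_edges cs) = set cs"
    using Union_walk_edges[of "cs @ [hd cs]"] cs by (auto simp: cycle_edges_def)
  with c show ?thesis using edge by (auto simp: is_cycle_def)
qed

lemma vertex_in_cycle:
  assumes "is_cycle E cs" "v \<in> V" "\<phi> v \<in> pts (cycle_edges cs)" shows "v \<in> set cs"
  using vertex_in_pts[of "cycle_edges cs" v] assms cycle_edges_subset by (fastforce simp: is_cycle_def)

lemma cycle_image_vertex:
  assumes "is_cycle E cs" "v \<in> set cs" shows "\<phi> v \<in> pts (cycle_edges cs)"
proof -
  obtain x ys where cs: "cs = x # ys" using assms by (cases cs) (auto simp: is_cycle_def)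
  have "\<Union> (cycle_edges cs) = set cs"
    using Union_walk_edges[of "cs @ [hd cs]"] cs by (auto simp: cycle_edges_def)
  then obtain e where "e \<in> cycle_edges cs" "v \<in> e" using assms by blast
  then show ?thesis using ends_in_im[of e] assms(1) by (auto simp: is_cycle_def)
qed

text \<open>Supplies the arcs in the form needed for a closed Jordan curve and for the theta curve
  theorem.\<close>

lemma two_arcs:
  assumes c: "is_cycle E (a # l @ b # r)"
  obtains g h where "arc g" "pathstart g = \<phi> a" "pathfinish g = \<phi> b"
    "path_image g = pts (walk_edges (a # l @ [b]))"
    "arc h" "pathstart h = \<phi> a" "pathfinish h = \<phi> b"
    "path_image h = pts (walk_edges (b # r @ [a]))"
    "path_image g \<inter> path_image h = {\<phi> a, \<phi> b}"
proof -
  have sub: "walk_edges (a # l @ [b]) \<subseteq> E" "walk_edges (b # r @ [a]) \<subseteq> E"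
    using c by (auto simp: is_cycle_def cycle_edges_split)
  obtain g where g: "arc g" "pathstart g = \<phi> a" "pathfinish g = \<phi> b"
    "path_image g = pts (walk_edges (a # l @ [b]))"
    using path_arc[of "a # l @ [b]"] sub c by (auto simp: is_cycle_def)
  obtain h where h: "arc h" "pathstart h = \<phi> b" "pathfinish h = \<phi> a"
    "path_image h = pts (walk_edges (b # r @ [a]))"
    using path_arc[of "b # r @ [a]"] sub c by (auto simp: is_cycle_def)
  \<comment> \<open>A common edge would be \<open>{a, b}\<close>, which is an edge of a path from
    \<open>a\<close> to \<open>b\<close> only if it is the whole path; a cycle of length at least 3
    has an inner vertex on one of the two paths.\<close>
  have "e \<notin> walk_edges (b # r @ [a])" if "e \<in> walk_edges (a # l @ [b])" for e
  proof
    assume e2: "e \<in> walk_edges (b # r @ [a])"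
    then have "e \<subseteq> {a, b}"
      using walk_edges_subset[OF that] walk_edges_subset[OF e2] c by (auto simp: is_cycle_def)
    moreover have "card e = 2" using edge sub that by auto
    ultimately have "e = {a, b}"
      by (intro card_seteq) (auto simp: card_insert_if)
    show False
    proof (cases "l = []")
      case False
      then show False
        using walk_edges_ends_notin[of a l b] that \<open>e = {a, b}\<close> c by (auto simp: is_cycle_def)
    next
      case True
      then have "r \<noteq> []" using c by (auto simp: is_cycle_def)
      then show False
        using walk_edges_ends_notin[of b r a] e2 \<open>e = {a, b}\<close> c
        by (auto simp: is_cycle_def insert_commute)
    qed
  qed
  then have "pts (walk_edges (a # l @ [b])) \<inter> pts (walk_edges (b # r @ [a]))
    \<subseteq> \<phi> ` (\<Union> (walk_edges (a # l @ [b])) \<inter> \<Union> (walk_edges (b # r @ [a])))"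
    using pts_Int[OF sub] by auto
  also have "\<dots> \<subseteq> {\<phi> a, \<phi> b}"
    using c by (auto simp: is_cycle_def Union_walk_edges)
  finally have "path_image g \<inter> path_image h \<subseteq> {\<phi> a, \<phi> b}" using g h by simp
  moreover have "{\<phi> a, \<phi> b} \<subseteq> path_image g \<inter> path_image h"
    using g h by (metis Int_subset_iff empty_subsetI insert_subset pathfinish_in_path_image pathstart_in_path_image)
  ultimately have eq: "path_image g \<inter> path_image h = {\<phi> a, \<phi> b}" by (rule antisym)
  show ?thesis
    by (rule that[of g "reversepath h"]) (use g h eq in \<open>simp_all add: arc_reversepath\<close>)
qed

lemma cycle_curve:
  assumes c: "is_cycle E cs"
  obtains g where "simple_path g" "pathfinish g = pathstart g" "path_image g = pts (cycle_edges cs)"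
proof -
  obtain a b r where cs: "cs = a # b # r" using c by (cases cs; cases "tl cs") (auto simp: is_cycle_def)
  then have c': "is_cycle E (a # [] @ b # r)" using c by simp
  obtain g h where gh: "arc g" "pathstart g = \<phi> a" "pathfinish g = \<phi> b"
    "path_image g = pts (walk_edges (a # [] @ [b]))"
    "arc h" "pathstart h = \<phi> a" "pathfinish h = \<phi> b"
    "path_image h = pts (walk_edges (b # r @ [a]))"
    "path_image g \<inter> path_image h = {\<phi> a, \<phi> b}"
    using two_arcs[OF c'] by blast
  have "simple_path (g +++ reversepath h)"
    using gh by (intro simple_path_join_loop) (auto simp: arc_reversepath)
  moreover have "path_image (g +++ reversepath h) = pts (cycle_edges cs)"
    using gh cs cycle_edges_split[of a "[]" b r] by (auto simp: path_image_join)
  ultimately show ?thesis using that[of "g +++ reversepath h"] gh by simp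
qed

end

section \<open>Counting triangles of a plane graph\<close>

definition triangles :: "'a set set \<Rightarrow> 'a set set" where
  "triangles E = {t. card t = 3 \<and> (\<forall>x\<in>t. \<forall>y\<in>t. x \<noteq> y \<longrightarrow> {x, y} \<in> E)}"

lemma triangles_mono: "E \<subseteq> E' \<Longrightarrow> triangles E \<subseteq> triangles E'"
  by (auto simp: triangles_def)

lemma triangles_edge:
  assumes "t \<in> triangles E" "card e = 2" "e \<subseteq> t" shows "e \<in> E"
  using assms by (auto simp: triangles_def card_2_iff)

lemma triangles_subset: "t \<in> triangles E \<Longrightarrow> t \<subseteq> \<Union> E"
proof
  fix x assume t: "t \<in> triangles E" "x \<in> t"
  then have "t \<noteq> {x}" by (auto simp: triangles_def)
  then obtain y where "y \<in> t" "x \<noteq> y" using t by auto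
  with t have "{x, y} \<in> E" by (auto simp: triangles_def)
  then show "x \<in> \<Union> E" by auto
qed

lemma finite_triangles: "finite (\<Union> E) \<Longrightarrow> finite (triangles E)"
  using triangles_subset by (metis Pow_iff finite_Pow_iff finite_subset subsetI)

text \<open>
  With \<open>f\<close> faces, \<open>|V| - |E| + f \<ge> 2\<close> and \<open>2|E| \<ge> 4f - |T|\<close> suggest the constant 8 in the first bound.
  It fails for a single edge and for a lone triangle, which is two faces but one element of \<open>T\<close>. The
  second bound is the analogue for a disc whose boundary is the cycle \<open>cs\<close>.
\<close>

definition plane_bound :: "'a set \<Rightarrow> 'a set set \<Rightarrow> bool" where
  "plane_bound V E \<longleftrightarrow> (\<exists>T \<subseteq> triangles E. (\<forall>e\<in>E. card {t \<in> T. e \<subseteq> t} \<le> 2) \<and>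
     2 * card E + 6 \<le> card T + 4 * card V)"

definition disc_bound :: "'a set \<Rightarrow> 'a set set \<Rightarrow> 'a list \<Rightarrow> bool" where
  "disc_bound V E cs \<longleftrightarrow> (\<exists>T \<subseteq> triangles E.
     (\<forall>e \<in> E - cycle_edges cs. card {t \<in> T. e \<subseteq> t} \<le> 2) \<and>
     (\<forall>e \<in> cycle_edges cs. card {t \<in> T. e \<subseteq> t} \<le> 1) \<and>
     2 * card (E - cycle_edges cs) + 4 \<le> card T + 4 * card (V - set cs) + length cs)"

definition disc_drawing ::
    "'a set \<Rightarrow> 'a set set \<Rightarrow> ('a \<Rightarrow> complex) \<Rightarrow> ('a set \<Rightarrow> real \<Rightarrow> complex) \<Rightarrow> 'a list \<Rightarrow> bool" where
  "disc_drawing V E \<phi> \<gamma> cs \<longleftrightarrow> plane_graph V E \<phi> \<gamma> \<and> is_cycle E cs \<and>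
     (\<forall>v \<in> V - set cs. \<phi> v \<in> inside (\<Union>e \<in> cycle_edges cs. path_image (\<gamma> e))) \<and>
     (\<forall>e \<in> E - cycle_edges cs.
        path_image (\<gamma> e) - \<phi> ` e \<subseteq> inside (\<Union>e \<in> cycle_edges cs. path_image (\<gamma> e)))"

section \<open>Inside and outside of a cycle, and inversion\<close>

context plane_graph
begin

lemma cycle_regions:
  assumes "is_cycle E cs"
  shows "inside (pts (cycle_edges cs)) \<noteq> {}" "open (inside (pts (cycle_edges cs)))"
    "Topological_Spaces.connected (inside (pts (cycle_edges cs)))" "bounded (inside (pts (cycle_edges cs)))"
    "open (outside (pts (cycle_edges cs)))" "Topological_Spaces.connected (outside (pts (cycle_edges cs)))"
    "inside (pts (cycle_edges cs)) \<inter> outside (pts (cycle_edges cs)) = {}"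
    "inside (pts (cycle_edges cs)) \<union> outside (pts (cycle_edges cs)) = - pts (cycle_edges cs)"
    "closure (inside (pts (cycle_edges cs))) \<subseteq> inside (pts (cycle_edges cs)) \<union> pts (cycle_edges cs)"
    "closure (outside (pts (cycle_edges cs))) \<subseteq> outside (pts (cycle_edges cs)) \<union> pts (cycle_edges cs)"
proof -
  obtain g where g: "simple_path g" "pathfinish g = pathstart g" "path_image g = pts (cycle_edges cs)"
    using cycle_curve[OF assms] by blast
  note J = Jordan_inside_outside[OF g(1,2), unfolded g(3)]
  show "inside (pts (cycle_edges cs)) \<noteq> {}" "open (inside (pts (cycle_edges cs)))"
    "Topological_Spaces.connected (inside (pts (cycle_edges cs)))" "bounded (inside (pts (cycle_edges cs)))"
    "open (outside (pts (cycle_edges cs)))" "Topological_Spaces.connected (outside (pts (cycle_edges cs)))"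
    "inside (pts (cycle_edges cs)) \<inter> outside (pts (cycle_edges cs)) = {}"
    "inside (pts (cycle_edges cs)) \<union> outside (pts (cycle_edges cs)) = - pts (cycle_edges cs)"
    using J by auto
  show "closure (inside (pts (cycle_edges cs))) \<subseteq> inside (pts (cycle_edges cs)) \<union> pts (cycle_edges cs)"
    "closure (outside (pts (cycle_edges cs))) \<subseteq> outside (pts (cycle_edges cs)) \<union> pts (cycle_edges cs)"
    using J by (simp_all add: closure_Un_frontier)
qed

lemma interior_inside_or_outside:
  assumes c: "is_cycle E cs" and e: "e \<in> E" "e \<notin> cycle_edges cs"
  shows "interior_edge e \<subseteq> inside (pts (cycle_edges cs)) \<or> interior_edge e \<subseteq> outside (pts (cycle_edges cs))"
proof -
  note R = cycle_regions[OF c]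
  have "interior_edge e \<subseteq> inside (pts (cycle_edges cs)) \<union> outside (pts (cycle_edges cs))"
    using interior_disjoint_pts[OF e(1) _ e(2)] c R(8) by (auto simp: is_cycle_def)
  then show ?thesis
    using Topological_Spaces.connectedD[OF interior_connected[OF e(1)] R(2,5)] R(7) by blast
qed

definition region_V :: "'a list \<Rightarrow> complex set \<Rightarrow> 'a set" where
  "region_V cs R = {v \<in> V. v \<in> set cs \<or> \<phi> v \<in> R}"

definition region_E :: "'a list \<Rightarrow> complex set \<Rightarrow> 'a set set" where
  "region_E cs R = {e \<in> E. e \<in> cycle_edges cs \<or> interior_edge e \<subseteq> R}"

lemma plane_region:
  assumes c: "is_cycle E cs" and R: "closure R \<subseteq> R \<union> pts (cycle_edges cs)"
  shows "plane_graph (region_V cs R) (region_E cs R) \<phi> \<gamma>"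
proof (rule plane_subgraph)
  fix e assume e: "e \<in> region_E cs R"
  then have eE: "e \<in> E" by (simp add: region_E_def)
  show "e \<subseteq> region_V cs R"
  proof (cases "e \<in> cycle_edges cs")
    case True
    then show ?thesis
      using cycle_edges_subset[OF True] cycle_in_V[OF c] by (auto simp: region_V_def)
  next
    case False
    then have "interior_edge e \<subseteq> R" using e by (simp add: region_E_def)
    then have "im e \<subseteq> R \<union> pts (cycle_edges cs)"
      using edge_in_closure[OF eE] closure_mono R by blast
    then have sub: "\<phi> ` e \<subseteq> R \<union> pts (cycle_edges cs)" using ends_in_im[OF eE] by blast
    show ?thesis
    proof
      fix x assume x: "x \<in> e"
      then have xV: "x \<in> V" using edge[OF eE] by auto
      have "\<phi> x \<in> R \<union> pts (cycle_edges cs)" using sub x by blast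
      then show "x \<in> region_V cs R"
        using vertex_in_cycle[OF c xV] xV by (auto simp: region_V_def)
    qed
  qed
qed (auto simp: region_V_def region_E_def)

lemma is_cycle_region: "is_cycle E cs \<Longrightarrow> is_cycle (region_E cs R) cs"
  by (auto simp: is_cycle_def region_E_def)

lemma disc_inside:
  assumes c: "is_cycle E cs"
  shows "disc_drawing (region_V cs (inside (pts (cycle_edges cs))))
    (region_E cs (inside (pts (cycle_edges cs)))) \<phi> \<gamma> cs"
  using plane_region[OF c cycle_regions(9)[OF c]] is_cycle_region[OF c]
  unfolding disc_drawing_def by (auto simp: region_V_def region_E_def)

end

text \<open>Invert at a point inside the cycle.\<close>

lemma disc_outside_inversion:
  assumes "plane_graph V E \<phi> \<gamma>" and c: "is_cycle E cs"
    and V: "\<forall>v \<in> V - set cs. \<phi> v \<in> outside (\<Union>e \<in> cycle_edges cs. path_image (\<gamma> e))"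
    and E: "\<forall>e \<in> E - cycle_edges cs.
        path_image (\<gamma> e) - \<phi> ` e \<subseteq> outside (\<Union>e \<in> cycle_edges cs. path_image (\<gamma> e))"
  shows "\<exists>\<phi>' \<gamma>'. disc_drawing V E \<phi>' \<gamma>' cs"
proof -
  interpret plane_graph V E \<phi> \<gamma> by fact
  define \<Gamma> where "\<Gamma> = pts (cycle_edges cs)"
  note R = cycle_regions[OF c, folded \<Gamma>_def]
  obtain p where p: "p \<in> inside \<Gamma>" using R(1) by auto
  \<comment> \<open>By the convention \<open>inverse 0 = 0\<close>, \<open>h\<close> is a bijection
    of the whole plane, continuous only off \<open>p\<close>. The value 0, which belongs to the
    point at infinity, is attained at \<open>p\<close>.\<close>
  define h where "h z = inverse (z - p)" for z
  have cont: "continuous_on (- {p}) h" unfolding h_def by (intro continuous_intros) auto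
  have injh: "inj_on h UNIV" by (auto simp: inj_on_def h_def)
  have hsurj: "h (p + inverse w) = w" for w by (simp add: h_def)
  have pG: "p \<notin> \<Gamma>" "p \<notin> outside \<Gamma>" using p R(7,8) by blast+
  have pV: "\<phi> ` V \<subseteq> - {p}"
  proof
    fix z assume "z \<in> \<phi> ` V"
    then obtain v where v: "v \<in> V" "z = \<phi> v" by auto
    then show "z \<in> - {p}"
      using V pG cycle_image_vertex[OF c, of v] by (cases "v \<in> set cs") (auto simp: \<Gamma>_def)
  qed
  have pE: "pts E \<subseteq> - {p}"
  proof
    fix z assume "z \<in> pts E"
    then obtain e where e: "e \<in> E" "z \<in> im e" by auto
    show "z \<in> - {p}"
    proof (cases "e \<in> cycle_edges cs")
      case True
      then show ?thesis using e pG by (auto simp: \<Gamma>_def)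
    next
      case False
      then have "z \<in> outside \<Gamma> \<or> z \<in> \<phi> ` e" using E e by (auto simp: \<Gamma>_def)
      then show ?thesis using pG pV edge[OF e(1)] by blast
    qed
  qed
  interpret I: plane_graph V E "h \<circ> \<phi>" "\<lambda>e. h \<circ> \<gamma> e"
    by (rule plane_graph_image[OF cont inj_on_subset[OF injh] pV pE]) simp
  define \<Gamma>' where "\<Gamma>' = I.pts (cycle_edges cs)"
  note R' = I.cycle_regions[OF c, folded \<Gamma>'_def]
  have G': "\<Gamma>' = h ` \<Gamma>" by (auto simp: \<Gamma>'_def \<Gamma>_def path_image_compose)
  have disj: "h ` X \<inter> \<Gamma>' = {}" if "X \<inter> \<Gamma> = {}" for X
    using that inj_on_image_Int[OF injh, of X \<Gamma>] by (auto simp: G')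
  have side: "h ` X \<subseteq> inside \<Gamma>' \<or> h ` X \<subseteq> outside \<Gamma>'" if "Topological_Spaces.connected X" "X \<inter> \<Gamma> = {}" "p \<notin> X" for X
  proof -
    have "Topological_Spaces.connected (h ` X)"
      using that cont by (intro connected_continuous_image) (auto intro: continuous_on_subset)
    moreover have "h ` X \<subseteq> inside \<Gamma>' \<union> outside \<Gamma>'" using disj[OF that(2)] R'(8) by blast
    ultimately show ?thesis using Topological_Spaces.connectedD[OF _ R'(2,5), of "h ` X"] R'(7) by blast
  qed
  have "Topological_Spaces.connected (inside \<Gamma> - {p})"
    using R by (intro connected_open_delete) auto
  then have in_side: "h ` (inside \<Gamma> - {p}) \<subseteq> inside \<Gamma>' \<or> h ` (inside \<Gamma> - {p}) \<subseteq> outside \<Gamma>'"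
    using R(8) by (intro side) blast+
  have "\<not> h ` (inside \<Gamma> - {p}) \<subseteq> inside \<Gamma>'"
  proof
    assume "h ` (inside \<Gamma> - {p}) \<subseteq> inside \<Gamma>'"
    then have "bounded (h ` (inside \<Gamma> - {p}))" using R'(4) bounded_subset by blast
    then obtain B where B: "B > 0" "\<forall>z \<in> inside \<Gamma> - {p}. norm (h z) \<le> B"
      by (auto simp: bounded_pos)
    obtain r where r: "r > 0" "ball p r \<subseteq> inside \<Gamma>" using R(2) p by (meson open_contains_ball)
    \<comment> \<open>A point at distance \<open>s\<close> from \<open>p\<close> is mapped to
      modulus 1/s, at least \<open>2 * B\<close>; so the image of the punctured inside is
      unbounded.\<close>
    define s where "s = min (r / 2) (1 / (2 * B))"
    have s: "s > 0" "s < r" "s \<le> 1 / (2 * B)" using r B by (auto simp: s_def)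
    have "p + of_real s \<in> inside \<Gamma> - {p}"
      using r s by (auto simp: dist_norm intro!: subsetD[OF r(2)])
    then have "norm (h (p + of_real s)) \<le> B" using B by blast
    then have "inverse s \<le> B" using s by (simp add: h_def norm_inverse)
    moreover have "inverse s \<ge> 2 * B"
      using s B by (simp add: field_simps)
    ultimately show False using B by simp
  qed
  with in_side have in_out: "h ` (inside \<Gamma> - {p}) \<subseteq> outside \<Gamma>'" by blast
  have "\<not> h ` outside \<Gamma> \<subseteq> outside \<Gamma>'"
  proof
    assume out: "h ` outside \<Gamma> \<subseteq> outside \<Gamma>'"
    \<comment> \<open>If both regions were mapped to the outside, only the value 0 would be left for
      the inside of \<open>\<Gamma>'\<close>, which is a nonempty open set.\<close>
    have "inside \<Gamma>' \<subseteq> {0}"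
    proof
      fix w assume w: "w \<in> inside \<Gamma>'"
      show "w \<in> {0}"
      proof (rule ccontr)
        assume "w \<notin> {0}"
        define z where "z = p + inverse w"
        have z: "h z = w" "z \<noteq> p" using hsurj \<open>w \<notin> {0}\<close> by (auto simp: z_def)
        have "z \<notin> \<Gamma>" using w z R'(8) G' by blast
        then have "z \<in> inside \<Gamma> - {p} \<or> z \<in> outside \<Gamma>" using R(8) z by blast
        then have "w \<in> outside \<Gamma>'" using in_out out z by blast
        with w R'(7) show False by blast
      qed
    qed
    then have "inside \<Gamma>' = {0}" using R'(1) by blast
    then show False using R'(2) by (simp add: not_open_singleton)
  qed
  then have out: "h ` outside \<Gamma> \<subseteq> inside \<Gamma>'"
    using side[OF R(6) _ pG(2)] R(8) by blast
  have "disc_drawing V E (h \<circ> \<phi>) (\<lambda>e. h \<circ> \<gamma> e) cs"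
    unfolding disc_drawing_def
  proof (intro conjI ballI)
    fix v assume "v \<in> V - set cs"
    then show "(h \<circ> \<phi>) v \<in> inside (I.pts (cycle_edges cs))"
      using V out unfolding \<Gamma>_def \<Gamma>'_def by fastforce
  next
    fix e assume e: "e \<in> E - cycle_edges cs"
    have "path_image (h \<circ> \<gamma> e) - (h \<circ> \<phi>) ` e \<subseteq> h ` (interior_edge e)"
      by (auto simp: path_image_compose)
    also have "\<dots> \<subseteq> inside \<Gamma>'" using E e out unfolding \<Gamma>_def by blast
    finally show "path_image (h \<circ> \<gamma> e) - (h \<circ> \<phi>) ` e \<subseteq> inside (I.pts (cycle_edges cs))"
      unfolding \<Gamma>'_def .
  qed (use c I.plane_graph_axioms in auto)
  then show ?thesis by blast
qed

section \<open>Triangle counts under gluing\<close>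

lemma card_Collect_Un_le:
  "card {t \<in> A \<union> B. P t} \<le> card {t \<in> A. P t} + card {t \<in> B. P t}"
proof -
  have "{t \<in> A \<union> B. P t} = {t \<in> A. P t} \<union> {t \<in> B. P t}" by auto
  then show ?thesis using card_Un_le by metis
qed

lemma no_triangle_over_foreign_edge:
  assumes "T \<subseteq> triangles E" "card e = 2" "e \<notin> E"
  shows "{t \<in> T. e \<subseteq> t} = {}"
  using assms triangles_edge by blast

text \<open>Pure counting, and without loss. The path adds 2 * length m + 2 to the left side for its
  edges and 4 * length m to the right side for its vertices, while the two boundaries together
  exceed \<open>length cs\<close> by 2 * length m + 2; this turns the two constants 4 into one. The
  triangle sets are disjoint because the sides share only the path, and an edge of the path receives
  at most one triangle from each side.\<close>

lemma disc_bound_theta: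
  fixes V :: "'a set"
  assumes fin: "finite V" "finite E" and E2: "\<And>e. e \<in> E \<Longrightarrow> e \<subseteq> V \<and> card e = 2"
    and dist: "distinct (a # m @ [b])"
    and cs: "cs = a # l @ b # r" "c1 = a # l @ b # rev m" "c2 = b # r @ a # m"
    and P: "P = walk_edges (a # m @ [b])"
    and sub: "E1 \<subseteq> E" "E2 \<subseteq> E" "P \<subseteq> E" "cycle_edges cs \<subseteq> E" "cycle_edges c1 \<subseteq> E1" "cycle_edges c2 \<subseteq> E2"
    and EE: "E - cycle_edges cs = (E1 - cycle_edges c1) \<union> (E2 - cycle_edges c2) \<union> P"
    and E12: "E1 \<inter> E2 = P"
    and VV: "V - set cs = (V1 - set c1) \<union> (V2 - set c2) \<union> set m"
    and V12: "(V1 - set c1) \<inter> (V2 - set c2) = {}" "set m \<subseteq> set c1" "set m \<subseteq> set c2"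
    and D1: "disc_bound V1 E1 c1" and D2: "disc_bound V2 E2 c2"
  shows "disc_bound V E cs"
proof -
  obtain T1 where T1: "T1 \<subseteq> triangles E1" "\<forall>e \<in> E1 - cycle_edges c1. card {t \<in> T1. e \<subseteq> t} \<le> 2"
     "\<forall>e \<in> cycle_edges c1. card {t \<in> T1. e \<subseteq> t} \<le> 1"
     "2 * card (E1 - cycle_edges c1) + 4 \<le> card T1 + 4 * card (V1 - set c1) + length c1"
    using D1 by (auto simp: disc_bound_def)
  obtain T2 where T2: "T2 \<subseteq> triangles E2" "\<forall>e \<in> E2 - cycle_edges c2. card {t \<in> T2. e \<subseteq> t} \<le> 2"
     "\<forall>e \<in> cycle_edges c2. card {t \<in> T2. e \<subseteq> t} \<le> 1"
     "2 * card (E2 - cycle_edges c2) + 4 \<le> card T2 + 4 * card (V2 - set c2) + length c2"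
    using D2 by (auto simp: disc_bound_def)
  have tsub: "triangles E1 \<subseteq> triangles E" "triangles E2 \<subseteq> triangles E"
    using sub by (simp_all add: triangles_mono)
  have "\<Union> E \<subseteq> V" using E2 by auto
  then have "finite (triangles E)" using fin finite_triangles finite_subset by metis
  then have fT: "finite T1" "finite T2"
    using tsub T1(1) T2(1) finite_subset by (metis (no_types))+
  have c1: "cycle_edges c1 = walk_edges (a # l @ [b]) \<union> P"
    using cycle_edges_split[of a l b "rev m"] walk_edges_rev[of "a # m @ [b]"] cs P by simp
  have c2: "cycle_edges c2 = walk_edges (b # r @ [a]) \<union> P"
    using cycle_edges_split[of b r a m] cs P by simp
  have c: "cycle_edges cs = walk_edges (a # l @ [b]) \<union> walk_edges (b # r @ [a])"
    using cycle_edges_split cs by simp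
  have "T1 \<inter> T2 = {}"
  proof (rule ccontr)
    assume "T1 \<inter> T2 \<noteq> {}"
    then obtain t where "t \<in> triangles E1" "t \<in> triangles E2" using T1(1) T2(1) by auto
    then have "card t = 3" "\<forall>x\<in>t. \<forall>y\<in>t. x \<noteq> y \<longrightarrow> {x, y} \<in> P"
      using E12 by (auto simp: triangles_def)
    with walk_edges_no_triangle[OF dist] P show False by blast
  qed
  then have cT: "card (T1 \<union> T2) = card T1 + card T2" using fT by (simp add: card_Un_disjoint)
  have z1: "card {t \<in> T1. e \<subseteq> t} = 0" if "e \<in> E" "e \<notin> E1" for e
    using no_triangle_over_foreign_edge[OF T1(1) _ that(2)] E2[OF that(1)] by (metis card.empty)
  have z2: "card {t \<in> T2. e \<subseteq> t} = 0" if "e \<in> E" "e \<notin> E2" for e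
    using no_triangle_over_foreign_edge[OF T2(1) _ that(2)] E2[OF that(1)] by (metis card.empty)
  note le = card_Collect_Un_le[of T1 T2 "\<lambda>t. e \<subseteq> t" for e]
  have inner: "card {t \<in> T1 \<union> T2. e \<subseteq> t} \<le> 2" if e: "e \<in> E - cycle_edges cs" for e
  proof -
    consider "e \<in> P" | "e \<notin> P" "e \<in> E1 - cycle_edges c1" | "e \<notin> P" "e \<in> E2 - cycle_edges c2"
      using e EE by auto
    then show ?thesis
    proof cases
      case 1
      then have "card {t \<in> T1. e \<subseteq> t} \<le> 1" "card {t \<in> T2. e \<subseteq> t} \<le> 1"
        using T1(3) T2(3) c1 c2 by auto
      then show ?thesis using le[of e] by linarith
    next
      case 2
      then have "e \<notin> E2" using E12 by auto
      then have "card {t \<in> T2. e \<subseteq> t} = 0" "card {t \<in> T1. e \<subseteq> t} \<le> 2"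
        using z2[of e] T1(2) 2 e by auto
      then show ?thesis using le[of e] by linarith
    next
      case 3
      then have "e \<notin> E1" using E12 by auto
      then have "card {t \<in> T1. e \<subseteq> t} = 0" "card {t \<in> T2. e \<subseteq> t} \<le> 2"
        using z1[of e] T2(2) 3 e by auto
      then show ?thesis using le[of e] by linarith
    qed
  qed
  have outer: "card {t \<in> T1 \<union> T2. e \<subseteq> t} \<le> 1" if e: "e \<in> cycle_edges cs" for e
  proof -
    have eP: "e \<notin> P" using EE e by auto
    have eE: "e \<in> E" using sub e by auto
    from e consider "e \<in> cycle_edges c1" | "e \<in> cycle_edges c2" using c c1 c2 by auto
    then show ?thesis
    proof cases
      case 1
      then have "e \<notin> E2" using E12 eP sub by auto
      then have "card {t \<in> T2. e \<subseteq> t} = 0" "card {t \<in> T1. e \<subseteq> t} \<le> 1"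
        using z2[of e] T1(3) 1 eE by auto
      then show ?thesis using le[of e] by linarith
    next
      case 2
      then have "e \<notin> E1" using E12 eP sub by auto
      then have "card {t \<in> T1. e \<subseteq> t} = 0" "card {t \<in> T2. e \<subseteq> t} \<le> 1"
        using z1[of e] T2(3) 2 eE by auto
      then show ?thesis using le[of e] by linarith
    qed
  qed
  have fE: "finite E1" "finite E2" "finite P"
    using finite_subset[OF sub(1) fin(2)] finite_subset[OF sub(2) fin(2)] finite_subset[OF sub(3) fin(2)]
    by auto
  have "(E1 - cycle_edges c1) \<inter> (E2 - cycle_edges c2) = {}"
    "((E1 - cycle_edges c1) \<union> (E2 - cycle_edges c2)) \<inter> P = {}"
    using E12 c1 c2 by auto
  then have cE: "card (E - cycle_edges cs) = card (E1 - cycle_edges c1) + card (E2 - cycle_edges c2) + card P"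
    unfolding EE using fE by (simp add: card_Un_disjoint)
  have cP: "card P = length m + 1" using card_walk_edges[OF dist] P by simp
  have fV: "finite (V1 - set c1)" "finite (V2 - set c2)"
    using fin VV by (metis finite_Diff finite_Un)+
  have "((V1 - set c1) \<union> (V2 - set c2)) \<inter> set m = {}" using V12 by auto
  then have cV: "card (V - set cs) = card (V1 - set c1) + card (V2 - set c2) + length m"
    unfolding VV using fV V12 dist by (simp add: card_Un_disjoint distinct_card)
  have len: "length c1 + length c2 = length cs + 2 + 2 * length m" using cs by simp
  show ?thesis
    unfolding disc_bound_def
  proof (intro exI[of _ "T1 \<union> T2"] conjI ballI)
    show "T1 \<union> T2 \<subseteq> triangles E" using T1(1) T2(1) tsub by auto
    show "2 * card (E - cycle_edges cs) + 4 \<le> card (T1 \<union> T2) + 4 * card (V - set cs) + length cs"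
      using T1(4) T2(4) len unfolding cE cV cT cP distrib_left by linarith
  qed (use inner outer in auto)
qed

text \<open>A piece hanging on a boundary vertex (the element of \<open>A\<close>) contributes one
  inner vertex fewer than it has vertices. This loss of 4 is covered by the constant 6 of its plane
  bound.\<close>

lemma disc_bound_attach:
  fixes V :: "'a set"
  assumes fin: "finite V" "finite E" and E2: "\<And>e. e \<in> E \<Longrightarrow> e \<subseteq> V \<and> card e = 2"
    and K: "K \<subseteq> V" "K \<inter> set cs = {}" "finite A" "card A \<le> 1"
    and EH: "EH \<subseteq> E" "EH \<inter> cycle_edges cs = {}" and ce: "cycle_edges cs \<subseteq> E"
    and P: "plane_bound (K \<union> A) EH" and D: "disc_bound (V - K) (E - EH) cs"
  shows "disc_bound V E cs"
proof -
  obtain T1 where T1: "T1 \<subseteq> triangles EH" "\<forall>e \<in> EH. card {t \<in> T1. e \<subseteq> t} \<le> 2"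
     "2 * card EH + 6 \<le> card T1 + 4 * card (K \<union> A)"
    using P by (auto simp: plane_bound_def)
  obtain T2 where T2: "T2 \<subseteq> triangles (E - EH)"
     "\<forall>e \<in> E - EH - cycle_edges cs. card {t \<in> T2. e \<subseteq> t} \<le> 2"
     "\<forall>e \<in> cycle_edges cs. card {t \<in> T2. e \<subseteq> t} \<le> 1"
     "2 * card (E - EH - cycle_edges cs) + 4 \<le> card T2 + 4 * card (V - K - set cs) + length cs"
    using D by (auto simp: disc_bound_def)
  have tsub: "triangles EH \<subseteq> triangles E" "triangles (E - EH) \<subseteq> triangles E"
    using EH triangles_mono[of EH E] triangles_mono[of "E - EH" E] by auto
  have "\<Union> E \<subseteq> V" using E2 by auto
  then have "finite (triangles E)" using fin finite_triangles finite_subset by metis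
  then have fT: "finite T1" "finite T2"
    using tsub T1(1) T2(1) finite_subset by (metis (no_types))+
  have z1: "card {t \<in> T1. e \<subseteq> t} = 0" if "e \<in> E" "e \<notin> EH" for e
    using no_triangle_over_foreign_edge[OF T1(1) _ that(2)] E2[OF that(1)] by (metis card.empty)
  have z2: "card {t \<in> T2. e \<subseteq> t} = 0" if "e \<in> EH" for e
    using no_triangle_over_foreign_edge[OF T2(1), of e] E2[of e] that EH by (metis DiffD2 card.empty subsetD)
  note le = card_Collect_Un_le[of T1 T2 "\<lambda>t. e \<subseteq> t" for e]
  have "T1 \<inter> T2 = {}"
  proof (rule ccontr)
    assume "T1 \<inter> T2 \<noteq> {}"
    then obtain t where t: "t \<in> triangles EH" "t \<in> triangles (E - EH)" using T1(1) T2(1) by auto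
    then have "card t = 3" by (simp add: triangles_def)
    then obtain x y where "x \<in> t" "y \<in> t" "x \<noteq> y" by (auto simp: card_3_iff)
    with t show False by (auto simp: triangles_def)
  qed
  then have cT: "card (T1 \<union> T2) = card T1 + card T2" using fT by (simp add: card_Un_disjoint)
  have cE: "card (E - cycle_edges cs) = card EH + card (E - EH - cycle_edges cs)"
  proof -
    have "E - cycle_edges cs = EH \<union> (E - EH - cycle_edges cs)" using EH by auto
    also have "card \<dots> = card EH + card (E - EH - cycle_edges cs)"
      using fin finite_subset[OF EH(1)] by (intro card_Un_disjoint) auto
    finally show ?thesis .
  qed
  have cV: "card (V - set cs) = card K + card (V - K - set cs)"
  proof -
    have "V - set cs = K \<union> (V - K - set cs)" using K by auto
    also have "card \<dots> = card K + card (V - K - set cs)"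
      using fin finite_subset[OF K(1)] by (intro card_Un_disjoint) auto
    finally show ?thesis .
  qed
  have cK: "card (K \<union> A) \<le> card K + 1" using card_Un_le[of K A] K by linarith
  show ?thesis
    unfolding disc_bound_def
  proof (intro exI[of _ "T1 \<union> T2"] conjI ballI)
    show "T1 \<union> T2 \<subseteq> triangles E" using T1(1) T2(1) tsub by auto
    show "2 * card (E - cycle_edges cs) + 4 \<le> card (T1 \<union> T2) + 4 * card (V - set cs) + length cs"
      using T1(3) T2(4) cK unfolding cE cV cT distrib_left by linarith
  next
    fix e assume e: "e \<in> E - cycle_edges cs"
    show "card {t \<in> T1 \<union> T2. e \<subseteq> t} \<le> 2"
    proof (cases "e \<in> EH")
      case True
      then have "card {t \<in> T2. e \<subseteq> t} = 0" "card {t \<in> T1. e \<subseteq> t} \<le> 2" using z2 T1(2) by auto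
      then show ?thesis using le[of e] by linarith
    next
      case False
      then have "card {t \<in> T1. e \<subseteq> t} = 0" "card {t \<in> T2. e \<subseteq> t} \<le> 2" using z1 T2(2) e by auto
      then show ?thesis using le[of e] by linarith
    qed
  next
    fix e assume e: "e \<in> cycle_edges cs"
    then have "e \<in> E" "e \<notin> EH" using EH ce by auto
    then have "card {t \<in> T1. e \<subseteq> t} = 0" "card {t \<in> T2. e \<subseteq> t} \<le> 1" using z1 T2(3) e by auto
    then show "card {t \<in> T1 \<union> T2. e \<subseteq> t} \<le> 1" using le[of e] by linarith
  qed
qed

text \<open>The two constants 4 add up to 8, but if the cycle is itself a triangle both sides may
  have counted it. All common triangles contain the closing edge of the cycle, so at most one is
  lost.\<close>

lemma plane_bound_two_sides:
  fixes V :: "'a set"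
  assumes fin: "finite V" "finite E" and E2: "\<And>e. e \<in> E \<Longrightarrow> e \<subseteq> V \<and> card e = 2"
    and cs: "is_cycle E cs" "set cs \<subseteq> V"
    and E12: "E1 \<union> E2 = E" "E1 \<inter> E2 = cycle_edges cs"
    and V12: "V1 \<union> V2 = V" "V1 \<inter> V2 = set cs"
    and D1: "disc_bound V1 E1 cs" and D2: "disc_bound V2 E2 cs"
  shows "plane_bound V E"
proof -
  obtain T1 where T1: "T1 \<subseteq> triangles E1" "\<forall>e \<in> E1 - cycle_edges cs. card {t \<in> T1. e \<subseteq> t} \<le> 2"
     "\<forall>e \<in> cycle_edges cs. card {t \<in> T1. e \<subseteq> t} \<le> 1"
     "2 * card (E1 - cycle_edges cs) + 4 \<le> card T1 + 4 * card (V1 - set cs) + length cs"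
    using D1 by (auto simp: disc_bound_def)
  obtain T2 where T2: "T2 \<subseteq> triangles E2" "\<forall>e \<in> E2 - cycle_edges cs. card {t \<in> T2. e \<subseteq> t} \<le> 2"
     "\<forall>e \<in> cycle_edges cs. card {t \<in> T2. e \<subseteq> t} \<le> 1"
     "2 * card (E2 - cycle_edges cs) + 4 \<le> card T2 + 4 * card (V2 - set cs) + length cs"
    using D2 by (auto simp: disc_bound_def)
  have tsub: "triangles E1 \<subseteq> triangles E" "triangles E2 \<subseteq> triangles E"
    using E12 triangles_mono[of E1 E] triangles_mono[of E2 E] by auto
  have "\<Union> E \<subseteq> V" using E2 by auto
  then have "finite (triangles E)" using fin finite_triangles finite_subset by metis
  then have fT: "finite T1" "finite T2"
    using tsub T1(1) T2(1) finite_subset by (metis (no_types))+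
  note le = card_Collect_Un_le[of T1 T2 "\<lambda>t. e \<subseteq> t" for e]
  have "cs \<noteq> []" using cs by (auto simp: is_cycle_def)
  have "T1 \<inter> T2 \<subseteq> {t \<in> T1. {last cs, hd cs} \<subseteq> t}"
  proof
    fix t assume t: "t \<in> T1 \<inter> T2"
    then have "t \<in> triangles E1" "t \<in> triangles E2" using T1(1) T2(1) by auto
    then have "card t = 3" "\<forall>x\<in>t. \<forall>y\<in>t. x \<noteq> y \<longrightarrow> {x, y} \<in> cycle_edges cs"
      using E12 by (auto simp: triangles_def)
    then have "{last cs, hd cs} \<subseteq> t"
      using cs by (intro cycle_edges_triangle) (auto simp: is_cycle_def)
    with t show "t \<in> {t \<in> T1. {last cs, hd cs} \<subseteq> t}" by auto
  qed
  then have "card (T1 \<inter> T2) \<le> card {t \<in> T1. {last cs, hd cs} \<subseteq> t}"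
    using fT by (intro card_mono) auto
  also have "\<dots> \<le> 1" using T1(3) last_hd_in_cycle_edges[OF \<open>cs \<noteq> []\<close>] by blast
  finally have cT: "card T1 + card T2 \<le> card (T1 \<union> T2) + 1"
    using card_Un_Int[OF fT] by linarith
  have lenE: "card (cycle_edges cs) = length cs"
    using cs by (intro card_cycle_edges) (auto simp: is_cycle_def)
  have fE: "finite E1" "finite E2" using fin E12 by auto
  have "E = (E1 - cycle_edges cs) \<union> (E2 - cycle_edges cs) \<union> cycle_edges cs" using E12 by auto
  also have "card \<dots> = card (E1 - cycle_edges cs) + card (E2 - cycle_edges cs) + length cs"
    using fE E12 lenE by (subst card_Un_disjoint, auto)+
  finally have cE: "card E = card (E1 - cycle_edges cs) + card (E2 - cycle_edges cs) + length cs" .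
  have lenV: "card (set cs) = length cs" using cs by (simp add: is_cycle_def distinct_card)
  have fV: "finite V1" "finite V2" using fin V12 by auto
  have "V = (V1 - set cs) \<union> (V2 - set cs) \<union> set cs" using V12 by auto
  also have "card \<dots> = card (V1 - set cs) + card (V2 - set cs) + length cs"
    using fV V12 lenV by (subst card_Un_disjoint, auto)+
  finally have cV: "card V = card (V1 - set cs) + card (V2 - set cs) + length cs" .
  have z1: "card {t \<in> T1. e \<subseteq> t} = 0" if "e \<in> E" "e \<notin> E1" for e
    using no_triangle_over_foreign_edge[OF T1(1) _ that(2)] E2[OF that(1)] by (metis card.empty)
  have z2: "card {t \<in> T2. e \<subseteq> t} = 0" if "e \<in> E" "e \<notin> E2" for e
    using no_triangle_over_foreign_edge[OF T2(1) _ that(2)] E2[OF that(1)] by (metis card.empty)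
  show ?thesis
    unfolding plane_bound_def
  proof (intro exI[of _ "T1 \<union> T2"] conjI ballI)
    show "T1 \<union> T2 \<subseteq> triangles E" using T1(1) T2(1) tsub by auto
    show "2 * card E + 6 \<le> card (T1 \<union> T2) + 4 * card V"
      using T1(4) T2(4) cT unfolding cE cV distrib_left by linarith
  next
    fix e assume e: "e \<in> E"
    consider "e \<in> cycle_edges cs" | "e \<in> E1 - cycle_edges cs" "e \<notin> E2" | "e \<in> E2 - cycle_edges cs" "e \<notin> E1"
      using e E12 by auto
    then show "card {t \<in> T1 \<union> T2. e \<subseteq> t} \<le> 2"
    proof cases
      case 1
      then have "card {t \<in> T1. e \<subseteq> t} \<le> 1" "card {t \<in> T2. e \<subseteq> t} \<le> 1"
        using T1(3) T2(3) by auto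
      then show ?thesis using le[of e] by linarith
    next
      case 2
      then have "card {t \<in> T2. e \<subseteq> t} = 0" "card {t \<in> T1. e \<subseteq> t} \<le> 2"
        using z2[of e] T1(2) e by auto
      then show ?thesis using le[of e] by linarith
    next
      case 3
      then have "card {t \<in> T1. e \<subseteq> t} = 0" "card {t \<in> T2. e \<subseteq> t} \<le> 2"
        using z1[of e] T2(2) e by auto
      then show ?thesis using le[of e] by linarith
    qed
  qed
qed

section \<open>Cutting a disc along a path\<close>

context plane_graph
begin

text \<open>The theta curve theorem for the arcs \<open>L\<close>, \<open>R\<close>,
  \<open>P\<close> from \<open>a\<close> to \<open>b\<close> cuts the inside into two; the interior
  of an edge is connected and misses \<open>P\<close>, so it falls into one of them. In
  \<open>c1\<close> the path is traversed from \<open>b\<close> back to \<open>a\<close>, hence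
  \<open>rev m\<close>.\<close>

lemma chord_splits_disc:
  assumes disc: "disc_drawing V E \<phi> \<gamma> cs"
    and cs: "cs = a # l @ b # r" "c1 = a # l @ b # rev m" "c2 = b # r @ a # m"
    and m: "distinct (a # m @ [b])" "walk_edges (a # m @ [b]) \<subseteq> E - cycle_edges cs" "set m \<inter> set cs = {}"
  defines "P \<equiv> walk_edges (a # m @ [b])"
    and "V1 \<equiv> region_V c1 (inside (pts (cycle_edges c1)))" and "E1 \<equiv> region_E c1 (inside (pts (cycle_edges c1)))"
    and "V2 \<equiv> region_V c2 (inside (pts (cycle_edges c2)))" and "E2 \<equiv> region_E c2 (inside (pts (cycle_edges c2)))"
  shows "is_cycle E c1" "is_cycle E c2"
    "E - cycle_edges cs = (E1 - cycle_edges c1) \<union> (E2 - cycle_edges c2) \<union> P"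
    "E1 \<inter> E2 = P"
    "V - set cs = (V1 - set c1) \<union> (V2 - set c2) \<union> set m"
    "(V1 - set c1) \<inter> (V2 - set c2) = {}"
proof -
  have c: "is_cycle E cs"
    and inV: "\<And>v. v \<in> V - set cs \<Longrightarrow> \<phi> v \<in> inside (pts (cycle_edges cs))"
    and inE: "\<And>e. e \<in> E - cycle_edges cs \<Longrightarrow> interior_edge e \<subseteq> inside (pts (cycle_edges cs))"
    using disc by (auto simp: disc_drawing_def)
  define L where "L = walk_edges (a # l @ [b])"
  define R where "R = walk_edges (b # r @ [a])"
  have ce: "cycle_edges cs = L \<union> R" using cycle_edges_split cs by (simp add: L_def R_def)
  have ce1: "cycle_edges c1 = L \<union> P"
    using cycle_edges_split[of a l b "rev m"] walk_edges_rev[of "a # m @ [b]"] cs by (simp add: P_def L_def)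
  have ce2: "cycle_edges c2 = R \<union> P"
    using cycle_edges_split[of b r a m] cs by (simp add: P_def R_def)
  have PE: "P \<subseteq> E" "P \<inter> (L \<union> R) = {}" using m ce by (auto simp: P_def)
  have LRE: "L \<subseteq> E" "R \<subseteq> E" using c ce by (auto simp: is_cycle_def)
  \<comment> \<open>Otherwise the edge \<open>{a, b}\<close> would be on the cycle and on
    \<open>P\<close>. So both new cycles have length at least 3.\<close>
  have "l \<noteq> [] \<or> m \<noteq> []" "r \<noteq> [] \<or> m \<noteq> []"
    using PE by (auto simp: P_def L_def R_def insert_commute)
  then show c1: "is_cycle E c1" and c2: "is_cycle E c2"
    using c m cs PE LRE ce1 ce2 by (auto simp: is_cycle_def Suc_le_eq numeral_3_eq_3)
  have revP: "walk_edges (b # rev m @ [a]) = P"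
    using walk_edges_rev[of "a # m @ [b]"] by (simp add: P_def)
  obtain g1 g2 where g: "arc g1" "pathstart g1 = \<phi> a" "pathfinish g1 = \<phi> b" "path_image g1 = pts L"
    "arc g2" "pathstart g2 = \<phi> a" "pathfinish g2 = \<phi> b" "path_image g2 = pts R"
    "path_image g1 \<inter> path_image g2 = {\<phi> a, \<phi> b}"
    by (rule two_arcs[OF c[unfolded cs(1)], folded L_def R_def])
  obtain h1 h where h: "arc h1" "pathstart h1 = \<phi> a" "pathfinish h1 = \<phi> b" "path_image h1 = pts L"
    "arc h" "pathstart h = \<phi> a" "pathfinish h = \<phi> b" "path_image h = pts P"
    "path_image h1 \<inter> path_image h = {\<phi> a, \<phi> b}"
    by (rule two_arcs[OF c1[unfolded cs(2)], unfolded revP, folded L_def])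
  \<comment> \<open>The cycle \<open>c2\<close> contributes the fact that \<open>R\<close> and
    \<open>P\<close> meet only at their ends; the other two pairs of arcs are settled by
    \<open>cs\<close> and \<open>c1\<close>.\<close>
  obtain k1 k2 where k: "arc k1" "pathstart k1 = \<phi> b" "pathfinish k1 = \<phi> a" "path_image k1 = pts R"
    "arc k2" "pathstart k2 = \<phi> b" "pathfinish k2 = \<phi> a" "path_image k2 = pts P"
    "path_image k1 \<inter> path_image k2 = {\<phi> b, \<phi> a}"
    by (rule two_arcs[OF c2[unfolded cs(3)], folded R_def P_def])
  have "P \<noteq> {}" by (cases m) (auto simp: P_def)
  then obtain e0 where e0: "e0 \<in> P" by auto
  have sub0: "interior_edge e0 \<subseteq> inside (pts L \<union> pts R)"
    using inE[of e0] e0 m ce by (auto simp: P_def)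
  have ne: "path_image h \<inter> inside (path_image g1 \<union> path_image g2) \<noteq> {}"
  proof -
    obtain z where "z \<in> interior_edge e0" using interior_nonempty[of e0] e0 PE by blast
    with sub0 have "z \<in> pts P" "z \<in> inside (pts L \<union> pts R)" using e0 by blast+
    then show ?thesis unfolding g(4,8) h(8) by blast
  qed
  have ab: "\<phi> a \<noteq> \<phi> b"
    using cycle_in_V[OF c] cs c inj by (auto simp: is_cycle_def inj_on_def)
  have gh: "path_image g1 \<inter> path_image h = {\<phi> a, \<phi> b}" "path_image g2 \<inter> path_image h = {\<phi> a, \<phi> b}"
    using g h k by auto
  obtain split: "inside (pts L \<union> pts P) \<inter> inside (pts R \<union> pts P) = {}"
    "inside (pts L \<union> pts P) \<union> inside (pts R \<union> pts P) \<union> (pts P - {\<phi> a, \<phi> b}) = inside (pts L \<union> pts R)"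
    by (rule split_inside_simple_closed_curve[OF arc_imp_simple_path[OF g(1)] g(2,3)
          arc_imp_simple_path[OF g(5)] g(6,7) arc_imp_simple_path[OF h(5)] h(6,7) ab g(9) gh ne,
          unfolded g(4,8) h(8)])
  define I where "I = inside (pts L \<union> pts R)"
  define I1 where "I1 = inside (pts L \<union> pts P)"
  define I2 where "I2 = inside (pts R \<union> pts P)"
  note split = split[folded I_def I1_def I2_def]
  have I: "inside (pts (cycle_edges cs)) = I" "inside (pts (cycle_edges c1)) = I1"
    "inside (pts (cycle_edges c2)) = I2"
    by (simp_all add: ce ce1 ce2 I_def I1_def I2_def)
  have opn: "open I1" "open I2"
    using cycle_regions(2)[OF c1] cycle_regions(2)[OF c2] I by auto
  have disj: "I \<inter> (pts L \<union> pts R) = {}" "I1 \<inter> pts P = {}" "I2 \<inter> pts P = {}"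
    unfolding I_def I1_def I2_def using inside_no_overlap by blast+
  have E1: "E1 = {e \<in> E. e \<in> L \<union> P \<or> interior_edge e \<subseteq> I1}"
    and E2: "E2 = {e \<in> E. e \<in> R \<union> P \<or> interior_edge e \<subseteq> I2}"
    unfolding E1_def E2_def region_E_def I unfolding ce1 ce2 by (rule refl)+
  have not_in: "\<not> interior_edge e \<subseteq> J" if F: "e \<in> F" "F \<subseteq> E" "J \<inter> pts F = {}" for e F J
  proof
    assume "interior_edge e \<subseteq> J"
    moreover obtain z where "z \<in> interior_edge e" using interior_nonempty[of e] F(1,2) by blast
    ultimately have "z \<in> J" "z \<in> pts F" using F(1) by blast+
    with F(3) show False by blast
  qed
  have noI: "\<not> interior_edge e \<subseteq> I" if "e \<in> L \<union> R" for e
    using not_in[OF that] LRE disj(1) by (simp add: Un_subset_iff)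
  have sub: "I1 \<subseteq> I" "I2 \<subseteq> I" using split by auto
  have LR: "L \<inter> R = {}"
  proof -
    have "e \<notin> R" if "e \<in> L" for e
    proof
      assume "e \<in> R"
      then have "interior_edge e \<subseteq> {\<phi> a, \<phi> b}" using g that by blast
      moreover have "e \<in> E" using that LRE by auto
      moreover have "a \<in> V" "b \<in> V" using cycle_in_V[OF c] cs by auto
      ultimately show False using vertex_notin_edge[of e] interior_nonempty[of e] by blast
    qed
    then show ?thesis by auto
  qed
  show EE: "E - cycle_edges cs = (E1 - cycle_edges c1) \<union> (E2 - cycle_edges c2) \<union> P"
  proof (intro equalityI subsetI)
    fix e assume e: "e \<in> E - cycle_edges cs"
    show "e \<in> (E1 - cycle_edges c1) \<union> (E2 - cycle_edges c2) \<union> P"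
    proof (cases "e \<in> P")
      case False
      have "interior_edge e \<subseteq> I" using inE[OF e] I by simp
      moreover have "interior_edge e \<inter> pts P = {}"
        using interior_disjoint_pts[of e P] e PE False by auto
      ultimately have "interior_edge e \<subseteq> I1 \<union> I2" using split by blast
      then have "interior_edge e \<subseteq> I1 \<or> interior_edge e \<subseteq> I2"
        using Topological_Spaces.connectedD[OF interior_connected opn, of e] split(1) e by blast
      then show ?thesis using e False ce ce1 ce2 by (auto simp: E1 E2)
    qed auto
  next
    fix e assume "e \<in> (E1 - cycle_edges c1) \<union> (E2 - cycle_edges c2) \<union> P"
    then consider "e \<in> E" "interior_edge e \<subseteq> I1" | "e \<in> E" "interior_edge e \<subseteq> I2" | "e \<in> P"
      by (auto simp: E1 E2 ce1 ce2)
    then show "e \<in> E - cycle_edges cs"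
    proof cases
      case 1
      then show ?thesis using noI[of e] sub ce by auto
    next
      case 2
      then show ?thesis using noI[of e] sub ce by auto
    next
      case 3
      then show ?thesis using PE ce by auto
    qed
  qed
  show "E1 \<inter> E2 = P"
  proof (intro equalityI subsetI)
    fix e assume e: "e \<in> E1 \<inter> E2"
    show "e \<in> P"
    proof (rule ccontr)
      assume nP: "e \<notin> P"
      consider "e \<in> L" "e \<in> R" | "e \<in> L \<union> R" "interior_edge e \<subseteq> I"
        | "interior_edge e \<subseteq> I1" "interior_edge e \<subseteq> I2"
        using e nP sub by (auto simp: E1 E2)
      then show False
      proof cases
        case 3
        then show False using split(1) interior_nonempty[of e] e by (auto simp: E1)
      qed (use LR noI in auto)
    qed
  qed (use PE in \<open>auto simp: E1 E2\<close>)
  have setc: "set c1 = insert a (insert b (set l \<union> set m))" "set c2 = insert a (insert b (set r \<union> set m))"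
    "set cs = insert a (insert b (set l \<union> set r))" using cs by auto
  have V1: "V1 = {v \<in> V. v \<in> set c1 \<or> \<phi> v \<in> I1}" and V2: "V2 = {v \<in> V. v \<in> set c2 \<or> \<phi> v \<in> I2}"
    unfolding V1_def V2_def region_V_def I by (rule refl)+
  have mV: "set m \<subseteq> V" using cycle_in_V[OF c1] setc by auto
  have noV: "\<phi> v \<notin> I" if "v \<in> set cs" for v
    using cycle_image_vertex[OF c that] disj(1) ce by auto
  have noV1: "\<phi> v \<notin> I1" if "v \<in> set c1" for v
    using cycle_image_vertex[OF c1 that] inside_no_overlap I by blast
  have noV2: "\<phi> v \<notin> I2" if "v \<in> set c2" for v
    using cycle_image_vertex[OF c2 that] inside_no_overlap I by blast
  show "V - set cs = (V1 - set c1) \<union> (V2 - set c2) \<union> set m"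
  proof (intro equalityI subsetI)
    fix v assume v: "v \<in> V - set cs"
    show "v \<in> (V1 - set c1) \<union> (V2 - set c2) \<union> set m"
    proof (cases "v \<in> set m")
      case False
      have "\<phi> v \<in> I" using inV[OF v] I by simp
      moreover have "\<phi> v \<notin> pts P"
      proof
        assume "\<phi> v \<in> pts P"
        then have "v \<in> \<Union> P" using vertex_in_pts[OF PE(1)] v by auto
        then have "v \<in> set (a # m @ [b])" using walk_edges_subset unfolding P_def by blast
        with v False setc show False by auto
      qed
      ultimately have "\<phi> v \<in> I1 \<or> \<phi> v \<in> I2" using split by auto
      then show ?thesis using v False setc by (auto simp: V1 V2)
    qed auto
  next
    fix v assume "v \<in> (V1 - set c1) \<union> (V2 - set c2) \<union> set m"
    then consider "v \<in> V" "\<phi> v \<in> I1" | "v \<in> V" "\<phi> v \<in> I2" | "v \<in> set m"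
      by (auto simp: V1 V2)
    then show "v \<in> V - set cs"
      by cases (use noV sub mV m(3) in auto)
  qed
  show "(V1 - set c1) \<inter> (V2 - set c2) = {}"
    using split(1) by (auto simp: V1 V2)
qed

end

lemma disc_bound_rotate:
  assumes "cycle_edges cs' = cycle_edges cs" "set cs' = set cs" "length cs' = length cs"
  shows "disc_bound V E cs' \<longleftrightarrow> disc_bound V E cs"
  using assms by (simp add: disc_bound_def)

text \<open>The edges of the dividing path become boundary edges of both parts, so each part has
  fewer inner edges. The case \<open>m = []\<close> is an ordinary chord.\<close>

lemma disc_bound_if_chord:
  fixes V :: "'a set"
  assumes disc: "disc_drawing V E \<phi> \<gamma> cs" and N: "card (E - cycle_edges cs) \<le> N"
    and chord: "a \<in> set cs" "b \<in> set cs" "distinct (a # m @ [b])"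
      "walk_edges (a # m @ [b]) \<subseteq> E - cycle_edges cs" "set m \<inter> set cs = {}"
    and IH: "\<And>(V :: 'a set) E \<phi> \<gamma> cs. disc_drawing V E \<phi> \<gamma> cs \<Longrightarrow> card (E - cycle_edges cs) < N \<Longrightarrow> disc_bound V E cs"
  shows "disc_bound V E cs"
proof -
  interpret plane_graph V E \<phi> \<gamma> using disc by (simp add: disc_drawing_def)
  obtain cs0 where cs0: "cycle_edges (a # cs0) = cycle_edges cs" "set (a # cs0) = set cs"
    "length (a # cs0) = length cs" "distinct (a # cs0) \<longleftrightarrow> distinct cs"
    using cycle_edges_rotate[OF chord(1)] by blast
  have "b \<in> set cs0" using cs0(2) chord by auto
  then obtain l r where lr: "cs0 = l @ b # r" by (meson split_list)
  define cs' where "cs' = a # l @ b # r"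
  have cs': "cycle_edges cs' = cycle_edges cs" "set cs' = set cs" "length cs' = length cs" "distinct cs' \<longleftrightarrow> distinct cs"
    using cs0 lr by (simp_all add: cs'_def)
  have disc': "disc_drawing V E \<phi> \<gamma> cs'"
    using disc cs' by (simp add: disc_drawing_def is_cycle_def)
  define c1 where "c1 = a # l @ b # rev m"
  define c2 where "c2 = b # r @ a # m"
  define P where "P = walk_edges (a # m @ [b])"
  define V1 where "V1 = region_V c1 (inside (pts (cycle_edges c1)))"
  define E1 where "E1 = region_E c1 (inside (pts (cycle_edges c1)))"
  define V2 where "V2 = region_V c2 (inside (pts (cycle_edges c2)))"
  define E2 where "E2 = region_E c2 (inside (pts (cycle_edges c2)))"
  have ch: "distinct (a # m @ [b])" "walk_edges (a # m @ [b]) \<subseteq> E - cycle_edges cs'" "set m \<inter> set cs' = {}"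
    using chord cs' by auto
  note S = chord_splits_disc[OF disc' cs'_def c1_def c2_def ch, folded P_def V1_def E1_def V2_def E2_def]
  have D: "disc_drawing V1 E1 \<phi> \<gamma> c1" "disc_drawing V2 E2 \<phi> \<gamma> c2"
    unfolding V1_def E1_def V2_def E2_def by (rule disc_inside; fact S(1,2))+
  have PE: "P \<subseteq> E" "P \<noteq> {}" using chord by (auto simp: P_def) (cases m; auto)
  have sub: "E1 \<subseteq> E" "E2 \<subseteq> E" by (auto simp: E1_def E2_def region_E_def)
  have c12: "P \<subseteq> cycle_edges c1" "P \<subseteq> cycle_edges c2"
    using cycle_edges_split[of a l b "rev m"] walk_edges_rev[of "a # m @ [b]"] cycle_edges_split[of b r a m]
    by (simp_all add: P_def c1_def c2_def)
  have fin: "finite (E - cycle_edges cs')" using finite_E by auto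
  have "E1 - cycle_edges c1 \<subset> E - cycle_edges cs'" "E2 - cycle_edges c2 \<subset> E - cycle_edges cs'"
    unfolding S(3) using PE c12 by auto
  then have "card (E1 - cycle_edges c1) < N" "card (E2 - cycle_edges c2) < N"
    using psubset_card_mono[OF fin, of "E1 - cycle_edges c1"] psubset_card_mono[OF fin, of "E2 - cycle_edges c2"]
      N cs'(1) by simp_all
  then have B: "disc_bound V1 E1 c1" "disc_bound V2 E2 c2" by (auto intro: IH D)
  have "disc_bound V E cs'"
    by (rule disc_bound_theta[OF finite_V finite_E edge ch(1) cs'_def c1_def c2_def P_def sub PE(1) _ _ _ S(3-6) _ _ B])
      (use S(1,2) disc' is_cycle_region[OF S(1)] is_cycle_region[OF S(2)] in
        \<open>auto simp: disc_drawing_def is_cycle_def E1_def E2_def c1_def c2_def\<close>)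
  then show ?thesis using disc_bound_rotate cs' by metis
qed

text \<open>A boundary of length 3 has to count its own triangle, 4 = 1 + 3; from length 4 on the
  boundary length alone suffices.\<close>

lemma disc_bound_empty:
  assumes "is_cycle E cs" "E - cycle_edges cs = {}"
  shows "disc_bound V E cs"
proof (cases "length cs = 3")
  case True
  then obtain x y z where cs: "cs = [x, y, z]" by (auto simp: length_Suc_conv numeral_3_eq_3)
  have "card {t \<in> {set cs}. e \<subseteq> t} \<le> 1" for e
    using card_mono[of "{set cs}" "{t \<in> {set cs}. e \<subseteq> t}"] by auto
  moreover have "set cs \<in> triangles E"
    using assms(1) cs by (auto simp: triangles_def is_cycle_def cycle_edges_def insert_commute)
  ultimately show ?thesis
    unfolding disc_bound_def assms(2) using True by (intro exI[of _ "{set cs}"]) auto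
next
  case False
  then show ?thesis
    unfolding disc_bound_def assms(2) using assms(1) by (intro exI[of _ "{}"]) (auto simp: is_cycle_def)
qed

text \<open>
  If a disc contains an edge but no chord path, some component of the inner vertices has at most
  one neighbour on the cycle; it is a plane graph of its own, and it can be cut off.
\<close>

lemma disc_bound_step:
  fixes V :: "'a set"
  assumes disc: "disc_drawing V E \<phi> \<gamma> cs" and N: "card (E - cycle_edges cs) \<le> N"
    and IH: "\<And>(V :: 'a set) E \<phi> \<gamma> cs. disc_drawing V E \<phi> \<gamma> cs \<Longrightarrow>
      card (E - cycle_edges cs) < N \<Longrightarrow> disc_bound V E cs"
    and plane: "\<And>(V :: 'a set) E \<phi> \<gamma>. plane_graph V E \<phi> \<gamma> \<Longrightarrow> 2 \<le> card V \<Longrightarrow> card E \<le> N \<Longrightarrow> plane_bound V E"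
  shows "disc_bound V E cs"
proof (cases "E - cycle_edges cs = {}")
  case True
  then show ?thesis using disc disc_bound_empty by (auto simp: disc_drawing_def)
next
  case False
  interpret plane_graph V E \<phi> \<gamma> using disc by (simp add: disc_drawing_def)
  have c: "is_cycle E cs" using disc by (simp add: disc_drawing_def)
  show ?thesis
  proof (rule ccontr)
    assume nb: "\<not> disc_bound V E cs"
    have no_chord: False if "a \<in> set cs" "b \<in> set cs" "distinct (a # m @ [b])"
      "walk_edges (a # m @ [b]) \<subseteq> E - cycle_edges cs" "set m \<inter> set cs = {}" for a b m
      using disc_bound_if_chord[OF disc N that] IH nb by metis
    obtain e where e: "e \<in> E" "e \<notin> cycle_edges cs" using False by auto
    obtain p q where pq: "e = {p, q}" "p \<noteq> q" using edge[OF e(1)] by (auto simp: card_2_iff)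
    \<comment> \<open>Both ends on the cycle would make the edge a chord path with
      \<open>m = []\<close>.\<close>
    have "\<not> (p \<in> set cs \<and> q \<in> set cs)"
      using no_chord[of p q "[]"] pq e by auto
    then obtain x where x: "x \<in> e" "x \<notin> set cs" using pq by auto
    have xV: "x \<in> V" using edge[OF e(1)] x by auto
    \<comment> \<open>Adjacency of inner vertices; \<open>K\<close> is the component of
      \<open>x\<close>, and \<open>A\<close> will be the set of its attachments on the cycle. Two
      attachments would be joined by a path through \<open>K\<close>, that is, by a chord
      path.\<close>
    define R where "R = {(u, v). u \<notin> set cs \<and> v \<notin> set cs \<and> {u, v} \<in> E}"
    define K where "K = R\<^sup>* `` {x}"
    have symR: "sym (R\<^sup>*)" by (rule sym_rtrancl) (auto simp: sym_def R_def insert_commute)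
    have K: "k \<in> V \<and> k \<notin> set cs" if "k \<in> K" for k
    proof -
      have "(x, k) \<in> R\<^sup>*" using that by (simp add: K_def)
      then show ?thesis
        by (induction rule: rtrancl_induct) (use xV x edge in \<open>auto simp: R_def\<close>)
    qed
    have Kext: "v \<in> K" if "k \<in> K" "{k, v} \<in> E" "v \<notin> set cs" for k v
    proof -
      have "(k, v) \<in> R" using that K by (auto simp: R_def)
      then show ?thesis using that(1) by (auto simp: K_def)
    qed
    define A where "A = {a \<in> set cs. \<exists>k \<in> K. {a, k} \<in> E}"
    define EH where "EH = {e \<in> E. e \<inter> K \<noteq> {}}"
    have cA: "card A \<le> 1"
    proof (rule ccontr)
      assume "\<not> card A \<le> 1"
      then obtain a b where ab: "a \<in> A" "b \<in> A" "a \<noteq> b"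
        using card_le_Suc0_iff_eq[of A] by (auto simp: A_def)
      then obtain k k' where k: "k \<in> K" "{a, k} \<in> E" "k' \<in> K" "{b, k'} \<in> E" by (auto simp: A_def)
      have "(k, k') \<in> R\<^sup>*"
        using k symR unfolding K_def by (meson Image_singleton_iff rtrancl_trans symD)
      then obtain m where m: "m \<noteq> []" "distinct m" "hd m = k" "last m = k'"
        "\<forall>e \<in> walk_edges m. \<exists>a b. e = {a, b} \<and> (a, b) \<in> R" "\<forall>z \<in> set m. (k, z) \<in> R\<^sup>*"
        using rtrancl_imp_distinct_walk[of k k' R] by blast
      have mK: "set m \<subseteq> K" using m(6) k(1) unfolding K_def by (auto intro: rtrancl_trans)
      then have mcs: "set m \<inter> set cs = {}" using K by auto
      obtain m' where m': "m = k # m'" using m by (cases m) auto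
      obtain m'' where m'': "m = m'' @ [k']" using m by (metis append_butlast_last_id)
      have "walk_edges (a # m @ [b]) = insert {a, k} (walk_edges (m @ [b]))" using m' by simp
      also have "walk_edges (m @ [b]) = walk_edges m \<union> {{k', b}}"
        using walk_edges_append[of m'' k' "[b]"] m'' by simp
      finally have w: "walk_edges (a # m @ [b]) = insert {a, k} (walk_edges m \<union> {{k', b}})" .
      have "walk_edges m \<subseteq> E" using m(5) by (auto simp: R_def)
      then have wE: "walk_edges (a # m @ [b]) \<subseteq> E" using w k by (auto simp: insert_commute)
      have "f \<notin> cycle_edges cs" if f: "f \<in> walk_edges (a # m @ [b])" for f
      proof
        assume fc: "f \<in> cycle_edges cs"
        have "f \<noteq> {}" using edge[of f] wE f by auto
        moreover have "f = {a, k} \<or> f = {k', b} \<or> f \<subseteq> K"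
          using f w walk_edges_subset[of f m] mK by auto
        ultimately have "f \<inter> K \<noteq> {}" using k by auto
        then show False using cycle_edges_subset[OF fc] K by auto
      qed
      moreover have "distinct (a # m @ [b])" using ab m mcs by (auto simp: A_def)
      ultimately show False
        using no_chord[of a b m] ab wE mcs by (auto simp: A_def)
    qed
    have EHs: "f \<subseteq> K \<union> A" if f: "f \<in> EH" for f
    proof
      fix y assume y: "y \<in> f"
      obtain k where k: "k \<in> f" "k \<in> K" using f by (auto simp: EH_def)
      have fE: "f \<in> E" using f by (simp add: EH_def)
      show "y \<in> K \<union> A"
      proof (cases "y = k")
        case False
        have "{k, y} \<subseteq> f" "card {k, y} = 2" using y k False by auto
        then have "f = {k, y}" using edge[OF fE] by (metis card_subset_eq finite_V finite_subset)
        then show ?thesis using fE k Kext[of k y] by (auto simp: A_def insert_commute)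
      qed (use k in auto)
    qed
    have EHE: "EH \<subseteq> E" and KV: "K \<subseteq> V" and AV: "A \<subseteq> V"
      using K cycle_in_V[OF c] by (auto simp: EH_def A_def)
    have EHc: "EH \<inter> cycle_edges cs = {}" using K cycle_edges_subset by (fastforce simp: EH_def)
    have eH: "e \<in> EH" using e x by (auto simp: EH_def K_def)
    have pH: "plane_graph (K \<union> A) EH \<phi> \<gamma>"
      by (rule plane_subgraph) (use EHE KV AV EHs in auto)
    have "card e \<le> card (K \<union> A)"
      using EHs[OF eH] KV AV finite_V by (intro card_mono) (auto intro: finite_subset)
    then have "2 \<le> card (K \<union> A)" using edge[OF e(1)] by simp
    \<comment> \<open>\<open>EH\<close> may consist of all inner edges, so the plane bound is needed
      at \<open>N\<close> itself. This is not circular: the plane bound at \<open>N\<close> uses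
      disc bounds only below \<open>N\<close>.\<close>
    moreover have "EH \<subseteq> E - cycle_edges cs" using EHE EHc by auto
    then have "card EH \<le> N" using N card_mono[of "E - cycle_edges cs" EH] finite_E by auto
    ultimately have PB: "plane_bound (K \<union> A) EH" using plane[OF pH] by auto
    have pR: "plane_graph (V - K) (E - EH) \<phi> \<gamma>"
      by (rule plane_subgraph) (use edge in \<open>auto simp: EH_def\<close>)
    have "cycle_edges cs \<subseteq> E - EH" using c EHc by (auto simp: is_cycle_def)
    then have dR: "disc_drawing (V - K) (E - EH) \<phi> \<gamma> cs"
      using disc pR unfolding disc_drawing_def by (auto simp: is_cycle_def)
    have "E - EH - cycle_edges cs \<subset> E - cycle_edges cs" using e eH by auto
    then have "card (E - EH - cycle_edges cs) < N"
      using psubset_card_mono[of "E - cycle_edges cs" "E - EH - cycle_edges cs"] finite_E N by simp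
    then have DB: "disc_bound (V - K) (E - EH) cs" using IH[OF dR] by simp
    have "disc_bound V E cs"
      by (rule disc_bound_attach[OF finite_V finite_E edge KV _ _ cA EHE EHc _ PB DB])
        (use K c in \<open>auto simp: A_def is_cycle_def\<close>)
    with nb show False by simp
  qed
qed

lemma plane_bound_remove_vertex:
  assumes "plane_graph V E \<phi> \<gamma>" and v: "v \<in> V" "card {e \<in> E. v \<in> e} \<le> 2"
    and B: "plane_bound (V - {v}) {e \<in> E. v \<notin> e}"
  shows "plane_bound V E"
proof -
  interpret plane_graph V E \<phi> \<gamma> by fact
  obtain T where T: "T \<subseteq> triangles {e \<in> E. v \<notin> e}" "\<forall>e \<in> {e \<in> E. v \<notin> e}. card {t \<in> T. e \<subseteq> t} \<le> 2"
    "2 * card {e \<in> E. v \<notin> e} + 6 \<le> card T + 4 * card (V - {v})"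
    using B by (auto simp: plane_bound_def)
  have "E = {e \<in> E. v \<notin> e} \<union> {e \<in> E. v \<in> e}" by auto
  also have "card \<dots> = card {e \<in> E. v \<notin> e} + card {e \<in> E. v \<in> e}"
    using finite_E by (intro card_Un_disjoint) auto
  finally have "card E \<le> card {e \<in> E. v \<notin> e} + 2" using v by simp
  moreover have "card V = card (V - {v}) + 1"
    using v finite_V by (metis Suc_eq_plus1 card_Suc_Diff1)
  ultimately have "2 * card E + 6 \<le> card T + 4 * card V" using T(3) by linarith
  moreover have "card {t \<in> T. e \<subseteq> t} \<le> 2" if e: "e \<in> E" for e
  proof (cases "v \<in> e")
    case True
    then have "{t \<in> T. e \<subseteq> t} = {}"
      using no_triangle_over_foreign_edge[OF T(1), of e] edge[OF e] by auto
    then show ?thesis by (metis card.empty zero_le)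
  qed (use T(2) e in auto)
  moreover have "T \<subseteq> triangles E" using T(1) triangles_mono[of "{e \<in> E. v \<notin> e}" E] by auto
  ultimately show ?thesis unfolding plane_bound_def by blast
qed

text \<open>A vertex of degree at most 2 is deleted, which removes at most 2 * 2 on the left and 4
  on the right. If there is none, a cycle exists; its edges are inner edges of neither side, so both
  discs are below \<open>N\<close>.\<close>

lemma plane_bound_step:
  fixes V :: "'a set"
  assumes disc: "\<And>(V :: 'a set) E \<phi> \<gamma> cs. disc_drawing V E \<phi> \<gamma> cs \<Longrightarrow>
      card (E - cycle_edges cs) < N \<Longrightarrow> disc_bound V E cs"
  shows "plane_graph V E \<phi> \<gamma> \<Longrightarrow> 2 \<le> card V \<Longrightarrow> card E \<le> N \<Longrightarrow> plane_bound V E"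
proof (induction "card V" arbitrary: V E rule: less_induct)
  case less
  interpret plane_graph V E \<phi> \<gamma> by fact
  show ?case
  proof (cases "\<exists>v \<in> V. card {e \<in> E. v \<in> e} \<le> 2")
    case True
    then obtain v where v: "v \<in> V" "card {e \<in> E. v \<in> e} \<le> 2" by auto
    show ?thesis
    proof (cases "card V = 2")
      \<comment> \<open>A single edge on two vertices gives the equality 2 + 6 = 8, so the constant
        cannot exceed 6.\<close>
      case True
      have "E \<subseteq> {V}"
        using edge True card_subset_eq[OF finite_V] by (metis insertI1 subsetI)
      then have "card E \<le> 1" using card_mono[of "{V}" E] by auto
      with True show ?thesis
        unfolding plane_bound_def by (intro exI[of _ "{}"]) auto
    next
      case False
      have cV: "card (V - {v}) = card V - 1" using v finite_V by simp
      have "plane_graph (V - {v}) {e \<in> E. v \<notin> e} \<phi> \<gamma>"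
        by (rule plane_subgraph) (use edge in auto)
      moreover have "card {e \<in> E. v \<notin> e} \<le> N"
        using card_mono[of E "{e \<in> E. v \<notin> e}"] finite_E less(4) by auto
      ultimately have "plane_bound (V - {v}) {e \<in> E. v \<notin> e}"
        using less(3) False by (intro less(1)) (auto simp: cV)
      then show ?thesis using plane_bound_remove_vertex[OF less(2) v] by simp
    qed
  next
    case False
    obtain cs where cs: "distinct cs" "3 \<le> length cs" "set cs \<subseteq> V" "cycle_edges cs \<subseteq> E"
      by (rule cycle_exists[of V E]) (use False finite_V less(3) edge in \<open>auto simp: not_le\<close>)
    then have c: "is_cycle E cs" by (simp add: is_cycle_def)
    define \<Gamma> where "\<Gamma> = pts (cycle_edges cs)"
    note reg = cycle_regions[OF c, folded \<Gamma>_def]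
    define V1 where "V1 = region_V cs (inside \<Gamma>)"
    define E1 where "E1 = region_E cs (inside \<Gamma>)"
    define V2 where "V2 = region_V cs (outside \<Gamma>)"
    define E2 where "E2 = region_E cs (outside \<Gamma>)"
    have c12: "is_cycle E1 cs" "is_cycle E2 cs"
      unfolding E1_def E2_def using is_cycle_region[OF c] by auto
    have D1: "disc_drawing V1 E1 \<phi> \<gamma> cs" unfolding V1_def E1_def \<Gamma>_def by (rule disc_inside[OF c])
    have "plane_graph V2 E2 \<phi> \<gamma>"
      unfolding V2_def E2_def \<Gamma>_def by (rule plane_region[OF c cycle_regions(10)[OF c]])
    moreover have "\<forall>v \<in> V2 - set cs. \<phi> v \<in> outside \<Gamma>" "\<forall>e \<in> E2 - cycle_edges cs. interior_edge e \<subseteq> outside \<Gamma>"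
      by (auto simp: V2_def E2_def region_V_def region_E_def)
    ultimately obtain \<phi>' \<gamma>' where D2: "disc_drawing V2 E2 \<phi>' \<gamma>' cs"
      using disc_outside_inversion[OF _ c12(2)] unfolding \<Gamma>_def by blast
    have EE: "E1 \<union> E2 = E"
      using interior_inside_or_outside[OF c] unfolding E1_def E2_def region_E_def \<Gamma>_def by blast
    have EI: "E1 \<inter> E2 = cycle_edges cs"
    proof (intro equalityI subsetI)
      fix e assume e: "e \<in> E1 \<inter> E2"
      show "e \<in> cycle_edges cs"
      proof (rule ccontr)
        assume "e \<notin> cycle_edges cs"
        then have "interior_edge e \<subseteq> inside \<Gamma> \<inter> outside \<Gamma>" "e \<in> E"
          using e unfolding E1_def E2_def region_E_def by blast+
        then show False using interior_nonempty[of e] reg(7) by blast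
      qed
    qed (use c12 in \<open>auto simp: is_cycle_def\<close>)
    have VU: "V1 \<union> V2 = V"
    proof -
      have "\<phi> v \<in> inside \<Gamma> \<or> \<phi> v \<in> outside \<Gamma>" if "v \<in> V" "v \<notin> set cs" for v
        using vertex_in_cycle[OF c that(1)] that(2) reg(8) unfolding \<Gamma>_def by blast
      then show ?thesis by (auto simp: V1_def V2_def region_V_def)
    qed
    have VI: "V1 \<inter> V2 = set cs"
      using reg(7) cs(3) unfolding V1_def V2_def region_V_def by blast
    have "cycle_edges cs \<noteq> {}" using card_cycle_edges[OF cs(1,2)] cs(2) by auto
    then have "E1 - cycle_edges cs \<subset> E" "E2 - cycle_edges cs \<subset> E" using EE EI by auto
    then have "card (E1 - cycle_edges cs) < N" "card (E2 - cycle_edges cs) < N"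
      using psubset_card_mono[OF finite_E, of "E1 - cycle_edges cs"]
        psubset_card_mono[OF finite_E, of "E2 - cycle_edges cs"] less(4) by auto
    then have B: "disc_bound V1 E1 cs" "disc_bound V2 E2 cs" using disc D1 D2 by blast+
    show ?thesis
      by (rule plane_bound_two_sides[OF finite_V finite_E edge c cs(3) EE EI VU VI B])
  qed
qed

theorem plane_graph_bound:
  fixes V :: "'a set"
  assumes "plane_graph V E \<phi> \<gamma>" "2 \<le> card V"
  shows "plane_bound V E"
proof -
  have disc: "disc_bound V E cs" if "disc_drawing V E \<phi> \<gamma> cs" "card (E - cycle_edges cs) \<le> N"
    for N and V :: "'a set" and E \<phi> \<gamma> cs
    using that
  proof (induction N arbitrary: V E \<phi> \<gamma> cs rule: less_induct)
    case (less N)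
    have IH: "disc_bound V E cs" if "disc_drawing V E \<phi> \<gamma> cs" "card (E - cycle_edges cs) < N"
      for V :: "'a set" and E \<phi> \<gamma> cs
      using less(1)[OF that(2) that(1)] by simp
    have plane: "plane_bound V E" if "plane_graph V E \<phi> \<gamma>" "2 \<le> card V" "card E \<le> N"
      for V :: "'a set" and E \<phi> \<gamma>
      by (rule plane_bound_step[OF _ that]) (rule IH)
    show ?case by (rule disc_bound_step[OF less(2,3)]) (use IH plane in blast)+
  qed
  show ?thesis
    by (rule plane_bound_step[where N = "card E", OF _ assms]) (use disc in blast)+
qed

section \<open>Reducible configurations\<close>

locale simple_graph =
  fixes V :: "'a set" and E :: "'a set set"
  assumes finite_V: "finite V" and edge: "e \<in> E \<Longrightarrow> e \<subseteq> V \<and> card e = 2"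
begin

definition nbr :: "'a \<Rightarrow> 'a set" where "nbr x = {y. {x, y} \<in> E}"

abbreviation "deg x \<equiv> card (nbr x)"

lemma finite_E: "finite E"
  by (rule finite_subset[of _ "Pow V"]) (use edge finite_V in auto)

lemma nbr_sym: "y \<in> nbr x \<longleftrightarrow> x \<in> nbr y"
  by (simp add: nbr_def insert_commute)

lemma nbrD: "y \<in> nbr x \<Longrightarrow> x \<in> V \<and> y \<in> V \<and> x \<noteq> y"
  using edge[of "{x, y}"] by (auto simp: nbr_def)

lemma nbr_subset: "nbr x \<subseteq> V"
  using nbrD by auto

lemma finite_nbr [simp]: "finite (nbr x)"
  using finite_subset[OF nbr_subset finite_V] .

lemma edges_at_nbr: "{e \<in> E. x \<in> e} = (\<lambda>y. {x, y}) ` nbr x"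
proof (intro equalityI subsetI)
  fix e assume e: "e \<in> {e \<in> E. x \<in> e}"
  then obtain p q where "e = {p, q}" using edge[of e] by (auto simp: card_2_iff)
  with e have "\<exists>y. e = {x, y}" by auto
  then show "e \<in> (\<lambda>y. {x, y}) ` nbr x" using e by (auto simp: nbr_def)
qed (auto simp: nbr_def)

lemma deg_eq: "deg x = card {e \<in> E. x \<in> e}"
proof -
  have "inj_on (\<lambda>y. {x, y}) (nbr x)" by (auto simp: inj_on_def doubleton_eq_iff)
  then show ?thesis by (simp add: edges_at_nbr card_image)
qed

lemma sum_deg: "(\<Sum>x\<in>V. deg x) = 2 * card E"
proof -
  have "card {x \<in> V. x \<in> e} = 2" if "e \<in> E" for e
  proof -
    have "{x \<in> V. x \<in> e} = e" using edge[OF that] by auto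
    then show ?thesis using edge[OF that] by simp
  qed
  then have "(\<Sum>x\<in>V. card {e \<in> E. x \<in> e}) = (\<Sum>e\<in>E. 2)"
    by (intro sum_multicount_gen finite_V finite_E) auto
  then show ?thesis by (simp add: deg_eq)
qed

lemma card_nbr_Diff: "A \<subseteq> nbr x \<Longrightarrow> A \<subseteq> C \<Longrightarrow> card (nbr x - C) + card A \<le> deg x"
proof -
  assume A: "A \<subseteq> nbr x" "A \<subseteq> C"
  have "card (nbr x - C) + card A = card ((nbr x - C) \<union> A)"
    using A finite_subset[OF A(1)] by (subst card_Un_disjoint) auto
  also have "\<dots> \<le> deg x" using A by (intro card_mono) auto
  finally show ?thesis .
qed

text \<open>
  Colouring the vertices of \<open>xs\<close> in this order with pairwise distinct colours, the \<open>j\<close>-th vertex still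
  has \<open>k - j\<close> colours left, one of which occurs at most once on its neighbours outside \<open>xs\<close>.
\<close>

definition reducible :: "nat \<Rightarrow> bool" where
  "reducible k \<longleftrightarrow> (\<exists>xs. distinct xs \<and> length xs = k \<and> set xs \<subseteq> V \<and>
     (\<forall>j < k. card (nbr (xs ! j) - set xs) \<le> 2 * (k - j) - 1))"

text \<open>Repeatedly take a vertex with at most five neighbours among those not yet taken. Later
  choices only shrink the set of outer neighbours, so the final bound does not depend on the
  position in \<open>ys\<close>.\<close>

lemma low_degree_sequence:
  assumes degenerate: "\<And>W. W \<subseteq> V \<Longrightarrow> W \<noteq> {} \<Longrightarrow> \<exists>x \<in> W. card (nbr x \<inter> W) \<le> 5"
    and "n \<le> card (V - Z)"
  shows "\<exists>ys. distinct ys \<and> length ys = n \<and> set ys \<subseteq> V - Z \<and>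
    (\<forall>y \<in> set ys. card (nbr y - (Z \<union> set ys)) \<le> 5)"
  using assms(2)
proof (induction n)
  case 0
  then show ?case by (intro exI[of _ "[]"]) auto
next
  case (Suc n)
  then obtain ys where ys: "distinct ys" "length ys = n" "set ys \<subseteq> V - Z"
    "\<forall>y \<in> set ys. card (nbr y - (Z \<union> set ys)) \<le> 5" by auto
  define W where "W = V - Z - set ys"
  have "card W = card (V - Z) - n"
    using ys unfolding W_def by (subst card_Diff_subset) (auto simp: distinct_card)
  then have "W \<noteq> {}" using Suc(2) by auto
  then obtain y where y: "y \<in> W" "card (nbr y \<inter> W) \<le> 5"
    using degenerate[of W] by (auto simp: W_def)
  have "card (nbr y - (Z \<union> set (ys @ [y]))) \<le> card (nbr y \<inter> W)"
    using nbr_subset by (intro card_mono) (auto simp: W_def)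
  moreover have "card (nbr x - (Z \<union> set (ys @ [y]))) \<le> card (nbr x - (Z \<union> set ys))" for x
    by (intro card_mono) auto
  ultimately have "\<forall>x \<in> set (ys @ [y]). card (nbr x - (Z \<union> set (ys @ [y]))) \<le> 5"
    using ys(4) y(2) by (metis (no_types, lifting) Un_iff empty_iff empty_set insert_iff le_trans list.simps(15) set_append)
  then show ?case
    using ys y by (intro exI[of _ "ys @ [y]"]) (auto simp: W_def)
qed

text \<open>The low-degree vertices go into the middle, where k - j is at least 3 and 2 * 3 - 1 = 5
  outer neighbours are allowed.\<close>

lemma reducible_core:
  assumes degenerate: "\<And>W. W \<subseteq> V \<Longrightarrow> W \<noteq> {} \<Longrightarrow> \<exists>x \<in> W. card (nbr x \<inter> W) \<le> 5"
    and k: "5 \<le> k" "k \<le> card V"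
    and core: "distinct (tops @ [v, u])" "set (tops @ [v, u]) \<subseteq> V" "length tops \<le> 3"
    and tops: "\<And>j. j < length tops \<Longrightarrow> card (nbr (tops ! j) - set (tops @ [v, u])) \<le> 2 * (k - j) - 1"
    and v: "card (nbr v - set (tops @ [v, u])) \<le> 3"
    and u: "card (nbr u - set (tops @ [v, u])) \<le> 1"
  shows "reducible k"
proof -
  define Z where "Z = set (tops @ [v, u])"
  define n where "n = k - 2 - length tops"
  have "card Z = length tops + 2" using core(1) unfolding Z_def by (simp add: distinct_card del: set_append)
  then have "card (V - Z) = card V - (length tops + 2)"
    using core(2) unfolding Z_def by (simp add: card_Diff_subset del: set_append)
  then have "n \<le> card (V - Z)" using k by (simp add: n_def)
  then obtain ys where ys: "distinct ys" "length ys = n" "set ys \<subseteq> V - Z"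
    "\<forall>y \<in> set ys. card (nbr y - (Z \<union> set ys)) \<le> 5"
    using low_degree_sequence[OF degenerate] by blast
  define xs where "xs = tops @ ys @ [v, u]"
  have set_xs: "set xs = Z \<union> set ys" by (auto simp: xs_def Z_def)
  have mono: "card (nbr x - set xs) \<le> card (nbr x - Z)" for x
    using set_xs by (intro card_mono) auto
  have len: "length xs = k" using ys(2) core(3) k by (simp add: xs_def n_def)
  have "card (nbr (xs ! j) - set xs) \<le> 2 * (k - j) - 1" if j: "j < k" for j
  proof -
    consider "j < length tops" | "length tops \<le> j" "j < k - 2" | "j = k - 2" | "j = k - 1"
      using j by linarith
    then show ?thesis
    proof cases
      case 1
      then have "xs ! j = tops ! j" by (simp add: xs_def nth_append)
      then show ?thesis using mono[of "xs ! j"] tops[OF 1] by (simp add: Z_def)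
    next
      case 2
      then have "xs ! j = ys ! (j - length tops)" "j - length tops < n"
        using ys(2) by (auto simp: xs_def nth_append n_def)
      then have "xs ! j \<in> set ys" using ys(2) by auto
      then have "card (nbr (xs ! j) - set xs) \<le> 5" using ys(4) set_xs by auto
      then show ?thesis using 2(2) by linarith
    next
      case 3
      then have "xs ! j = v"
        using ys(2) core(3) k by (auto simp: xs_def nth_append n_def)
      then show ?thesis using mono[of v] v 3 k unfolding Z_def by simp
    next
      case 4
      then have "xs ! j = u"
        using ys(2) core(3) k by (auto simp: xs_def nth_append n_def nth_Cons split: nat.split)
      then show ?thesis using mono[of u] u 4 k unfolding Z_def by simp
    qed
  qed
  then show ?thesis
    unfolding reducible_def using len core ys
    by (intro exI[of _ xs]) (auto simp: xs_def Z_def)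
qed

end

text \<open>What a plane graph without a suitable set of k vertices would satisfy, except for the
  lower bound on \<open>card T\<close>, which discharging is going to contradict.\<close>

locale irreducible_graph = simple_graph V E for V :: "'a set" and E +
  fixes T :: "'a set set" and k :: nat
  assumes T_sub: "T \<subseteq> triangles E"
    and T_edge: "e \<in> E \<Longrightarrow> card {t \<in> T. e \<subseteq> t} \<le> 2"
    and k: "5 \<le> k" "k \<le> card V"
    and max_deg: "x \<in> V \<Longrightarrow> deg x \<le> 2 * k - 1"
    and degenerate: "W \<subseteq> V \<Longrightarrow> W \<noteq> {} \<Longrightarrow> \<exists>x \<in> W. card (nbr x \<inter> W) \<le> 5"
    and irreducible: "\<not> reducible k"
begin

lemma no_core:
  assumes "distinct (tops @ [v, u])" "set (tops @ [v, u]) \<subseteq> V" "length tops \<le> 3"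
    "\<And>j. j < length tops \<Longrightarrow> card (nbr (tops ! j) - set (tops @ [v, u])) \<le> 2 * (k - j) - 1"
    "card (nbr v - set (tops @ [v, u])) \<le> 3"
    "card (nbr u - set (tops @ [v, u])) \<le> 1"
  shows False
  using reducible_core[OF degenerate k assms] irreducible by blast

lemma card_nbr_Diff_max: "x \<in> V \<Longrightarrow> card (nbr x - C) \<le> 2 * k - 1"
  using card_nbr_Diff[of "{}" x C] max_deg[of x] by simp

text \<open>
  The vertices \<open>a\<close>, \<open>b\<close>, \<open>c\<close> take the indices \<open>k\<close>, \<open>k - 1\<close>, \<open>k - 2\<close>, and \<open>v\<close>, \<open>u\<close> the indices 2, 1. The sets
  \<open>B\<close>, \<open>C\<close>, \<open>W\<close>, \<open>U\<close> collect known neighbours of \<open>b\<close>, \<open>c\<close>, \<open>v\<close>, \<open>u\<close> inside the configuration.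
\<close>

lemma no_core3:
  assumes S: "distinct [a, b, c, v, u]" "{a, b, c, v, u} \<subseteq> V"
    and b: "B \<subseteq> nbr b \<inter> {a, b, c, v, u}" "deg b + 3 \<le> 2 * k + card B"
    and c: "C \<subseteq> nbr c \<inter> {a, b, c, v, u}" "deg c + 5 \<le> 2 * k + card C"
    and v: "W \<subseteq> nbr v \<inter> {a, b, c, v, u}" "deg v \<le> 3 + card W"
    and u: "U \<subseteq> nbr u \<inter> {a, b, c, v, u}" "deg u \<le> 1 + card U"
  shows False
proof (rule no_core[of "[a, b, c]" v u])
  fix j assume "j < length [a, b, c]"
  then consider "j = 0" | "j = 1" | "j = 2" by force
  then show "card (nbr ([a, b, c] ! j) - set ([a, b, c] @ [v, u])) \<le> 2 * (k - j) - 1"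
  proof cases
    case 1
    then show ?thesis using card_nbr_Diff_max[of a] S by simp
  next
    case 2
    then show ?thesis using card_nbr_Diff[of B b "{a, b, c, v, u}"] b by simp
  next
    case 3
    then show ?thesis using card_nbr_Diff[of C c "{a, b, c, v, u}"] c by simp
  qed
qed (use S card_nbr_Diff[of W v "{a, b, c, v, u}"] card_nbr_Diff[of U u "{a, b, c, v, u}"] v u in auto)

lemma no_core2:
  assumes S: "distinct [a, b, v, u]" "{a, b, v, u} \<subseteq> V"
    and b: "B \<subseteq> nbr b \<inter> {a, b, v, u}" "deg b + 3 \<le> 2 * k + card B"
    and v: "W \<subseteq> nbr v \<inter> {a, b, v, u}" "deg v \<le> 3 + card W"
    and u: "U \<subseteq> nbr u \<inter> {a, b, v, u}" "deg u \<le> 1 + card U"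
  shows False
proof (rule no_core[of "[a, b]" v u])
  fix j assume "j < length [a, b]"
  then consider "j = 0" | "j = 1" by force
  then show "card (nbr ([a, b] ! j) - set ([a, b] @ [v, u])) \<le> 2 * (k - j) - 1"
  proof cases
    case 1
    then show ?thesis using card_nbr_Diff_max[of a] S by simp
  next
    case 2
    then show ?thesis using card_nbr_Diff[of B b "{a, b, v, u}"] b by simp
  qed
qed (use S card_nbr_Diff[of W v "{a, b, v, u}"] card_nbr_Diff[of U u "{a, b, v, u}"] v u in auto)

section \<open>Counting the triangles of T at a vertex\<close>

lemma T_triangle:
  assumes "{u, v, w} \<in> T"
  shows "u \<noteq> v" "u \<noteq> w" "v \<noteq> w" "v \<in> nbr u" "w \<in> nbr u" "u \<in> nbr v" "w \<in> nbr v" "u \<in> nbr w" "v \<in> nbr w"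
    "u \<in> V" "v \<in> V" "w \<in> V"
proof -
  have t: "card {u, v, w} = 3" "\<And>x y. x \<in> {u, v, w} \<Longrightarrow> y \<in> {u, v, w} \<Longrightarrow> x \<noteq> y \<Longrightarrow> {x, y} \<in> E"
    using assms T_sub by (auto simp: triangles_def)
  then show n: "u \<noteq> v" "u \<noteq> w" "v \<noteq> w" by (auto simp: card_insert_if split: if_splits)
  show "v \<in> nbr u" "w \<in> nbr u" "u \<in> nbr v" "w \<in> nbr v" "u \<in> nbr w" "v \<in> nbr w"
    using n t(2) by (auto simp: nbr_def)
  then show "u \<in> V" "v \<in> V" "w \<in> V" using nbrD by blast+
qed

lemma T_third:
  assumes "t \<in> T" "x \<in> t" "y \<in> t" "x \<noteq> y"
  obtains z where "t = {x, y, z}"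
proof -
  have "card t = 3" using assms T_sub by (auto simp: triangles_def)
  then have "card (t - {x, y}) = 1" using assms by (subst card_Diff_subset) auto
  then obtain z where "t - {x, y} = {z}" by (auto simp: card_1_singleton_iff)
  then have "t = {x, y, z}" using assms by auto
  then show ?thesis by (rule that)
qed

lemma T_others:
  assumes "t \<in> T" "x \<in> t"
  obtains y z where "t = {x, y, z}"
proof -
  have "card t = 3" using assms T_sub by (auto simp: triangles_def)
  then have "t \<noteq> {x}" by auto
  then obtain y where "y \<in> t" "x \<noteq> y" using assms by auto
  then show ?thesis using T_third[OF assms, of y] that by blast
qed

lemma finite_T: "finite T"
proof -
  have "\<Union> E \<subseteq> V" using edge by auto
  then show ?thesis
    using finite_triangles[of E] T_sub finite_V finite_subset by metis
qed

definition tri_at :: "'a \<Rightarrow> 'a set set" where "tri_at x = {t \<in> T. x \<in> t}"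

abbreviation "tau x y \<equiv> card {t \<in> T. {x, y} \<subseteq> t}"

lemma finite_tri_at [simp]: "finite (tri_at x)" using finite_T by (simp add: tri_at_def)

lemma sum_tau: "(\<Sum>y \<in> nbr x. tau x y) = 2 * card (tri_at x)"
proof -
  have "card {y \<in> nbr x. y \<in> t} = 2" if t: "t \<in> tri_at x" for t
  proof -
    obtain y z where yz: "t = {x, y, z}" using T_others[of t x] t by (auto simp: tri_at_def)
    then have "{x, y, z} \<in> T" using t by (simp add: tri_at_def)
    note tr = T_triangle[OF this]
    have "{y \<in> nbr x. y \<in> t} = {y, z}" using yz tr nbrD by auto
    then show ?thesis using tr by simp
  qed
  then have "(\<Sum>y \<in> nbr x. card {t \<in> tri_at x. y \<in> t}) = (\<Sum>t \<in> tri_at x. 2)"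
    by (intro sum_multicount_gen) auto
  moreover have "{t \<in> tri_at x. y \<in> t} = {t \<in> T. {x, y} \<subseteq> t}" for y by (auto simp: tri_at_def)
  ultimately show ?thesis by simp
qed

text \<open>A triangle at \<open>x\<close> uses two edges at \<open>x\<close>, and an edge carries
  at most two triangles; so every edge without a triangle costs one triangle.\<close>

lemma card_tri_at_le_if_tau_0:
  assumes "Y \<subseteq> nbr x" "\<And>y. y \<in> Y \<Longrightarrow> tau x y = 0"
  shows "card (tri_at x) + card Y \<le> deg x"
proof -
  have "2 * card (tri_at x) = (\<Sum>y \<in> nbr x - Y. tau x y) + (\<Sum>y \<in> Y. tau x y)"
    unfolding sum_tau[symmetric] using assms(1) by (intro sum.subset_diff) auto
  also have "(\<Sum>y \<in> Y. tau x y) = 0" using assms(2) by auto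
  also have "(\<Sum>y \<in> nbr x - Y. tau x y) \<le> (\<Sum>y \<in> nbr x - Y. 2)"
    by (intro sum_mono T_edge) (auto simp: nbr_def)
  finally have "card (tri_at x) \<le> card (nbr x - Y)" by simp
  also have "\<dots> + card Y = deg x"
    using assms(1) card_Diff_subset[of Y "nbr x"] card_mono[of "nbr x" Y] finite_subset[of Y] by auto
  finally show ?thesis by simp
qed

lemma card_tri_at_le: "card (tri_at x) \<le> deg x"
  using card_tri_at_le_if_tau_0[of "{}" x] by simp

text \<open>A single missing incidence leaves at most 2 * deg x - 1 of them, and by parity a whole
  triangle is lost.\<close>

lemma card_tri_at_less_if_tau_1:
  assumes "y \<in> nbr x" "tau x y \<le> 1"
  shows "card (tri_at x) < deg x"
proof -
  have "2 * card (tri_at x) = (\<Sum>y \<in> nbr x - {y}. tau x y) + tau x y"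
    unfolding sum_tau[symmetric] using sum.subset_diff[of "{y}" "nbr x" "tau x"] assms(1) by auto
  also have "(\<Sum>y \<in> nbr x - {y}. tau x y) \<le> (\<Sum>y \<in> nbr x - {y}. 2)"
    by (intro sum_mono T_edge) (auto simp: nbr_def)
  finally have "2 * card (tri_at x) \<le> 2 * (deg x - 1) + 1" using assms by simp
  moreover have "deg x > 0" using assms by (auto simp: card_gt_0_iff)
  ultimately show ?thesis by linarith
qed

lemma tau_le_1:
  assumes "nbr u \<inter> nbr v \<subseteq> {w}"
  shows "tau u v \<le> 1" "tau v u \<le> 1"
proof -
  have "{t \<in> T. {u, v} \<subseteq> t} \<subseteq> {{u, v, w}}"
  proof
    fix t assume t: "t \<in> {t \<in> T. {u, v} \<subseteq> t}"
    show "t \<in> {{u, v, w}}"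
    proof (cases "u = v")
      case True
      obtain y z where yz: "t = {u, y, z}" using T_others[of t u] t by auto
      then have "{u, y, z} \<in> T" using t by auto
      from T_triangle(3,4,5)[OF this] assms True show ?thesis by auto
    next
      case False
      then obtain z where z: "t = {u, v, z}" using T_third[of t u v] t by auto
      then have "{u, v, z} \<in> T" using t by auto
      from T_triangle(5,7)[OF this] have "z = w" using assms by auto
      then show ?thesis using z by simp
    qed
  qed
  then have "card {t \<in> T. {u, v} \<subseteq> t} \<le> card {{u, v, w}}" by (intro card_mono) auto
  then show "tau u v \<le> 1" "tau v u \<le> 1" by (simp_all add: insert_commute)
qed

lemma tau_2_third:
  assumes "{u, v, w} \<in> T" "\<not> tau u v \<le> 1"
  obtains p where "{u, v, p} \<in> T" "p \<noteq> w"
proof -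
  have "\<not> {t \<in> T. {u, v} \<subseteq> t} \<subseteq> {{u, v, w}}"
    using assms(2) card_mono[of "{{u, v, w}}" "{t \<in> T. {u, v} \<subseteq> t}"] by auto
  then obtain t where t: "t \<in> T" "u \<in> t" "v \<in> t" "t \<noteq> {u, v, w}" by auto
  obtain p where "t = {u, v, p}" using T_third[OF t(1-3)] T_triangle(1)[OF assms(1)] by blast
  then show ?thesis using that[of p] t by auto
qed

section \<open>Forbidden neighbourhoods of vertices of small degree\<close>

lemma another_nbr:
  assumes "card A < deg u" "finite A"
  obtains c where "c \<in> nbr u" "c \<notin> A"
proof -
  have "\<not> nbr u \<subseteq> A" using assms card_mono[of A "nbr u"] by auto
  then show ?thesis using that by auto
qed

text \<open>The pattern of the lemmas below. At index 1, \<open>u\<close> needs three of its four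
  neighbours in the set, here \<open>v\<close>, \<open>w\<close> and some \<open>p\<close>; at index
  2, \<open>v\<close> needs two of its at most five, here \<open>u\<close> and \<open>w\<close>. Any
  vertex may take index k, so \<open>p\<close> does; \<open>w\<close> takes k - 1, where its
  neighbours \<open>u\<close>, \<open>v\<close> reduce 2k - 1 to the admissible 2k - 3.\<close>

lemma deg4_no_deg5:
  assumes t: "{u, v, w} \<in> T" and u: "deg u = 4"
  shows "6 \<le> deg v"
proof (rule ccontr)
  assume v: "\<not> 6 \<le> deg v"
  note tr = T_triangle[OF t]
  obtain p where p: "p \<in> nbr u" "p \<notin> {v, w}"
    using another_nbr[of "{v, w}" u] u tr by auto
  have "p \<in> V" "p \<noteq> u" using nbrD[OF p(1)] by auto
  then show False
    using tr p v u max_deg[of w] k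
    by (intro no_core2[of p w v u "{u, v}" "{u, w}" "{v, w, p}"]) auto
qed

text \<open>A second common neighbour \<open>p\<close> is a third neighbour in the set for both
  \<open>u\<close> and \<open>v\<close>, and 6 - 3 = 3.\<close>

lemma deg4_deg6_common:
  assumes t: "{u, v, w} \<in> T" and u: "deg u = 4" and v: "deg v = 6"
  shows "nbr u \<inter> nbr v \<subseteq> {w}"
proof (rule ccontr)
  assume "\<not> nbr u \<inter> nbr v \<subseteq> {w}"
  then obtain p where p: "p \<in> nbr u" "p \<in> nbr v" "p \<noteq> w" by auto
  note tr = T_triangle[OF t]
  have "p \<in> V" "p \<noteq> u" "p \<noteq> v" using nbrD[OF p(1)] nbrD[OF p(2)] by auto
  then show False
    using tr p v u max_deg[of w] k
    by (intro no_core2[of p w v u "{u, v}" "{u, w, p}" "{v, w, p}"]) auto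
qed

text \<open>A vertex \<open>s\<close> of degree at most 5 fits index k - 2 without help, as 5 is at
  most 2k - 5, and it is the third neighbour that \<open>v\<close> needs.\<close>

lemma deg4_deg6_low:
  assumes t: "{u, v, w} \<in> T" and u: "deg u = 4" and v: "deg v = 6"
    and s: "s \<in> nbr v" "deg s \<le> 5"
  shows "s = u"
proof (rule ccontr)
  assume su: "s \<noteq> u"
  note tr = T_triangle[OF t]
  have "6 \<le> deg w" using deg4_no_deg5[of u w v] t u by (simp add: insert_commute)
  then have sw: "s \<noteq> w" using s by auto
  then have snu: "s \<notin> nbr u" using deg4_deg6_common[OF t u v] s by auto
  obtain c where c: "c \<in> nbr u" "c \<notin> {v, w}"
    using another_nbr[of "{v, w}" u] u tr by auto
  have "c \<in> V" "c \<noteq> u" "s \<in> V" "s \<noteq> v" using nbrD[OF c(1)] nbrD[OF s(1)] by auto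
  then show False
    using tr c s sw su snu v u max_deg[of w] k
    by (intro no_core3[of c w s v u "{u, v}" "{}" "{u, w, s}" "{v, w, c}"]) auto
qed

text \<open>Two triangles on the edge \<open>uv\<close> make \<open>w\<close> and \<open>p\<close>
  neighbours of both ends; with \<open>u\<close> and \<open>s\<close> this gives \<open>v\<close>
  four neighbours in the set, and 7 - 4 = 3.\<close>

lemma deg4_deg7_low:
  assumes t: "{u, v, w} \<in> T" "{u, v, p} \<in> T" "p \<noteq> w" and u: "deg u = 4" and v: "deg v = 7"
    and s: "s \<in> nbr v" "deg s \<le> 5"
  shows "s = u"
proof (rule ccontr)
  assume su: "s \<noteq> u"
  note tr = T_triangle[OF t(1)] T_triangle[OF t(2)]
  have "6 \<le> deg w" "6 \<le> deg p"
    using deg4_no_deg5[of u w v] deg4_no_deg5[of u p v] t u by (simp_all add: insert_commute)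
  then have sw: "s \<noteq> w" "s \<noteq> p" using s by auto
  have "s \<in> V" "s \<noteq> v" using nbrD[OF s(1)] by auto
  then show False
    using tr s sw su v u t(3) max_deg[of w] k
    by (intro no_core3[of p w s v u "{u, v}" "{}" "{u, w, p, s}" "{v, w, p}"]) auto
qed

text \<open>The threshold 7 arises here: \<open>w\<close> takes index k - 2 and has
  \<open>u\<close>, \<open>v\<close> in the set, which admits degree 2k - 5 + 2, and this is at
  least 7.\<close>

lemma deg5_deg6_common:
  assumes t: "{u, v, w} \<in> T" and u: "deg u = 5" and v: "deg v = 6" and w: "deg w \<le> 7"
  shows "nbr u \<inter> nbr v \<subseteq> {w}"
proof (rule ccontr)
  assume "\<not> nbr u \<inter> nbr v \<subseteq> {w}"
  then obtain p where p: "p \<in> nbr u" "p \<in> nbr v" "p \<noteq> w" by auto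
  note tr = T_triangle[OF t]
  have pV: "p \<in> V" "p \<noteq> u" "p \<noteq> v" "u \<in> nbr p" "v \<in> nbr p"
    using nbrD[OF p(1)] nbrD[OF p(2)] nbr_sym p by auto
  obtain c where c: "c \<in> nbr u" "c \<notin> {v, w, p}"
    using another_nbr[of "{v, w, p}" u] u tr p pV by auto
  have "c \<in> V" "c \<noteq> u" using nbrD[OF c(1)] by auto
  then show False
    using tr p c pV v u w max_deg[of p] k
    by (intro no_core3[of c p w v u "{u, v}" "{u, v}" "{u, w, p}" "{v, w, p, c}"]) auto
qed

text \<open>\<open>u\<close> needs two more neighbours \<open>c\<close>, \<open>c'\<close> in the
  set besides \<open>v\<close>, \<open>w\<close>. One of them, \<open>c'\<close>, takes index k - 1
  and must have a neighbour \<open>x\<close> there other than \<open>u\<close>; any further triangle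
  of \<open>T\<close> at \<open>u\<close> provides one.\<close>

lemma deg5_deg5_small:
  assumes t: "{u, v, w} \<in> T" and u: "deg u = 5" and v: "deg v = 5" and w: "deg w \<le> 7"
  shows "tri_at u = {{u, v, w}}"
proof (rule ccontr)
  assume "tri_at u \<noteq> {{u, v, w}}"
  note tr = T_triangle[OF t]
  have core: False if c: "c \<in> nbr u" "c' \<in> nbr u" "c \<noteq> c'" "c \<notin> {v, w}" "c' \<notin> {v, w}"
    and x: "x \<in> nbr c'" "x \<in> {v, w, c}" for c c' x
  proof -
    have "c \<in> V" "c \<noteq> u" "c' \<in> V" "c' \<noteq> u" "u \<in> nbr c'"
      using nbrD[OF c(1)] nbrD[OF c(2)] nbr_sym c by auto
    moreover have "card {u, x} = 2" using x tr \<open>c \<noteq> u\<close> by auto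
    ultimately show False
      using tr c x v u w max_deg[of c'] k
      by (intro no_core3[of c c' w v u "{u, x}" "{u, v}" "{u, w}" "{v, w, c, c'}"]) auto
  qed
  have "{u, v, w} \<in> tri_at u" using t by (simp add: tri_at_def)
  with \<open>tri_at u \<noteq> {{u, v, w}}\<close> obtain t' where t': "t' \<in> T" "u \<in> t'" "t' \<noteq> {u, v, w}" by (auto simp: tri_at_def)
  have ex: "\<exists>a b. {u, a, b} \<in> T \<and> a \<notin> {v, w}"
  proof -
    obtain a b where ab: "t' = {u, a, b}" using T_others[OF t'(1,2)] by blast
    then have T': "{u, a, b} \<in> T" "{u, b, a} \<in> T" using t' by (auto simp: insert_commute)
    show ?thesis
    proof (cases "a \<in> {v, w}")
      case True
      then have "b \<notin> {v, w}" using t' ab T_triangle(3)[OF T'(1)] by auto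
      then show ?thesis using T' by blast
    qed (use T' in blast)
  qed
  then obtain a b where ab: "{u, a, b} \<in> T" "a \<notin> {v, w}" by blast
  note tr' = T_triangle[OF ab(1)]
  show False
  proof (cases "b \<in> {v, w}")
    case True
    obtain c where c: "c \<in> nbr u" "c \<notin> {v, w, a}"
      by (rule another_nbr[of "{v, w, a}" u]) (use u in \<open>auto simp: card_insert_if\<close>)
    show False by (rule core[of c a b]) (use c tr' ab True in auto)
  next
    case False
    show False by (rule core[of b a b]) (use False tr' ab in auto)
  qed
qed

text \<open>With degree at most 7, \<open>y\<close> could take index k - 2, having \<open>u\<close>
  and \<open>w\<close> in the set. The lemma serves to find a triangle at \<open>u\<close> that
  draws no charge from \<open>u\<close>.\<close>

lemma deg5_deg5_large:
  assumes t: "{u, v, w} \<in> T" and u: "deg u = 5" and v: "deg v = 5" and w: "{u, w, y} \<in> T" "y \<noteq> v"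
  shows "8 \<le> deg y"
proof (rule ccontr)
  assume y: "\<not> 8 \<le> deg y"
  note tr = T_triangle[OF t] T_triangle[OF w(1)]
  obtain c where c: "c \<in> nbr u" "c \<notin> {v, w, y}"
    using another_nbr[of "{v, w, y}" u] u tr w by auto
  have "c \<in> V" "c \<noteq> u" using nbrD[OF c(1)] by auto
  then show False
    using tr c v u w y max_deg[of w] k
    by (intro no_core3[of c w y v u "{u, v, y}" "{u, w}" "{u, w}" "{v, w, y, c}"]) auto
qed

text \<open>Since \<open>v\<close> fits index 2 on its own, it remains to bring \<open>u\<close>
  down to one outer neighbour, by putting neighbours of \<open>u\<close> at indices k and k - 1. For
  degree 3 both are needed, and index k - 1 refuses \<open>b\<close> only if \<open>b\<close> has
  degree 2k - 1 and no neighbour in the set but \<open>u\<close>.\<close>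

lemma two_deg3:
  assumes uv: "u \<in> V" "v \<in> V" "u \<noteq> v" "deg u \<le> 3" "deg v \<le> 3"
  shows "deg u = 3" "tri_at u = {}" "\<And>b. b \<in> nbr u \<Longrightarrow> deg b = 2 * k - 1"
proof -
  have few: False if small: "card (nbr u - {v}) \<le> 2"
  proof (cases "nbr u - {v} = {}")
    case True
    then have "nbr u - {v, u} = {}" by auto
    then have "card (nbr u - {v, u}) \<le> 1" by (metis card.empty zero_le)
    then show False
      using uv card_nbr_Diff[of "{}" v "{v, u}"]
      by (intro no_core[of "[]" v u]) auto
  next
    case False
    then obtain a where a: "a \<in> nbr u" "a \<noteq> v" by auto
    have aV: "a \<in> V" "a \<noteq> u" using nbrD[OF a(1)] by auto
    have "nbr u - set ([a] @ [v, u]) \<subseteq> nbr u - {v} - {a}" by auto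
    then have "card (nbr u - set ([a] @ [v, u])) \<le> card (nbr u - {v} - {a})" by (intro card_mono) auto
    also have "\<dots> \<le> 1" using small a by simp
    finally show False
      using uv a aV card_nbr_Diff[of "{}" v "set ([a] @ [v, u])"] card_nbr_Diff_max[of a]
      by (intro no_core[of "[a]" v u]) auto
  qed
  have "card (nbr u - {v}) \<le> deg u" by (intro card_mono) auto
  with few uv show d3: "deg u = 3" by fastforce
  have vn: "v \<notin> nbr u"
    using few d3 by fastforce
  have pair: False if ab: "a \<in> nbr u" "b \<in> nbr u" "a \<noteq> b" and b: "deg b \<noteq> 2 * k - 1 \<or> a \<in> nbr b" for a b
  proof -
    have V: "a \<in> V" "a \<noteq> u" "b \<in> V" "b \<noteq> u" "u \<in> nbr b" "a \<noteq> v" "b \<noteq> v"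
      using nbrD[OF ab(1)] nbrD[OF ab(2)] nbr_sym ab vn by auto
    define B where "B = (if a \<in> nbr b then {a, u} else {u})"
    have "deg b + 3 \<le> 2 * k + card B" using b max_deg[OF V(3)] V k by (auto simp: B_def)
    moreover have "B \<subseteq> nbr b \<inter> {a, b, v, u}" using V by (auto simp: B_def)
    ultimately show False
      using V ab uv d3 by (intro no_core2[of a b v u B "{}" "{a, b}"]) auto
  qed
  show "deg b = 2 * k - 1" if b: "b \<in> nbr u" for b
  proof -
    obtain a where "a \<in> nbr u" "a \<notin> {b}" using another_nbr[of "{b}" u] d3 by auto
    then show ?thesis using pair[of a b] b by auto
  qed
  show "tri_at u = {}"
  proof (rule ccontr)
    assume "tri_at u \<noteq> {}"
    then obtain t where t: "t \<in> T" "u \<in> t" by (auto simp: tri_at_def)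
    then obtain a b where "t = {u, a, b}" using T_others by blast
    then have "{u, a, b} \<in> T" using t by simp
    from T_triangle[OF this] show False using pair[of a b] by auto
  qed
qed

end

section \<open>Discharging\<close>

lemma sort_three:
  fixes f :: "'b \<Rightarrow> nat"
  obtains u v w where "{x, y, z} = {u, v, w}" "f u \<le> f v" "f v \<le> f w"
proof -
  consider "f x \<le> f y" "f y \<le> f z" | "f x \<le> f z" "f z \<le> f y" | "f y \<le> f x" "f x \<le> f z"
    | "f y \<le> f z" "f z \<le> f x" | "f z \<le> f x" "f x \<le> f y" | "f z \<le> f y" "f y \<le> f x" by linarith
  then show ?thesis
    by cases (use that in \<open>auto simp: insert_commute\<close>)
qed

context irreducible_graph
begin

text \<open>A triangle that is not low lives on 1/3 from each of its vertices.\<close>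

definition low :: "'a set \<Rightarrow> bool" where "low t \<longleftrightarrow> (\<exists>y \<in> t. deg y \<le> 5)"

definition n_low :: "'a \<Rightarrow> nat" where "n_low x = card {t \<in> tri_at x. low t}"
definition n_high :: "'a \<Rightarrow> nat" where "n_high x = card {t \<in> tri_at x. \<not> low t}"

text \<open>In the remaining triangles at \<open>x\<close> the other two vertices have degree at
  least 8 and pay 1/2 each, so a vertex of degree 5 can save its charge for the needy ones.\<close>

definition needy :: "'a \<Rightarrow> 'a set \<Rightarrow> bool" where "needy x t \<longleftrightarrow> (\<exists>y \<in> t. y \<noteq> x \<and> deg y \<le> 7)"
definition n_needy :: "'a \<Rightarrow> nat" where "n_needy x = card {t \<in> tri_at x. needy x t}"

text \<open>
  The part of its charge \<open>deg x - 4\<close> that the vertex \<open>x\<close> passes on to the triangle \<open>t \<in> tri_at x\<close>; every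
  triangle has to collect 1. No division by 0 occurs, since \<open>t\<close> itself is counted in \<open>n_low x\<close> or
  \<open>n_needy x\<close>.
\<close>

definition weight :: "'a \<Rightarrow> 'a set \<Rightarrow> real" where
  "weight x t =
     (if 8 \<le> deg x then 1 / 2
      else if 6 \<le> deg x then (if low t then (real (deg x) - 4 - real (n_high x) / 3) / real (n_low x) else 1 / 3)
      else if deg x = 5 \<and> needy x t then 1 / real (n_needy x)
      else 0)"

lemma n_low_high: "n_low x + n_high x = card (tri_at x)"
proof -
  have "tri_at x = {t \<in> tri_at x. low t} \<union> {t \<in> tri_at x. \<not> low t}" by auto
  also have "card \<dots> = n_low x + n_high x"
    unfolding n_low_def n_high_def by (intro card_Un_disjoint) auto
  finally show ?thesis by simp
qed

lemma n_low_pos: "t \<in> tri_at x \<Longrightarrow> low t \<Longrightarrow> 1 \<le> n_low x"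
  unfolding n_low_def by (auto simp: Suc_le_eq card_gt_0_iff)

text \<open>At most \<open>n - n_low x\<close> triangles take 1/3 each and the low ones share the
  rest; the fraction is this share, expanded by 3. Putting \<open>n_low x = n\<close> gives the
  later constants: 2/5 for degree 6 and n = 5, 3/7 and 1/2 for degree 7 and n = 7, 6. For degree 6
  and n = 6 it is always 1/3.\<close>

lemma weight_mid:
  assumes "t \<in> tri_at x" "low t" "deg x = 6 \<or> deg x = 7" "card (tri_at x) \<le> n"
  shows "weight x t \<ge> (3 * real (deg x) - 12 - real n + real (n_low x)) / (3 * real (n_low x))"
proof -
  have L: "1 \<le> n_low x" using n_low_pos assms by auto
  have "real (n_high x) \<le> real n - real (n_low x)" using n_low_high[of x] assms(4) by linarith
  then have "(3 * real (deg x) - 12 - real n + real (n_low x)) / (3 * real (n_low x)) \<le>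
    (3 * real (deg x) - 12 - real (n_high x)) / (3 * real (n_low x))"
    using L by (intro divide_right_mono) auto
  also have "\<dots> = weight x t" using L assms(2,3) by (auto simp: weight_def field_simps)
  finally show ?thesis .
qed

lemma weight_6: "t \<in> tri_at x \<Longrightarrow> low t \<Longrightarrow> deg x = 6 \<Longrightarrow> weight x t \<ge> 1 / 3"
  using weight_mid[of t x 6] card_tri_at_le[of x] n_low_pos[of t x] by (simp add: field_simps)

lemma weight_6': "t \<in> tri_at x \<Longrightarrow> low t \<Longrightarrow> deg x = 6 \<Longrightarrow> card (tri_at x) \<le> 5 \<Longrightarrow> weight x t \<ge> 2 / 5"
proof -
  assume a: "t \<in> tri_at x" "low t" "deg x = 6" "card (tri_at x) \<le> 5"
  have "n_low x \<le> 5" "1 \<le> n_low x" using a n_low_high[of x] n_low_pos by auto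
  then have "(3 * real (deg x) - 12 - real 5 + real (n_low x)) / (3 * real (n_low x)) \<ge> 2 / 5"
    using a by (simp add: field_simps)
  then show ?thesis using weight_mid[of t x 5] a by linarith
qed

lemma weight_7: "t \<in> tri_at x \<Longrightarrow> low t \<Longrightarrow> deg x = 7 \<Longrightarrow> weight x t \<ge> 3 / 7"
proof -
  assume a: "t \<in> tri_at x" "low t" "deg x = 7"
  have "n_low x \<le> 7" "1 \<le> n_low x" using a n_low_high[of x] n_low_pos card_tri_at_le[of x] by auto
  then have "(3 * real (deg x) - 12 - real 7 + real (n_low x)) / (3 * real (n_low x)) \<ge> 3 / 7"
    using a by (simp add: field_simps)
  then show ?thesis using weight_mid[of t x 7] a card_tri_at_le[of x] by linarith
qed

lemma weight_8: "8 \<le> deg x \<Longrightarrow> weight x t = 1 / 2"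
  by (simp add: weight_def)

lemma weight_ge_third: "t \<in> tri_at x \<Longrightarrow> 6 \<le> deg x \<Longrightarrow> weight x t \<ge> 1 / 3"
proof -
  assume a: "t \<in> tri_at x" "6 \<le> deg x"
  consider "deg x = 6" | "deg x = 7" | "8 \<le> deg x" using a by linarith
  then show ?thesis
  proof cases
    case 1
    then show ?thesis using a weight_6[of t x] by (cases "low t") (auto simp: weight_def)
  next
    case 2
    show ?thesis
    proof (cases "low t")
      case True
      then show ?thesis using weight_7[OF a(1) _ 2] by linarith
    qed (use 2 in \<open>simp add: weight_def\<close>)
  qed (simp add: weight_8)
qed

lemma weight_nonneg: "t \<in> tri_at x \<Longrightarrow> weight x t \<ge> 0"
proof -
  assume t: "t \<in> tri_at x"
  show ?thesis
  proof (cases "6 \<le> deg x")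
    case True
    then show ?thesis using weight_ge_third[OF t] by linarith
  qed (simp add: weight_def)
qed

lemma weight_5:
  assumes "t \<in> tri_at x" "deg x = 5" "needy x t" "n_needy x \<le> n"
  shows "weight x t \<ge> 1 / real n"
proof -
  have "0 < n_needy x" using assms unfolding n_needy_def by (auto simp: card_gt_0_iff)
  then show ?thesis using assms by (simp add: weight_def frac_le)
qed

lemma n_needy_le: "n_needy x \<le> card (tri_at x)"
  unfolding n_needy_def by (intro card_mono) auto

text \<open>\<open>Y\<close> is going to be the set of neighbours of degree 3, which receive 1/2
  each. Edges to \<open>Y\<close> carry no triangle, so a vertex of degree d pays at most d/2, and
  d/2 is at most d - 4 precisely from d = 8 on.\<close>

lemma weight_budget:
  assumes x: "4 \<le> deg x" and Y: "Y \<subseteq> nbr x" "\<And>y. y \<in> Y \<Longrightarrow> tau x y = 0" "8 \<le> deg x \<or> Y = {}"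
  shows "(\<Sum>t \<in> tri_at x. weight x t) + real (card Y) / 2 \<le> real (deg x) - 4"
proof -
  consider "8 \<le> deg x" | "deg x = 6 \<or> deg x = 7" "Y = {}" | "deg x = 5" "Y = {}" | "deg x = 4" "Y = {}"
    using x Y(3) by linarith
  then show ?thesis
  proof cases
    case 1
    have "real (card (tri_at x)) + real (card Y) \<le> real (deg x)"
      using card_tri_at_le_if_tau_0[OF Y(1,2)] by linarith
    then show ?thesis using 1 by (simp add: weight_8)
  next
    case 2
    have "(\<Sum>t \<in> tri_at x. weight x t) = (\<Sum>t \<in> {t \<in> tri_at x. low t}. weight x t) + (\<Sum>t \<in> {t \<in> tri_at x. \<not> low t}. weight x t)"
      by (subst sum.union_disjoint[symmetric]) (auto intro: sum.cong)
    also have "(\<Sum>t \<in> {t \<in> tri_at x. \<not> low t}. weight x t) = (\<Sum>t \<in> {t \<in> tri_at x. \<not> low t}. 1 / 3)"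
      using 2 by (intro sum.cong refl) (auto simp: weight_def)
    also have "\<dots> = real (n_high x) / 3" by (simp add: n_high_def)
    also have "(\<Sum>t \<in> {t \<in> tri_at x. low t}. weight x t) =
        (\<Sum>t \<in> {t \<in> tri_at x. low t}. (real (deg x) - 4 - real (n_high x) / 3) / real (n_low x))"
      using 2 by (intro sum.cong refl) (auto simp: weight_def)
    also have "\<dots> = real (n_low x) * ((real (deg x) - 4 - real (n_high x) / 3) / real (n_low x))"
      unfolding n_low_def by (simp only: sum_constant)
    finally have S: "(\<Sum>t \<in> tri_at x. weight x t) =
       real (n_low x) * ((real (deg x) - 4 - real (n_high x) / 3) / real (n_low x)) + real (n_high x) / 3" .
    show ?thesis
    \<comment> \<open>Without low triangles at most a third of the degree is paid, which is within
      the charge from degree 6 on.\<close>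
    proof (cases "n_low x = 0")
      case True
      then have "real (n_high x) \<le> real (deg x)" using n_low_high[of x] card_tri_at_le[of x] by linarith
      then show ?thesis using S True 2 by auto
    next
      case False
      then show ?thesis using S 2 by simp
    qed
  next
    case 3
    have "(\<Sum>t \<in> tri_at x. weight x t) = (\<Sum>t \<in> tri_at x. if needy x t then 1 / real (n_needy x) else 0)"
      using 3 by (simp add: weight_def)
    also have "\<dots> = (\<Sum>t \<in> {t \<in> tri_at x. needy x t}. 1 / real (n_needy x))"
      by (rule sum.inter_filter[symmetric]) simp
    also have "\<dots> = real (n_needy x) / real (n_needy x)" by (simp add: n_needy_def)
    also have "\<dots> \<le> 1" by simp
    finally show ?thesis using 3 by simp
  next
    case 4
    then show ?thesis by (simp add: weight_def)
  qed
qed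

lemma low_at:
  assumes "{u, v, w} \<in> T" "deg u \<le> 5"
  shows "low {u, v, w}" "{u, v, w} \<in> tri_at u" "{u, v, w} \<in> tri_at v" "{u, v, w} \<in> tri_at w"
  using assms by (auto simp: low_def tri_at_def)

lemma low_triangles_with_u:
  assumes "6 \<le> deg v" "\<And>s. s \<in> nbr v \<Longrightarrow> deg s \<le> 5 \<Longrightarrow> s = u" "u \<noteq> v"
  shows "n_low v \<le> tau u v"
proof -
  have "{t \<in> tri_at v. low t} \<subseteq> {t \<in> T. {u, v} \<subseteq> t}"
  proof
    fix t assume t: "t \<in> {t \<in> tri_at v. low t}"
    then obtain s where s: "s \<in> t" "deg s \<le> 5" by (auto simp: low_def)
    have tT: "t \<in> T" "v \<in> t" using t by (auto simp: tri_at_def)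
    have sv: "v \<noteq> s" using s assms(1) by auto
    obtain z where "t = {v, s, z}" using T_third[OF tT s(1) sv] by blast
    then have "{v, s, z} \<in> T" using tT by simp
    then have "s \<in> nbr v" by (rule T_triangle)
    then have "s = u" using assms(2) s by simp
    then show "t \<in> {t \<in> T. {u, v} \<subseteq> t}" using tT s by auto
  qed
  then show ?thesis
    unfolding n_low_def using finite_T by (intro card_mono) auto
qed

text \<open>There is one low triangle at \<open>v\<close> among at most five, so of the charge 2 at
  least 2 - 4/3 is left for it.\<close>

lemma weight_deg4_deg6:
  assumes t: "{u, v, w} \<in> T" and u: "deg u = 4" and v: "deg v = 6"
  shows "weight v {u, v, w} \<ge> 2 / 3"
proof -
  note tr = T_triangle[OF t]
  note at = low_at[OF t]
  have tau: "tau u v \<le> 1" "tau v u \<le> 1" using tau_le_1[OF deg4_deg6_common[OF t u v]] by auto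
  have "n_low v \<le> 1"
  proof -
    have "n_low v \<le> tau u v"
      by (rule low_triangles_with_u) (use deg4_deg6_low[OF t u v] v tr(1) in simp_all)
    then show ?thesis using tau(1) by simp
  qed
  then have L: "n_low v = 1" using n_low_pos[of "{u, v, w}" v] at u by simp
  have "card (tri_at v) \<le> 5" using card_tri_at_less_if_tau_1[of u v] tau tr v by simp
  then have "weight v {u, v, w} \<ge> (3 * real (deg v) - 12 - real 5 + real (n_low v)) / (3 * real (n_low v))"
    using at u v by (intro weight_mid) simp_all
  then show ?thesis using L v by simp
qed

text \<open>For degree 7, either \<open>uv\<close> lies in one triangle only and \<open>v\<close>
  loses a triangle, or the at most two triangles on \<open>uv\<close> are the only low ones at
  \<open>v\<close>.\<close>

lemma weight_deg4_deg7:
  assumes t: "{u, v, w} \<in> T" and u: "deg u = 4" and v: "7 \<le> deg v"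
  shows "weight v {u, v, w} \<ge> 1 / 2"
proof (cases "deg v = 7")
  case True
  note tr = T_triangle[OF t]
  note at = low_at[OF t]
  have L1: "1 \<le> n_low v" using n_low_pos[of "{u, v, w}" v] at u by simp
  show ?thesis
  proof (cases "tau u v \<le> 1")
    case tau: True
    then have "tau v u \<le> 1" by (simp add: insert_commute)
    then have c: "card (tri_at v) \<le> 6" using card_tri_at_less_if_tau_1[of u v] tr True by simp
    then have "n_low v \<le> 6" using n_low_high[of v] by simp
    then have "(3 * real (deg v) - 12 - real 6 + real (n_low v)) / (3 * real (n_low v)) \<ge> 1 / 2"
      using True L1 by (simp add: field_simps)
    moreover have "weight v {u, v, w} \<ge> (3 * real (deg v) - 12 - real 6 + real (n_low v)) / (3 * real (n_low v))"
      using at u True c by (intro weight_mid) simp_all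
    ultimately show ?thesis by linarith
  next
    case False
    obtain p where p: "{u, v, p} \<in> T" "p \<noteq> w" using tau_2_third[OF t False] by blast
    have "{u, v} \<in> E" using tr by (simp add: nbr_def)
    then have "tau u v \<le> 2" by (rule T_edge)
    have "n_low v \<le> 2"
    proof -
      have "n_low v \<le> tau u v"
        by (rule low_triangles_with_u) (use deg4_deg7_low[OF t p u True] True tr(1) in simp_all)
      then show ?thesis using \<open>tau u v \<le> 2\<close> by simp
    qed
    then have "(3 * real (deg v) - 12 - real 7 + real (n_low v)) / (3 * real (n_low v)) \<ge> 1 / 2"
      using True L1 by (simp add: field_simps)
    moreover have "weight v {u, v, w} \<ge> (3 * real (deg v) - 12 - real 7 + real (n_low v)) / (3 * real (n_low v))"
      using at u True card_tri_at_le[of v] by (intro weight_mid) simp_all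
    ultimately show ?thesis by linarith
  qed
next
  case False
  then show ?thesis using v by (simp add: weight_8)
qed

text \<open>Five needy triangles would be all that fit around \<open>u\<close>, so \<open>uw\<close>
  would lie in a second one; but its third vertex has degree at least 8, like \<open>w\<close>, so
  it is not needy.\<close>

lemma weight_deg5_deg5:
  assumes t: "{u, v, w} \<in> T" and u: "deg u = 5" and v: "deg v = 5" and w: "8 \<le> deg w"
  shows "weight u {u, v, w} \<ge> 1 / 4"
proof -
  note tr = T_triangle[OF t]
  note at = low_at[OF t]
  have "n_needy u \<le> 4"
  proof (rule ccontr)
    assume "\<not> n_needy u \<le> 4"
    then have five: "5 \<le> n_needy u" "5 \<le> card (tri_at u)" using n_needy_le[of u] by linarith+
    have "\<not> tau u w \<le> 1" using card_tri_at_less_if_tau_1[of w u] tr u five by auto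
    then obtain y where y: "{u, w, y} \<in> T" "y \<noteq> v"
      using tau_2_third[of u w v] t by (auto simp: insert_commute)
    have "8 \<le> deg y" using deg5_deg5_large[OF t u v y] .
    then have "\<not> needy u {u, w, y}" using w by (auto simp: needy_def)
    then have "{t \<in> tri_at u. needy u t} \<subset> tri_at u" using y by (auto simp: tri_at_def)
    then have "n_needy u < card (tri_at u)" unfolding n_needy_def by (intro psubset_card_mono) auto
    then show False using card_tri_at_le[of u] u five by simp
  qed
  moreover have "needy u {u, v, w}" using v tr by (auto simp: needy_def)
  ultimately show ?thesis using weight_5[of "{u, v, w}" u 4] at u by simp
qed

lemma triangle_weight_sorted:
  assumes t: "{u, v, w} \<in> T" and d: "4 \<le> deg u" "deg u \<le> deg v" "deg v \<le> deg w"
  shows "weight u {u, v, w} + weight v {u, v, w} + weight w {u, v, w} \<ge> 1"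
proof -
  note tr = T_triangle[OF t]
  have at: "{u, v, w} \<in> tri_at u" "{u, v, w} \<in> tri_at v" "{u, v, w} \<in> tri_at w"
    using t by (auto simp: tri_at_def)
  note nonneg = weight_nonneg[OF at(1)] weight_nonneg[OF at(2)] weight_nonneg[OF at(3)]
  note third = weight_ge_third[OF at(1)] weight_ge_third[OF at(2)] weight_ge_third[OF at(3)]
  have tuwv: "{u, w, v} \<in> T" and eq: "{u, w, v} = {u, v, w}" using t by (auto simp: insert_commute)
  \<comment> \<open>The sums, case by case: 2/3 + 1/3 or 1/2 + 1/2; then 1 from \<open>u\<close>
    alone; 1/4 + 1/4 + 1/2; 1/4 + 2/5 + 2/5; 1/5 + 1/3 + 1/2; 1/2 + 1/2 or 1/5 + 3/7 + 3/7; and 1/3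
    three times.\<close>
  consider (c4) "deg u = 4" | (c55) "deg u = 5" "deg v = 5" "deg w \<le> 7" | (c55') "deg u = 5" "deg v = 5" "8 \<le> deg w"
    | (c56) "deg u = 5" "deg v = 6" "deg w \<le> 7" | (c56') "deg u = 5" "deg v = 6" "8 \<le> deg w"
    | (c57) "deg u = 5" "7 \<le> deg v" | (c6) "6 \<le> deg u" using d by linarith
  then show ?thesis
  proof cases
    case c4
    have "6 \<le> deg v" "6 \<le> deg w" using deg4_no_deg5[OF t c4] deg4_no_deg5[OF tuwv c4] by auto
    show ?thesis
    proof (cases "deg v = 6")
      case True
      then show ?thesis using weight_deg4_deg6[OF t c4 True] third(3) nonneg(1) \<open>6 \<le> deg w\<close> by linarith
    next
      case False
      then have "7 \<le> deg v" "7 \<le> deg w" using \<open>6 \<le> deg v\<close> d by auto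
      then show ?thesis
        using weight_deg4_deg7[OF t c4] weight_deg4_deg7[OF tuwv c4] nonneg(1) unfolding eq by linarith
    qed
  next
    case c55
    have "tri_at u = {{u, v, w}}" using deg5_deg5_small[OF t] c55 by simp
    then have "n_needy u \<le> 1" using n_needy_le[of u] by simp
    moreover have "needy u {u, v, w}" using c55 tr by (auto simp: needy_def)
    ultimately have "weight u {u, v, w} \<ge> 1" using weight_5[of "{u, v, w}" u 1] at c55 by simp
    then show ?thesis using nonneg by linarith
  next
    case c55'
    have "{v, u, w} \<in> T" "{v, u, w} = {u, v, w}" using t by (auto simp: insert_commute)
    then have "weight u {u, v, w} \<ge> 1 / 4" "weight v {u, v, w} \<ge> 1 / 4"
      using weight_deg5_deg5[OF t] weight_deg5_deg5[of v u w] c55' by auto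
    then show ?thesis using weight_8[of w "{u, v, w}"] c55' by simp
  next
    case c56
    have low: "low {u, v, w}" using c56 by (auto simp: low_def)
    have tau: "tau u v \<le> 1" "tau v u \<le> 1" using tau_le_1[OF deg5_deg6_common[OF t]] c56 by auto
    have "card (tri_at u) \<le> 4" "card (tri_at v) \<le> 5"
      using card_tri_at_less_if_tau_1[of v u] card_tri_at_less_if_tau_1[of u v] tau tr c56 by auto
    moreover have "needy u {u, v, w}" using c56 tr by (auto simp: needy_def)
    ultimately have "weight u {u, v, w} \<ge> 1 / 4" "weight v {u, v, w} \<ge> 2 / 5"
      using weight_5[of "{u, v, w}" u 4] weight_6'[of "{u, v, w}" v] at c56 low n_needy_le[of u] by auto
    moreover have "weight w {u, v, w} \<ge> 2 / 5"
    proof (cases "deg w = 7")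
      case True
      then show ?thesis using weight_7[of "{u, v, w}" w] at low by simp
    next
      case False
      then have w: "deg w = 6" using c56 d by simp
      have "tau w u \<le> 1" using tau_le_1[OF deg5_deg6_common[OF tuwv]] c56 w by auto
      then have "card (tri_at w) \<le> 5" using card_tri_at_less_if_tau_1[of u w] tr w by auto
      then show ?thesis using weight_6'[of "{u, v, w}" w] at low w by simp
    qed
    ultimately show ?thesis by linarith
  next
    case c56'
    have "card (tri_at u) \<le> 5" using card_tri_at_le[of u] c56' by simp
    moreover have "needy u {u, v, w}" using c56' tr by (auto simp: needy_def)
    ultimately have "weight u {u, v, w} \<ge> 1 / 5"
      using weight_5[of "{u, v, w}" u 5] at c56' n_needy_le[of u] by auto
    then show ?thesis using third(2) weight_8[of w "{u, v, w}"] c56' by simp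
  next
    case c57
    have low: "low {u, v, w}" using c57 by (auto simp: low_def)
    have w: "7 \<le> deg w" using c57 d by simp
    show ?thesis
    proof (cases "8 \<le> deg v")
      case True
      then show ?thesis using weight_8[of v "{u, v, w}"] weight_8[of w "{u, v, w}"] d nonneg by simp
    next
      case False
      then have v: "deg v = 7" using c57 by simp
      have "card (tri_at u) \<le> 5" using card_tri_at_le[of u] c57 by simp
      moreover have "needy u {u, v, w}" using v tr by (auto simp: needy_def)
      ultimately have "weight u {u, v, w} \<ge> 1 / 5"
        using weight_5[of "{u, v, w}" u 5] at c57 n_needy_le[of u] by auto
      moreover have "weight v {u, v, w} \<ge> 3 / 7" using weight_7[of "{u, v, w}" v] at low v by simp
      moreover have "weight w {u, v, w} \<ge> 3 / 7"
        using weight_7[of "{u, v, w}" w] at low w weight_8[of w "{u, v, w}"] by (cases "deg w = 7") auto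
      ultimately show ?thesis by simp
    qed
  next
    case c6
    then show ?thesis using third d by linarith
  qed
qed

lemma triangle_weight:
  assumes t: "t \<in> T" and d: "\<And>x. x \<in> t \<Longrightarrow> 4 \<le> deg x"
  shows "(\<Sum>x \<in> t. weight x t) \<ge> 1"
proof -
  have "t \<noteq> {}" using t T_sub by (auto simp: triangles_def)
  then obtain x y z where xyz: "t = {x, y, z}" using T_others[OF t] by blast
  obtain u v w where uvw: "{x, y, z} = {u, v, w}" "deg u \<le> deg v" "deg v \<le> deg w"
    using sort_three[of x y z deg] by blast
  have t': "{u, v, w} \<in> T" using t xyz uvw by simp
  note tr = T_triangle[OF t']
  have "weight u {u, v, w} + weight v {u, v, w} + weight w {u, v, w} \<ge> 1"
    using triangle_weight_sorted[OF t' _ uvw(2,3)] d xyz uvw(1) by auto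
  then show ?thesis using tr unfolding xyz uvw(1) by simp
qed

text \<open>Vertices of degree at most 3 (the set \<open>X\<close>) have negative charge, and the
  triangles \<open>TX\<close> through them may go unpaid. If there is only one such vertex, its
  charge deg - 4 and its at most deg triangles cost 4 in total, less than 6. If there are more,
  \<open>two_deg3\<close> leaves no triangle unpaid, and each of them gets 3/2 from its neighbours,
  more than its debt of 1.\<close>

lemma few_triangles: "card T + 4 * card V < 2 * card E + 6"
proof -
  define X where "X = {x \<in> V. deg x \<le> 3}"
  have X: "finite X" "X \<subseteq> V" using finite_V by (auto simp: X_def)
  define TX where "TX = {t \<in> T. t \<inter> X \<noteq> {}}"
  have swap: "(\<Sum>x \<in> V - X. \<Sum>t \<in> tri_at x. weight x t) = (\<Sum>t \<in> T. \<Sum>x \<in> {x \<in> V - X. x \<in> t}. weight x t)"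
    using sum.swap_restrict[of "V - X" T "\<lambda>x t. weight x t" "\<lambda>x t. x \<in> t"] finite_V finite_T
    by (simp add: tri_at_def)
  have per_t: "(\<Sum>x \<in> {x \<in> V - X. x \<in> t}. weight x t) \<ge> (if t \<in> TX then 0 else 1)" if t: "t \<in> T" for t
  proof (cases "t \<in> TX")
    case True
    then show ?thesis using t by (auto intro!: sum_nonneg weight_nonneg simp: tri_at_def)
  next
    case False
    then have tX: "t \<inter> X = {}" using t by (auto simp: TX_def)
    have "t \<subseteq> \<Union> E" using t T_sub triangles_subset by blast
    then have "t \<subseteq> V" using edge by blast
    then have "{x \<in> V - X. x \<in> t} = t" "\<And>x. x \<in> t \<Longrightarrow> 4 \<le> deg x"
      using tX by (auto simp: X_def)
    then show ?thesis using triangle_weight[OF t] False by simp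
  qed
  have "(\<Sum>t \<in> T. if t \<in> TX then 0 else 1 :: real) = real (card (T - TX))"
    using finite_T by (simp add: sum.If_cases Collect_neg_eq Diff_eq)
  also have "\<dots> = real (card T) - real (card TX)"
    using finite_T card_mono[of T TX] by (subst card_Diff_subset) (auto simp: TX_def of_nat_diff)
  finally have sumW: "(\<Sum>x \<in> V - X. \<Sum>t \<in> tri_at x. weight x t) \<ge> real (card T) - real (card TX)"
    unfolding swap using sum_mono[OF per_t, of T "\<lambda>t. t"] by simp
  have total: "(\<Sum>x \<in> V. real (deg x) - 4) = 2 * real (card E) - 4 * real (card V)"
    using sum_deg by (simp add: sum_subtractf flip: of_nat_sum)
  have split: "(\<Sum>x \<in> V. real (deg x) - 4) = (\<Sum>x \<in> V - X. real (deg x) - 4) + (\<Sum>x \<in> X. real (deg x) - 4)"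
    using X finite_V by (intro sum.subset_diff) auto
  have bound: "(\<Sum>x \<in> V. real (deg x) - 4) > real (card T) - 6"
  proof (cases "card X \<le> 1")
    case True
    have "(\<Sum>x \<in> V - X. real (deg x) - 4) \<ge> (\<Sum>x \<in> V - X. \<Sum>t \<in> tri_at x. weight x t)"
      using weight_budget[of _ "{}"] by (intro sum_mono) (auto simp: X_def)
    moreover have "(\<Sum>x \<in> X. real (deg x) - 4) - real (card TX) \<ge> - 4"
    proof (cases "X = {}")
      case True
      then have "TX = {}" by (auto simp: TX_def)
      then show ?thesis using True by simp
    next
      case False
      then obtain u where u: "X = {u}" using \<open>card X \<le> 1\<close> X(1) by (metis card_1_singletonE card_0_eq le_antisym less_one not_le)
      then have "TX = tri_at u" by (auto simp: TX_def tri_at_def)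
      then show ?thesis using u card_tri_at_le[of u] by simp
    qed
    ultimately show ?thesis using split sumW by linarith
  next
    case False
    have X3: "deg u = 3 \<and> tri_at u = {} \<and> (\<forall>b \<in> nbr u. deg b = 2 * k - 1)" if u: "u \<in> X" for u
    proof -
      have "\<not> X \<subseteq> {u}" using False card_mono[of "{u}" X] by auto
      then obtain v where "v \<in> X" "u \<noteq> v" by auto
      then have "u \<in> V" "v \<in> V" "deg u \<le> 3" "deg v \<le> 3" using u by (auto simp: X_def)
      note D = two_deg3[OF this(1,2) \<open>u \<noteq> v\<close> this(3,4)]
      show ?thesis using D by blast
    qed
    have "TX = {}" using X3 unfolding TX_def tri_at_def by blast
    have budget: "(\<Sum>t \<in> tri_at x. weight x t) + real (card (nbr x \<inter> X)) / 2 \<le> real (deg x) - 4"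
      if x: "x \<in> V - X" for x
    proof (rule weight_budget)
      show "4 \<le> deg x" using x by (auto simp: X_def)
      show "tau x y = 0" if y: "y \<in> nbr x \<inter> X" for y
      proof -
        have "{t \<in> T. {x, y} \<subseteq> t} \<subseteq> tri_at y" by (auto simp: tri_at_def)
        then have "{t \<in> T. {x, y} \<subseteq> t} = {}" using X3[of y] y by auto
        then show ?thesis by (metis card.empty)
      qed
      show "8 \<le> deg x \<or> nbr x \<inter> X = {}"
      proof (rule disjCI)
        assume "nbr x \<inter> X \<noteq> {}"
        then obtain y where "y \<in> nbr x" "y \<in> X" by auto
        then have "deg x = 2 * k - 1" using X3[of y] nbr_sym by auto
        then show "8 \<le> deg x" using k by simp
      qed
    qed auto
    \<comment> \<open>Edges between \<open>X\<close> and the rest: every neighbour of a vertex of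
      \<open>X\<close> has degree 2k - 1, so it lies outside \<open>X\<close>.\<close>
    have "(\<Sum>x \<in> V - X. card (nbr x \<inter> X)) = 3 * card X"
    proof -
      have "card {x \<in> V - X. y \<in> nbr x \<inter> X} = 3" if y: "y \<in> X" for y
      proof -
        have "{x \<in> V - X. y \<in> nbr x \<inter> X} = nbr y"
        proof (intro equalityI subsetI)
          fix x assume x: "x \<in> nbr y"
          then have "deg x = 2 * k - 1" "x \<in> V" using X3[OF y] nbrD by auto
          then show "x \<in> {x \<in> V - X. y \<in> nbr x \<inter> X}" using x y k nbr_sym by (auto simp: X_def)
        qed (use nbr_sym in auto)
        then show ?thesis using X3[OF y] by simp
      qed
      then have "(\<Sum>x \<in> V - X. card {y \<in> X. y \<in> nbr x \<inter> X}) = (\<Sum>y \<in> X. 3)"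
        using X finite_V by (intro sum_multicount_gen) auto
      moreover have "{y \<in> X. y \<in> nbr x \<inter> X} = nbr x \<inter> X" for x by auto
      ultimately show ?thesis by simp
    qed
    then have three: "(\<Sum>x \<in> V - X. real (card (nbr x \<inter> X)) / 2) = 3 * real (card X) / 2"
      by (simp flip: sum_divide_distrib of_nat_sum)
    have "(\<Sum>x \<in> V - X. real (deg x) - 4) \<ge> (\<Sum>x \<in> V - X. (\<Sum>t \<in> tri_at x. weight x t) + real (card (nbr x \<inter> X)) / 2)"
      using budget by (intro sum_mono) auto
    then have "(\<Sum>x \<in> V - X. real (deg x) - 4) \<ge> real (card T) + 3 * real (card X) / 2"
      using sumW three \<open>TX = {}\<close> by (simp add: sum.distrib)
    moreover have "(\<Sum>x \<in> X. real (deg x) - 4) = - real (card X)" using X3 by simp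
    ultimately show ?thesis using split by simp
  qed
  then show ?thesis using total by linarith
qed

end

text \<open>Double counting of edges in triangles gives 3 * card T at most 2 * card F, and the plane
  bound then leaves fewer than 3 * card W edges.\<close>

lemma (in simple_graph) plane_bound_degenerate:
  assumes bound: "\<And>W. W \<subseteq> V \<Longrightarrow> 2 \<le> card W \<Longrightarrow> plane_bound W {e \<in> E. e \<subseteq> W}"
    and W: "W \<subseteq> V" "W \<noteq> {}"
  shows "\<exists>x \<in> W. card (nbr x \<inter> W) \<le> 5"
proof (rule ccontr)
  assume n: "\<not> (\<exists>x \<in> W. card (nbr x \<inter> W) \<le> 5)"
  define F where "F = {e \<in> E. e \<subseteq> W}"
  interpret W: simple_graph W F
    by unfold_locales (use finite_subset[OF W(1) finite_V] edge in \<open>auto simp: F_def\<close>)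
  have nbrW: "W.nbr x = nbr x \<inter> W" if "x \<in> W" for x
    using that unfolding W.nbr_def unfolding nbr_def F_def by auto
  have six: "6 \<le> W.deg x" if "x \<in> W" for x
  proof -
    have "\<not> card (nbr x \<inter> W) \<le> 5" using n that by blast
    then show ?thesis using nbrW[OF that] by simp
  qed
  have "2 \<le> card W"
  proof -
    obtain x where x: "x \<in> W" using W by auto
    have "6 \<le> W.deg x" by (rule six[OF x])
    also have "\<dots> \<le> card W" using W.nbr_subset W.finite_V by (intro card_mono) auto
    finally show ?thesis by simp
  qed
  then obtain T where T: "T \<subseteq> triangles F" "\<forall>e\<in>F. card {t \<in> T. e \<subseteq> t} \<le> 2" "2 * card F + 6 \<le> card T + 4 * card W"
    using bound[OF W(1)] by (auto simp: plane_bound_def F_def)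
  have "finite T"
  proof -
    have "\<Union> F \<subseteq> W" using W.edge by auto
    then show ?thesis using finite_triangles[of F] T(1) W.finite_V finite_subset by metis
  qed
  have "card {e \<in> F. e \<subseteq> t} = 3" if t: "t \<in> T" for t
  proof -
    have tt: "t \<in> triangles F" using t T by auto
    then have "{e \<in> F. e \<subseteq> t} = {e. e \<subseteq> t \<and> card e = 2}"
      using W.edge triangles_edge[OF tt] by auto
    moreover have "card t = 3" using tt by (simp add: triangles_def)
    moreover have "finite t" using \<open>card t = 3\<close> by (metis card.infinite zero_neq_numeral)
    ultimately show ?thesis using n_subsets[of t 2] by (simp add: numeral_3_eq_3 numeral_2_eq_2)
  qed
  then have "(\<Sum>e \<in> F. card {t \<in> T. e \<subseteq> t}) = (\<Sum>t \<in> T. 3)"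
    using W.finite_E \<open>finite T\<close> by (intro sum_multicount_gen) auto
  moreover have "(\<Sum>e \<in> F. card {t \<in> T. e \<subseteq> t}) \<le> (\<Sum>e \<in> F. 2)" using T(2) by (intro sum_mono) auto
  ultimately have "3 * card T \<le> 2 * card F" by simp
  moreover have "6 * card W \<le> 2 * card F"
    using sum_mono[of W "\<lambda>_. 6" W.deg] six W.sum_deg by simp
  ultimately show False using T(3) by linarith
qed

theorem (in simple_graph) plane_bound_reducible:
  assumes bound: "\<And>W. W \<subseteq> V \<Longrightarrow> 2 \<le> card W \<Longrightarrow> plane_bound W {e \<in> E. e \<subseteq> W}"
    and k: "5 \<le> k" "k \<le> card V" and max_deg: "\<And>x. x \<in> V \<Longrightarrow> deg x \<le> 2 * k - 1"
  shows "reducible k"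
proof (rule ccontr)
  assume irr: "\<not> reducible k"
  have "{e \<in> E. e \<subseteq> V} = E" using edge by auto
  then have "plane_bound V E" using bound[of V] k by simp
  then obtain T where T: "T \<subseteq> triangles E" "\<forall>e\<in>E. card {t \<in> T. e \<subseteq> t} \<le> 2" "2 * card E + 6 \<le> card T + 4 * card V"
    by (auto simp: plane_bound_def)
  interpret irreducible_graph V E T k
    by unfold_locales (use T k max_deg irr plane_bound_degenerate[OF bound] in auto)
  show False using few_triangles T(3) by simp
qed

section \<open>Equitable list colouring\<close>

lemma ex_colour_used_at_most_once:
  assumes "finite A" "finite C" "card A < 2 * card C"
  shows "\<exists>\<alpha> \<in> C. card {y \<in> A. c y = \<alpha>} \<le> 1"
proof (rule ccontr)
  assume "\<not> ?thesis"
  then have "2 \<le> card {y \<in> A. c y = \<alpha>}" if "\<alpha> \<in> C" for \<alpha> using that by fastforce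
  then have "2 * card C \<le> (\<Sum>\<alpha> \<in> C. card {y \<in> A. c y = \<alpha>})"
    using sum_mono[of C "\<lambda>_. 2" "\<lambda>\<alpha>. card {y \<in> A. c y = \<alpha>}"] by simp
  also have "\<dots> = card (\<Union>\<alpha> \<in> C. {y \<in> A. c y = \<alpha>})"
    using assms by (subst card_UN_disjoint) auto
  also have "\<dots> \<le> card A" using assms by (intro card_mono) auto
  finally show False using assms(3) by simp
qed

context simple_graph
begin

text \<open>A form of acyclicity that is trivially kept when a vertex with at most one neighbour is added.\<close>

definition one_degenerate :: "'a set \<Rightarrow> bool" where
  "one_degenerate X \<longleftrightarrow> (\<forall>A \<subseteq> X. A \<noteq> {} \<longrightarrow> (\<exists>a \<in> A. card (nbr a \<inter> A) \<le> 1))"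

lemma extend_colouring:
  assumes xs: "distinct xs" "length xs \<le> k"
    and out: "\<And>j. j < length xs \<Longrightarrow> card (nbr (xs ! j) - set xs) \<le> 2 * (k - j) - 1"
    and L: "\<And>v. v \<in> set xs \<Longrightarrow> finite (L v) \<and> card (L v) = k"
  shows "\<exists>d. inj_on d (set xs) \<and>
    (\<forall>v \<in> set xs. d v \<in> L v \<and> card {y \<in> nbr v - set xs. c y = d v} \<le> 1)"
proof -
  have "\<exists>d. inj_on d (set (take i xs)) \<and>
    (\<forall>v \<in> set (take i xs). d v \<in> L v \<and> card {y \<in> nbr v - set xs. c y = d v} \<le> 1)"
    if "i \<le> length xs" for i
    using that
  proof (induction i)
    case 0
    then show ?case by simp
  next
    case (Suc i)
    then obtain d where d: "inj_on d (set (take i xs))"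
      "\<forall>v \<in> set (take i xs). d v \<in> L v \<and> card {y \<in> nbr v - set xs. c y = d v} \<le> 1" by auto
    define v where "v = xs ! i"
    have v: "v \<in> set xs" "v \<notin> set (take i xs)"
      using Suc(2) xs(1) by (auto simp: v_def in_set_conv_nth[of _ "take i xs"] nth_eq_iff_index_eq)
    have take: "set (take (Suc i) xs) = insert v (set (take i xs))"
      using Suc(2) by (simp add: take_Suc_conv_app_nth v_def)
    define C where "C = L v - d ` set (take i xs)"
    have "card (d ` set (take i xs)) \<le> i"
      using card_image_le[of "set (take i xs)" d] card_length[of "take i xs"] Suc(2) by simp
    then have "k - i \<le> card C"
      using L[OF v(1)] diff_card_le_card_Diff[of "d ` set (take i xs)" "L v"] by (simp add: C_def)
    moreover have "card (nbr v - set xs) \<le> 2 * (k - i) - 1" using out[of i] Suc(2) by (simp add: v_def)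
    ultimately have "card (nbr v - set xs) < 2 * card C" using Suc(2) xs(2) by linarith
    then obtain \<alpha> where \<alpha>: "\<alpha> \<in> C" "card {y \<in> nbr v - set xs. c y = \<alpha>} \<le> 1"
      using ex_colour_used_at_most_once[of "nbr v - set xs" C c] L[OF v(1)] by (auto simp: C_def)
    have "inj_on (d(v := \<alpha>)) (set (take (Suc i) xs))"
      using d(1) \<alpha>(1) v(2) unfolding take by (auto simp: inj_on_def C_def)
    moreover have "\<forall>w \<in> set (take (Suc i) xs). (d(v := \<alpha>)) w \<in> L w \<and>
        card {y \<in> nbr w - set xs. c y = (d(v := \<alpha>)) w} \<le> 1"
      using d(2) \<alpha> v(2) unfolding take by (auto simp: C_def)
    ultimately show ?case by blast
  qed
  from this[of "length xs"] show ?thesis by simp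
qed

text \<open>The inequality for the class sizes says "at most the ceiling of \<open>card W\<close>
  divided by \<open>k\<close>" without division; adding k vertices adds k to both sides for a class
  that grows by one. If \<open>xs\<close> is all of \<open>W\<close>, classes have at most one
  vertex. A class stays 1-degenerate because the new vertex has at most one neighbour in it.\<close>

lemma equitable_colouring_extend:
  assumes xs: "distinct xs" "length xs \<le> k" "set xs \<subseteq> W" "finite W" "length xs = k \<or> set xs = W"
    and out: "\<And>j. j < length xs \<Longrightarrow> card (nbr (xs ! j) \<inter> W - set xs) \<le> 2 * (k - j) - 1"
    and L: "\<And>v. v \<in> W \<Longrightarrow> finite (L v) \<and> card (L v) = k"
    and c: "\<forall>v \<in> W - set xs. c v \<in> L v"
      "\<forall>x. one_degenerate {v \<in> W - set xs. c v = x} \<and>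
        card {v \<in> W - set xs. c v = x} * k < card (W - set xs) + k"
  shows "\<exists>c. (\<forall>v \<in> W. c v \<in> L v) \<and>
    (\<forall>x. one_degenerate {v \<in> W. c v = x} \<and> card {v \<in> W. c v = x} * k < card W + k)"
proof -
  interpret W: simple_graph W "{e \<in> E. e \<subseteq> W}"
    by unfold_locales (use xs(4) edge in auto)
  have nbrW: "W.nbr x = nbr x \<inter> W" if "x \<in> W" for x
    using that unfolding W.nbr_def nbr_def by auto
  have outW: "card (W.nbr (xs ! j) - set xs) \<le> 2 * (k - j) - 1" if "j < length xs" for j
    using out[OF that] nbrW[of "xs ! j"] xs(3) that nth_mem by fastforce
  obtain d where d: "inj_on d (set xs)"
    "\<forall>v \<in> set xs. d v \<in> L v \<and> card {y \<in> W.nbr v - set xs. c y = d v} \<le> 1"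
    using W.extend_colouring[OF xs(1,2) outW, of L c] L xs(3) by blast
  define e where "e v = (if v \<in> set xs then d v else c v)" for v
  have e1: "\<forall>v \<in> W. e v \<in> L v" using c(1) d(2) by (auto simp: e_def)
  have "one_degenerate {v \<in> W. e v = x} \<and> card {v \<in> W. e v = x} * k < card W + k" for x
  proof (cases "\<exists>v \<in> set xs. d v = x")
    case False
    then have eq: "{v \<in> W. e v = x} = {v \<in> W - set xs. c v = x}" by (auto simp: e_def)
    have "card (W - set xs) \<le> card W" using xs(4) by (intro card_mono) auto
    then show ?thesis using c(2)[rule_format, of x] unfolding eq by linarith
  next
    case True
    then obtain v where v: "v \<in> set xs" "d v = x" by auto
    define Y where "Y = {v \<in> W - set xs. c v = x}"
    have uniq: "w = v" if "w \<in> set xs" "d w = x" for w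
      using that v d(1) by (auto simp: inj_on_def)
    have eq: "{v \<in> W. e v = x} = insert v Y"
      using v xs(3) by (auto simp: e_def Y_def dest: uniq split: if_splits)
    have vY: "v \<notin> Y" "finite Y" using v xs(4) by (auto simp: Y_def)
    have one: "card (nbr v \<inter> Y) \<le> 1"
    proof -
      have "{y \<in> W.nbr v - set xs. c y = d v} = nbr v \<inter> Y"
        using nbrW[of v] v xs(3) by (auto simp: Y_def)
      then show ?thesis using d(2) v by metis
    qed
    have "one_degenerate (insert v Y)"
      unfolding one_degenerate_def
    proof (intro allI impI)
      fix A assume A: "A \<subseteq> insert v Y" "A \<noteq> {}"
      show "\<exists>a \<in> A. card (nbr a \<inter> A) \<le> 1"
      proof (cases "v \<in> A")
        case True
        have "nbr v \<inter> A \<subseteq> nbr v \<inter> Y" using A nbrD by auto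
        then have "card (nbr v \<inter> A) \<le> card (nbr v \<inter> Y)" by (intro card_mono) auto
        then show ?thesis using True one by (metis le_trans)
      next
        case False
        then have "A \<subseteq> Y" using A by auto
        then show ?thesis using c(2) A(2) unfolding one_degenerate_def Y_def by blast
      qed
    qed
    moreover have "card (insert v Y) * k < card W + k"
    proof -
      have Yk: "card Y * k < card (W - set xs) + k" using c(2) by (simp add: Y_def)
      have "card (W - set xs) = card W - length xs"
        using xs by (simp add: card_Diff_subset distinct_card)
      moreover have "length xs \<le> card W" using xs(1,3,4) by (metis card_mono distinct_card)
      moreover have "card (W - set xs) = 0 \<and> 0 < card W" if "set xs = W"
        using that v xs(4) by (auto simp: card_gt_0_iff)
      ultimately show ?thesis
        using Yk xs(5) vY by (cases "length xs = k") auto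
    qed
    ultimately show ?thesis unfolding eq by simp
  qed
  with e1 show ?thesis by blast
qed

text \<open>The induction passes to induced subgraphs, hence the plane bound for every
  \<open>W\<close>. Fewer than k vertices are all put into \<open>xs\<close>, which leaves no outer
  neighbours.\<close>

theorem equitable_list_colouring:
  assumes bound: "\<And>W. W \<subseteq> V \<Longrightarrow> 2 \<le> card W \<Longrightarrow> plane_bound W {e \<in> E. e \<subseteq> W}"
    and k: "5 \<le> k" and max_deg: "\<And>x. x \<in> V \<Longrightarrow> deg x \<le> 2 * k - 1"
    and L: "\<And>v. v \<in> V \<Longrightarrow> finite (L v) \<and> card (L v) = k"
  shows "\<exists>c. (\<forall>v \<in> V. c v \<in> L v) \<and>
    (\<forall>x. one_degenerate {v \<in> V. c v = x} \<and> card {v \<in> V. c v = x} * k < card V + k)"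
proof -
  have "\<exists>c. (\<forall>v \<in> W. c v \<in> L v) \<and>
    (\<forall>x. one_degenerate {v \<in> W. c v = x} \<and> card {v \<in> W. c v = x} * k < card W + k)"
    if "W \<subseteq> V" for W
    using that
  proof (induction "card W" arbitrary: W rule: less_induct)
    case less
    have fW: "finite W" using less(2) finite_V finite_subset by auto
    have LW: "finite (L v) \<and> card (L v) = k" if "v \<in> W" for v using L less(2) that by auto
    interpret W: simple_graph W "{e \<in> E. e \<subseteq> W}"
      by unfold_locales (use fW edge in auto)
    have nbrW: "W.nbr x = nbr x \<inter> W" if "x \<in> W" for x
      using that unfolding W.nbr_def nbr_def by auto
    obtain xs where xs: "distinct xs" "length xs \<le> k" "set xs \<subseteq> W" "length xs = k \<or> set xs = W"
      "\<And>j. j < length xs \<Longrightarrow> card (nbr (xs ! j) \<inter> W - set xs) \<le> 2 * (k - j) - 1"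
    proof (cases "k \<le> card W")
      case True
      have "W.reducible k"
      proof (rule W.plane_bound_reducible[OF _ k True])
        fix U assume U: "U \<subseteq> W" "2 \<le> card U"
        have "{e \<in> {e \<in> E. e \<subseteq> W}. e \<subseteq> U} = {e \<in> E. e \<subseteq> U}" using U by auto
        then show "plane_bound U {e \<in> {e \<in> E. e \<subseteq> W}. e \<subseteq> U}" using bound[of U] U less(2) by auto
      next
        fix x assume x: "x \<in> W"
        have "W.deg x \<le> deg x" unfolding nbrW[OF x] by (intro card_mono) auto
        then show "W.deg x \<le> 2 * k - 1" using max_deg[of x] x less(2) by auto
      qed
      then obtain xs where xs: "distinct xs" "length xs = k" "set xs \<subseteq> W"
        "\<forall>j < k. card (W.nbr (xs ! j) - set xs) \<le> 2 * (k - j) - 1" by (auto simp: W.reducible_def)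
      show ?thesis
      proof (rule that[of xs])
        fix j assume j: "j < length xs"
        then have "xs ! j \<in> W" using xs(3) by auto
        then show "card (nbr (xs ! j) \<inter> W - set xs) \<le> 2 * (k - j) - 1"
          using xs(2,4) j nbrW[of "xs ! j"] by auto
      qed (use xs in auto)
    next
      case False
      obtain xs where xs: "set xs = W" "distinct xs" using finite_distinct_list[OF fW] by blast
      have "nbr y \<inter> W - set xs = {}" for y using xs by auto
      then have z: "card (nbr y \<inter> W - set xs) \<le> n" for y n by (metis card.empty zero_le)
      show ?thesis
        by (rule that[of xs, OF xs(2) _ _ _ z]) (use xs False distinct_card[OF xs(2)] in simp_all)
    qed
    show ?case
    proof (cases "W = {}")
      case True
      then show ?thesis using k by (simp add: one_degenerate_def)
    next
      case False
      then have "xs \<noteq> []" using xs(4) k by auto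
      then have "W - set xs \<subset> W" using xs(3) by (cases xs) auto
      then have "card (W - set xs) < card W" using fW by (intro psubset_card_mono)
      then obtain c where c: "\<forall>v \<in> W - set xs. c v \<in> L v"
        "\<forall>x. one_degenerate {v \<in> W - set xs. c v = x} \<and>
          card {v \<in> W - set xs. c v = x} * k < card (W - set xs) + k"
        using less(1)[of "W - set xs"] less(2) by blast
      show ?thesis
        by (rule equitable_colouring_extend[OF xs(1-3) fW xs(4) _ _ c]) (use xs(5) LW in auto)
    qed
  qed
  then show ?thesis by blast
qed

end

section \<open>From symmetric digraphs to vertex and edge sets\<close>

lemma edge_undirected_edges:
  assumes "graph G" "e \<in> undirected_edges G"
  shows "e \<subseteq> verts G \<and> card e = 2"
proof -
  interpret graph G by fact
  obtain u v where e: "e = {u, v}" "u \<rightarrow>\<^bsub>G\<^esub> v" using assms(2) by (auto simp: undirected_edges_def)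
  then have "u \<in> verts G" "v \<in> verts G" "u \<noteq> v"
    using no_loops by (auto simp: arcs_ends_conv)
  then show ?thesis using e by auto
qed

lemma plane_graph_drawing:
  assumes "graph G" "plane_drawing G \<phi> \<gamma>"
  shows "plane_graph (verts G) (undirected_edges G) \<phi> \<gamma>"
proof -
  interpret graph G by fact
  show ?thesis
    by unfold_locales (use assms edge_undirected_edges in \<open>auto simp: plane_drawing_def\<close>)
qed

lemma simple_graph_undirected:
  assumes "graph G" shows "simple_graph (verts G) (undirected_edges G)"
proof -
  interpret graph G by fact
  show ?thesis by unfold_locales (use assms edge_undirected_edges in auto)
qed

lemma nbr_undirected:
  assumes "graph G"
  shows "simple_graph.nbr (undirected_edges G) x = {y. x \<rightarrow>\<^bsub>G\<^esub> y}"
proof -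
  interpret graph G by fact
  interpret simple_graph "verts G" "undirected_edges G" using assms by (rule simple_graph_undirected)
  show ?thesis
    using arcs_ends_symmetric[OF sym_arcs] unfolding nbr_def
    by (auto simp: undirected_edges_def doubleton_eq_iff)
qed

lemma card_nbr_undirected:
  assumes "graph G"
  shows "card (simple_graph.nbr (undirected_edges G) x) = out_degree G x"
proof -
  interpret graph G by fact
  have "inj_on (head G) (out_arcs G x)"
    by (auto simp: inj_on_def arc_to_ends_def intro: no_multi_arcs)
  moreover have "head G ` out_arcs G x = {y. x \<rightarrow>\<^bsub>G\<^esub> y}"
    by (auto simp: arcs_ends_conv)
  ultimately show ?thesis
    unfolding nbr_undirected[OF assms] out_degree_def by (metis card_image)
qed

lemma cas_last:
  assumes "pre_digraph.cas G u p v" "p \<noteq> []"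
  shows "head G (last p) = v"
  using assms
  by (induction p arbitrary: u) (auto simp: pre_digraph.cas.simps)

text \<open>On a cycle of length at least 3 every vertex has two neighbours.\<close>

lemma undirected_acyclic_if_one_degenerate:
  assumes G: "graph G" and X: "X \<subseteq> verts G"
    and deg: "simple_graph.one_degenerate (undirected_edges G) X"
  shows "undirected_acyclic (G \<restriction> X)"
  unfolding undirected_acyclic_def
proof
  interpret simple_graph "verts G" "undirected_edges G" using G by (rule simple_graph_undirected)
  note deg = deg[unfolded one_degenerate_def]
  assume "\<exists>p. pre_digraph.cycle (G \<restriction> X) p \<and> 3 \<le> length p"
  then obtain p u where p: "3 \<le> length p" "pre_digraph.awalk (G \<restriction> X) u p u"
    "distinct (tl (pre_digraph.awalk_verts (G \<restriction> X) u p))"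
    by (auto simp: pre_digraph.cycle_def)
  define n where "n = length p"
  have cas: "pre_digraph.cas (G \<restriction> X) u p u" and arcs: "set p \<subseteq> arcs (G \<restriction> X)"
    using p(2) by (auto simp: pre_digraph.awalk_def)
  have ne: "p \<noteq> []" using p(1) by auto
  have verts: "pre_digraph.awalk_verts (G \<restriction> X) u p = tail G (hd p) # map (head G) p"
    "pre_digraph.awalk_verts (G \<restriction> X) u p = map (tail G) p @ [head G (last p)]"
    using pre_digraph.awalk_verts_conv'[OF cas] pre_digraph.awalk_verts_conv[of "G \<restriction> X" u p] ne by simp_all
  define h where "h i = head G (p ! i)" for i
  have dist: "h i \<noteq> h j" if "i < n" "j < n" "i \<noteq> j" for i j
    using p(3) that unfolding verts(1) by (auto simp: h_def n_def distinct_conv_nth)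
  have step: "tail G (p ! Suc i) = h i" if "Suc i < n" for i
  proof -
    have "(map (tail G) p @ [head G (last p)]) ! Suc i = (tail G (hd p) # map (head G) p) ! Suc i"
      using verts by simp
    then show ?thesis using that by (simp add: nth_append h_def n_def)
  qed
  have "tail G (hd p) = u" using cas ne by (cases p) (auto simp: pre_digraph.cas.simps)
  moreover have "head G (last p) = u" using cas_last[OF cas ne] by simp
  ultimately have wrap: "tail G (p ! 0) = h (n - 1)"
    using ne by (simp add: h_def n_def hd_conv_nth last_conv_nth)
  \<comment> \<open>The vertices of the cycle; 1-degeneracy supplies one with at most one neighbour
    among them.\<close>
  define A where "A = h ` {..<n}"
  have arc: "p ! i \<in> arcs G" "h i \<in> X" if "i < n" for i
    using subsetD[OF arcs nth_mem[of i p]] that by (auto simp: n_def h_def)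
  have dom: "tail G (p ! i) \<rightarrow>\<^bsub>G\<^esub> h i" if "i < n" for i
    using arc(1)[OF that] by (auto simp: arcs_ends_conv h_def)
  have AX: "A \<subseteq> X" using arc by (auto simp: A_def)
  have "h 0 \<in> A" unfolding A_def n_def by (rule imageI) (use ne in simp)
  then have "A \<noteq> {}" by blast
  then obtain a where a: "a \<in> A" "card (nbr a \<inter> A) \<le> 1" using deg AX by blast
  then obtain i where i: "i < n" "a = h i" by (auto simp: A_def)
  \<comment> \<open>Cyclic predecessor and successor. They differ because the length is at least 3;
    for an edge traversed back and forth they would coincide.\<close>
  define pre where "pre = (if i = 0 then n - 1 else i - 1)"
  define suc where "suc = (if i = n - 1 then 0 else Suc i)"
  have idx: "pre < n" "suc < n" "pre \<noteq> suc" using i(1) p(1) by (auto simp: pre_def suc_def n_def)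
  have "h pre \<rightarrow>\<^bsub>G\<^esub> a"
    using dom[OF i(1)] step[of "i - 1"] wrap i by (cases "i = 0") (auto simp: pre_def)
  then have "a \<in> nbr (h pre)" by (simp add: nbr_undirected[OF G])
  then have pre: "h pre \<in> nbr a" using nbr_sym by blast
  have "a \<rightarrow>\<^bsub>G\<^esub> h suc"
    using dom[OF idx(2)] step[of i] wrap i by (cases "i = n - 1") (auto simp: suc_def)
  then have suc: "h suc \<in> nbr a" by (simp add: nbr_undirected[OF G])
  have "{h pre, h suc} \<subseteq> nbr a \<inter> A" using pre suc idx by (auto simp: A_def)
  then have "card {h pre, h suc} \<le> card (nbr a \<inter> A)" by (intro card_mono) auto
  then show False using dist[OF idx] a(2) by simp
qed

theorem theorem4:
  fixes G :: "('a, 'b) pre_digraph" and k :: nat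
  assumes "graph G"
    and "planar_graph G"
    and "int k \<ge> max \<lceil>(real (max_degree G) + 1) / 2\<rceil> 5"
  shows "equitable_list_point_arborable TYPE('c) G k"
  unfolding equitable_list_point_arborable_def
proof (intro allI impI)
  fix L :: "'a \<Rightarrow> 'c set" assume L: "list_assignment G k L"
  interpret graph G by fact
  interpret simple_graph "verts G" "undirected_edges G" using assms(1) by (rule simple_graph_undirected)
  obtain \<phi> \<gamma> where "plane_drawing G \<phi> \<gamma>" using assms(2) by (auto simp: planar_graph_def)
  then interpret plane: plane_graph "verts G" "undirected_edges G" \<phi> \<gamma>
    by (rule plane_graph_drawing[OF assms(1)])
  have k: "5 \<le> k" using assms(3) by simp
  have bound: "plane_bound W {e \<in> undirected_edges G. e \<subseteq> W}" if "W \<subseteq> verts G" "2 \<le> card W" for W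
    by (rule plane_graph_bound[OF plane.plane_subgraph]) (use that in auto)
  have "\<lceil>(real (max_degree G) + 1) / 2\<rceil> \<le> int k" using assms(3) by simp
  then have "(real (max_degree G) + 1) / 2 \<le> real k" by (simp add: ceiling_le_iff)
  then have "real (max_degree G + 1) \<le> real (2 * k)" by simp
  then have "max_degree G + 1 \<le> 2 * k" by (simp only: of_nat_le_iff)
  then have max: "max_degree G \<le> 2 * k - 1" by linarith
  have "deg x \<le> 2 * k - 1" if "x \<in> verts G" for x
  proof -
    have "out_degree G x \<le> max_degree G" using that by (simp add: max_degree_def)
    then show ?thesis using max by (simp add: card_nbr_undirected[OF assms(1)])
  qed
  then obtain c where c: "\<forall>v \<in> verts G. c v \<in> L v"
    "\<forall>x. one_degenerate {v \<in> verts G. c v = x} \<and> card {v \<in> verts G. c v = x} * k < card (verts G) + k"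
    using equitable_list_colouring[OF bound k, of L] L by (auto simp: list_assignment_def)
  have "int (card {v \<in> verts G. c v = x}) \<le> \<lceil>real (card (verts G)) / real k\<rceil>" for x
  proof -
    have "real (card {v \<in> verts G. c v = x} * k) < real (card (verts G) + k)"
      using c(2) of_nat_less_iff by blast
    then have "real (card {v \<in> verts G. c v = x}) - 1 < real (card (verts G)) / real k"
      using k by (simp add: field_simps)
    \<comment> \<open>For an integer m, m - 1 < r is equivalent to m being at most the ceiling of
      r.\<close>
    then have "of_int (int (card {v \<in> verts G. c v = x}) - 1) < real (card (verts G)) / real k" by simp
    then have "int (card {v \<in> verts G. c v = x}) - 1 < \<lceil>real (card (verts G)) / real k\<rceil>"
      by (simp only: less_ceiling_iff)
    then show ?thesis by simp
  qed
  moreover have "undirected_acyclic (G \<restriction> {v \<in> verts G. c v = x})" for x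
    using c(2) by (intro undirected_acyclic_if_one_degenerate[OF assms(1)]) auto
  ultimately show "\<exists>c. (\<forall>v \<in> verts G. c v \<in> L v) \<and>
      (\<forall>x. undirected_acyclic (G \<restriction> {v \<in> verts G. c v = x}) \<and>
        int (card {v \<in> verts G. c v = x}) \<le> \<lceil>real (card (verts G)) / real k\<rceil>)"
    using c(1) by blast
qed

end
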